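(* Let $X$ and $Y$ be based spaces satisfying the standing assumptions in the context. (1) If $Y$ is a $T$-space, then so is $\mathrm{map}(X,Y;0)$. (2) Suppose that $\Sigma X$ splits as (is homotopy equivalent to) some wedge of spheres. If $Y$ is a $G$-space, then so is $\mathrm{map}(X,Y;0)$.
   Context: Standing assumptions: $X$ and $Y$ are based spaces that are connected, locally compact, Hausdorff and well-pointed (no finiteness or simple connectivity is assumed). $\Sigma$ is reduced suspension. Mapping spaces consist of unbased maps and carry the compact-open topology. $\mathrm{map}(X,Y;0)$ denotes the path component of the null (constant) map in the space of unbased maps $X\to Y$, based at the constant map at the basepoint of $Y$. A $T$-space is a space $Z$ for which the free loop fibration $\Omega Z\to Z^{S^1}\to Z$ (evaluation of free loops at the basepoint of $S^1$) is fibre-homotopically trivial. For a based space $Z$, $\mathrm{aut}_1 Z$ denotes the path component of the identity map $1_Z$ in the space of unbased self-maps of $Z$, based at $1_Z$, and $\omega\colon \mathrm{aut}_1 Z\to Z$ is evaluation at the basepoint of $Z$. The $n$th Gottlieb group $G_n(Z)$ is the image of $\omega_\#\colon\pi_n(\mathrm{aut}_1 Z)\to\pi_n(Z)$. A $G$-space is a space $Z$ with $G_n(Z)=\pi_n(Z)$ for all $n\ge1$. *)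

theory Defs
  imports "HOL-Analysis.Analysis"
begin

section \<open>Well-pointed spaces\<close>

abbreviation unit_interval :: "real topology"
  where "unit_interval \<equiv> top_of_set {0..1}"

text \<open>The homotopy extension property of the pair \<open>(X, A)\<close> for the single target space \<open>Z\<close>.\<close>

definition homotopy_extension :: "'a topology \<Rightarrow> 'a set \<Rightarrow> 'c topology \<Rightarrow> bool" where
  "homotopy_extension X A Z \<longleftrightarrow>
     (\<forall>f h. continuous_map X Z f \<and>
            continuous_map (prod_topology unit_interval (subtopology X A)) Z h \<and>
            (\<forall>a \<in> topspace X \<inter> A. h (0, a) = f a) \<longrightarrow>
        (\<exists>H. continuous_map (prod_topology unit_interval X) Z H \<and>
             (\<forall>x \<in> topspace X. H (0, x) = f x) \<and>
             (\<forall>t \<in> {0..1}. \<forall>a \<in> topspace X \<inter> A. H (t, a) = h (t, a))))"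

text \<open>
  Well-pointed: the inclusion of the base point is a cofibration.  A definition cannot quantify
  over all types of target spaces, so the targets here are all the topologies on the type of
  \<open>I \<times> X\<close>.  Among these is the mapping cylinder of the inclusion, so for Hausdorff \<open>X\<close> nothing
  is lost: see \<open>well_pointed_homotopy_extension\<close> below.
\<close>

definition well_pointed :: "'a topology \<Rightarrow> 'a \<Rightarrow> bool" where
  "well_pointed X x0 \<longleftrightarrow>
     x0 \<in> topspace X \<and> (\<forall>Z :: (real \<times> 'a) topology. homotopy_extension X {x0} Z)"

lemma well_pointed_homotopy_extension:
  fixes X :: "'a topology" and Z :: "'c topology"
  assumes "well_pointed X x0" "Hausdorff_space X"
  shows "homotopy_extension X {x0} Z"
  unfolding homotopy_extension_def
proof (intro allI impI, elim conjE)
  fix f h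
  assume f: "continuous_map X Z f"
    and h: "continuous_map (prod_topology unit_interval (subtopology X {x0})) Z h"
    and fh: "\<forall>a\<in>topspace X \<inter> {x0}. h (0, a) = f a"
  have x0: "x0 \<in> topspace X" using assms(1) by (simp add: well_pointed_def)
  have cl: "closedin X {x0}"
    using assms(2) x0 by (simp add: closedin_Hausdorff_singleton)
  define P where "P = prod_topology unit_interval X"
  define A where "A = {0::real} \<times> topspace X"
  define B where "B = {0..1::real} \<times> {x0}"
  define M where "M = subtopology P (A \<union> B)"
  have topP: "topspace P = {0..1} \<times> topspace X" by (simp add: P_def)
  have AB: "A \<subseteq> topspace P" "B \<subseteq> topspace P" using x0 by (auto simp: topP A_def B_def)
  have "continuous_map X P (\<lambda>x. (0, x))"
    unfolding P_def by (intro continuous_map_pairedI) auto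
  then have i0: "continuous_map X M (\<lambda>x. (0, x))"
    unfolding M_def by (auto simp: continuous_map_in_subtopology A_def)
  have "continuous_map (prod_topology unit_interval (subtopology X {x0})) P (\<lambda>z. (fst z, snd z))"
    unfolding P_def
  proof (rule continuous_map_pairedI)
    show "continuous_map (prod_topology unit_interval (subtopology X {x0})) unit_interval fst"
      by (rule continuous_map_fst)
    have "continuous_map (prod_topology unit_interval (subtopology X {x0})) (subtopology X {x0}) snd"
      by (rule continuous_map_snd)
    then show "continuous_map (prod_topology unit_interval (subtopology X {x0})) X snd"
      using continuous_map_in_subtopology by blast
  qed
  then have i1: "continuous_map (prod_topology unit_interval (subtopology X {x0})) M (\<lambda>z. z)"
    unfolding M_def by (auto simp: continuous_map_in_subtopology B_def)
  have "homotopy_extension X {x0} M"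
    using assms(1) by (simp add: well_pointed_def)
  then have "\<exists>R. continuous_map P M R \<and> (\<forall>x\<in>topspace X. R (0, x) = (0, x)) \<and>
      (\<forall>t\<in>{0..1}. \<forall>a\<in>topspace X \<inter> {x0}. R (t, a) = (t, a))"
    unfolding homotopy_extension_def P_def using i0 i1 by blast
  then obtain R where R: "continuous_map P M R"
    and R0: "\<forall>x\<in>topspace X. R (0, x) = (0, x)"
    and R1: "\<forall>t\<in>{0..1}. \<forall>a\<in>topspace X \<inter> {x0}. R (t, a) = (t, a)"
    by blast
  define k where "k = (\<lambda>z. if z \<in> A then f (snd z) else h z)"
  have clA: "closedin M A" and clB: "closedin M B"
  proof -
    have "closedin unit_interval {0}" "closedin unit_interval {0..1}"
      by (auto intro!: closed_subset)
    then have "closedin P A" "closedin P B"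
      using cl unfolding P_def A_def B_def by (auto simp: closedin_prod_Times_iff)
    then show "closedin M A" "closedin M B"
      unfolding M_def by (auto intro!: closedin_subset_topspace)
  qed
  have topM: "topspace M = A \<union> B" using AB by (auto simp: M_def)
  have agree: "f (snd z) = h z" if "z \<in> A" "z \<in> B" for z
    using that fh x0 by (auto simp: A_def B_def)
  have cA: "continuous_map (subtopology M A) Z k"
  proof -
    have "continuous_map (subtopology M A) X snd"
      unfolding M_def P_def
      by (intro continuous_map_from_subtopology continuous_map_snd)
    then have "continuous_map (subtopology M A) Z (f \<circ> snd)"
      using f continuous_map_compose by blast
    then show ?thesis
      by (rule continuous_map_eq) (auto simp: k_def)
  qed
  have cB: "continuous_map (subtopology M B) Z k"
  proof -
    have "subtopology M B = subtopology P B"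
      unfolding M_def by (simp add: subtopology_subtopology Int_absorb1)
    also have "\<dots> = prod_topology (subtopology unit_interval {0..1}) (subtopology X {x0})"
      unfolding P_def B_def by (rule subtopology_Times)
    finally have eq: "subtopology M B = prod_topology unit_interval (subtopology X {x0})"
      by (simp add: subtopology_subtopology)
    have "continuous_map (subtopology M B) Z h" unfolding eq by (rule h)
    then show ?thesis
      by (rule continuous_map_eq) (use agree in \<open>auto simp: k_def\<close>)
  qed
  have k: "continuous_map M Z k"
    unfolding continuous_map_closedin
  proof (intro conjI allI impI)
    show "k \<in> topspace M \<rightarrow> topspace Z"
      using cA cB topM unfolding continuous_map_def by (auto simp: Pi_iff)
    fix C assume C: "closedin Z C"
    have "closedin (subtopology M A) {x \<in> topspace (subtopology M A). k x \<in> C}"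
      "closedin (subtopology M B) {x \<in> topspace (subtopology M B). k x \<in> C}"
      using cA cB C by (simp_all only: continuous_map_closedin)
    then have "closedin M {x \<in> topspace (subtopology M A). k x \<in> C}"
      "closedin M {x \<in> topspace (subtopology M B). k x \<in> C}"
      using clA clB closedin_trans_full by blast+
    moreover have "{x \<in> topspace M. k x \<in> C} =
       {x \<in> topspace (subtopology M A). k x \<in> C} \<union> {x \<in> topspace (subtopology M B). k x \<in> C}"
      using topM by auto
    ultimately show "closedin M {x \<in> topspace M. k x \<in> C}" by (simp only: closedin_Un)
  qed
  show "\<exists>H. continuous_map (prod_topology unit_interval X) Z H \<and>
      (\<forall>x\<in>topspace X. H (0, x) = f x) \<and>
      (\<forall>t\<in>{0..1}. \<forall>a\<in>topspace X \<inter> {x0}. H (t, a) = h (t, a))"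
  proof (intro exI conjI ballI)
    show "continuous_map (prod_topology unit_interval X) Z (k \<circ> R)"
      using R k continuous_map_compose unfolding P_def by blast
    show "(k \<circ> R) (0, x) = f x" if "x \<in> topspace X" for x
      using that R0 by (simp add: k_def A_def)
    show "(k \<circ> R) (t, a) = h (t, a)" if "t \<in> {0..1}" "a \<in> topspace X \<inter> {x0}" for t a
    proof -
      have "R (t, a) = (t, a)" using R1 that by blast
      then show ?thesis using that agree[of "(t, a)"] by (auto simp: k_def B_def)
    qed
  qed
qed

section \<open>Mapping spaces\<close>

text \<open>
  Continuous maps are represented by functions that are \<open>undefined\<close> outside \<open>topspace X\<close>, so that
  each map is represented exactly once.  The instance \<open>K = {}\<close> of the subbasis is the whole set.
\<close>

definition maps :: "'a topology \<Rightarrow> 'b topology \<Rightarrow> ('a \<Rightarrow> 'b) set" where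
  "maps X Y = {f \<in> extensional (topspace X). continuous_map X Y f}"

definition mapping_space :: "'a topology \<Rightarrow> 'b topology \<Rightarrow> ('a \<Rightarrow> 'b) topology" where
  "mapping_space X Y =
     topology_generated_by {{f \<in> maps X Y. f ` K \<subseteq> U} |K U. compactin X K \<and> openin Y U}"

lemma topspace_mapping_space [simp]: "topspace (mapping_space X Y) = maps X Y"
proof -
  have "maps X Y = {f \<in> maps X Y. f ` {} \<subseteq> {}}" by simp
  then have "maps X Y \<in> {{f \<in> maps X Y. f ` K \<subseteq> U} |K U. compactin X K \<and> openin Y U}"
    using compactin_empty openin_empty by blast
  then show ?thesis
    unfolding mapping_space_def topology_generated_by_topspace by blast
qed

definition null_map :: "'a topology \<Rightarrow> 'b \<Rightarrow> 'a \<Rightarrow> 'b" where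
  "null_map X y0 = (\<lambda>x \<in> topspace X. y0)"

definition null_component :: "'a topology \<Rightarrow> 'b topology \<Rightarrow> 'b \<Rightarrow> ('a \<Rightarrow> 'b) topology" where
  "null_component X Y y0 =
     subtopology (mapping_space X Y)
       (path_component_of_set (mapping_space X Y) (null_map X y0))"

definition identity_map :: "'a topology \<Rightarrow> 'a \<Rightarrow> 'a" where
  "identity_map Z = (\<lambda>z \<in> topspace Z. z)"

definition aut1 :: "'a topology \<Rightarrow> ('a \<Rightarrow> 'a) topology" where
  "aut1 Z =
     subtopology (mapping_space Z Z)
       (path_component_of_set (mapping_space Z Z) (identity_map Z))"


section \<open>T-spaces\<close>

text \<open>The point \<open>(1, 0, 0, \<dots>)\<close>, which lies on \<open>nsphere n\<close> for every \<open>n\<close>.\<close>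

definition sphere_base :: "nat \<Rightarrow> real" where
  "sphere_base = (\<lambda>i. if i = 0 then 1 else 0)"

lemma sphere_base_in_nsphere: "sphere_base \<in> topspace (nsphere n)"
  by (auto simp: nsphere sphere_base_def if_distrib[of "\<lambda>x. x ^ 2"] cong: if_cong)

definition fibre_homotopy_equivalent ::
  "'e topology \<Rightarrow> ('e \<Rightarrow> 'b) \<Rightarrow> 'f topology \<Rightarrow> ('f \<Rightarrow> 'b) \<Rightarrow> bool" where
  "fibre_homotopy_equivalent E p E' p' \<longleftrightarrow>
     (\<exists>f g. continuous_map E E' f \<and> (\<forall>e \<in> topspace E. p' (f e) = p e) \<and>
            continuous_map E' E g \<and> (\<forall>e \<in> topspace E'. p (g e) = p' e) \<and>
            homotopic_with (\<lambda>h. \<forall>e \<in> topspace E. p (h e) = p e) E E (g \<circ> f) id \<and>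
            homotopic_with (\<lambda>h. \<forall>e \<in> topspace E'. p' (h e) = p' e) E' E' (f \<circ> g) id)"

definition fibre_homotopically_trivial ::
  "'e topology \<Rightarrow> ('e \<Rightarrow> 'b) \<Rightarrow> 'b topology \<Rightarrow> 'b \<Rightarrow> bool" where
  "fibre_homotopically_trivial E p B b0 \<longleftrightarrow>
     fibre_homotopy_equivalent E p
       (prod_topology B (subtopology E {e \<in> topspace E. p e = b0})) fst"

definition free_loop_space :: "'a topology \<Rightarrow> ((nat \<Rightarrow> real) \<Rightarrow> 'a) topology" where
  "free_loop_space Z = mapping_space (nsphere 1) Z"

text \<open>The fibre of the evaluation map over \<open>z0\<close> is the based loop space \<open>\<Omega>Z\<close>.\<close>

definition T_space :: "'a topology \<Rightarrow> 'a \<Rightarrow> bool" where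
  "T_space Z z0 \<longleftrightarrow>
     fibre_homotopically_trivial (free_loop_space Z) (\<lambda>\<gamma>. \<gamma> sphere_base) Z z0"


section \<open>Gottlieb groups and G-spaces\<close>

text \<open>
  Only the underlying sets of the homotopy groups are introduced: the group structure plays no
  role in forming the image of \<open>\<omega>\<^sub>#\<close> or in comparing it with \<open>\<pi>\<^sub>n(Z)\<close>.
\<close>

definition based_maps :: "nat \<Rightarrow> 'a topology \<Rightarrow> 'a \<Rightarrow> ((nat \<Rightarrow> real) \<Rightarrow> 'a) set" where
  "based_maps n Z z0 = {f. continuous_map (nsphere n) Z f \<and> f sphere_base = z0}"

definition based_class ::
  "nat \<Rightarrow> 'a topology \<Rightarrow> 'a \<Rightarrow> ((nat \<Rightarrow> real) \<Rightarrow> 'a) \<Rightarrow> ((nat \<Rightarrow> real) \<Rightarrow> 'a) set" where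
  "based_class n Z z0 f = {g. homotopic_with (\<lambda>h. h sphere_base = z0) (nsphere n) Z f g}"

definition homotopy_group :: "nat \<Rightarrow> 'a topology \<Rightarrow> 'a \<Rightarrow> ((nat \<Rightarrow> real) \<Rightarrow> 'a) set set" where
  "homotopy_group n Z z0 = based_class n Z z0 ` based_maps n Z z0"

text \<open>
  The union is over representatives of the class \<open>c\<close>, all of which give the same class: see
  \<open>induced_map_based_class\<close>.
\<close>

definition induced_map ::
  "nat \<Rightarrow> 'b topology \<Rightarrow> 'b \<Rightarrow> ('a \<Rightarrow> 'b) \<Rightarrow> ((nat \<Rightarrow> real) \<Rightarrow> 'a) set \<Rightarrow> ((nat \<Rightarrow> real) \<Rightarrow> 'b) set" where
  "induced_map n Z z0 \<phi> c = (\<Union>f \<in> c. based_class n Z z0 (\<phi> \<circ> f))"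

lemma induced_map_based_class:
  assumes \<phi>: "continuous_map W Z \<phi>" "\<phi> w0 = z0" and f: "f \<in> based_maps n W w0"
  shows "induced_map n Z z0 \<phi> (based_class n W w0 f) = based_class n Z z0 (\<phi> \<circ> f)"
proof -
  have "f \<in> based_class n W w0 f"
    using f by (simp add: based_class_def based_maps_def)
  moreover have "based_class n Z z0 (\<phi> \<circ> g) = based_class n Z z0 (\<phi> \<circ> f)"
    if "g \<in> based_class n W w0 f" for g
  proof -
    have "homotopic_with (\<lambda>h. h sphere_base = w0) (nsphere n) W f g"
      using that by (simp add: based_class_def)
    then have "homotopic_with (\<lambda>h. h sphere_base = z0) (nsphere n) Z (\<phi> \<circ> f) (\<phi> \<circ> g)"
      by (rule homotopic_with_compose_continuous_map_left) (use \<phi> in auto)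
    then show ?thesis
      unfolding based_class_def
      by (intro Collect_cong iffI) (blast intro: homotopic_with_symD homotopic_with_trans)+
  qed
  ultimately show ?thesis unfolding induced_map_def by blast
qed

definition gottlieb_group :: "nat \<Rightarrow> 'a topology \<Rightarrow> 'a \<Rightarrow> ((nat \<Rightarrow> real) \<Rightarrow> 'a) set set" where
  "gottlieb_group n Z z0 =
     induced_map n Z z0 (\<lambda>f. f z0) ` homotopy_group n (aut1 Z) (identity_map Z)"

definition G_space :: "'a topology \<Rightarrow> 'a \<Rightarrow> bool" where
  "G_space Z z0 \<longleftrightarrow> (\<forall>n \<ge> 1. gottlieb_group n Z z0 = homotopy_group n Z z0)"


section \<open>Reduced suspensions and wedges of spheres\<close>

text \<open>
  The quotient \<open>X/A\<close>, with base point \<open>None\<close> the class of \<open>A\<close>.  For \<open>A = {}\<close> this is \<open>X\<close> with a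
  disjoint base point added, so that in particular \<open>{}/{}\<close> is a single point.
\<close>

definition collapse :: "'a set \<Rightarrow> 'a \<Rightarrow> 'a option" where
  "collapse A x = (if x \<in> A then None else Some x)"

definition quotient_space :: "'a topology \<Rightarrow> 'a set \<Rightarrow> 'a option topology" where
  "quotient_space X A =
     topology (\<lambda>U. U \<subseteq> insert None (collapse A ` topspace X) \<and>
                   openin X {x \<in> topspace X. collapse A x \<in> U})"

lemma openin_quotient_space:
  "openin (quotient_space X A) U \<longleftrightarrow>
     U \<subseteq> insert None (collapse A ` topspace X) \<and> openin X {x \<in> topspace X. collapse A x \<in> U}"
proof -
  have "istopology (\<lambda>U. U \<subseteq> insert None (collapse A ` topspace X) \<and>
                   openin X {x \<in> topspace X. collapse A x \<in> U})"
    unfolding istopology_def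
  proof (intro conjI allI impI)
    fix S T
    assume "S \<subseteq> insert None (collapse A ` topspace X) \<and> openin X {x \<in> topspace X. collapse A x \<in> S}"
      and "T \<subseteq> insert None (collapse A ` topspace X) \<and> openin X {x \<in> topspace X. collapse A x \<in> T}"
    moreover have "{x \<in> topspace X. collapse A x \<in> S \<inter> T} =
      {x \<in> topspace X. collapse A x \<in> S} \<inter> {x \<in> topspace X. collapse A x \<in> T}" by auto
    ultimately show "S \<inter> T \<subseteq> insert None (collapse A ` topspace X)"
      "openin X {x \<in> topspace X. collapse A x \<in> S \<inter> T}" by auto
  next
    fix \<K>
    assume *: "\<forall>K\<in>\<K>. K \<subseteq> insert None (collapse A ` topspace X) \<and>
                 openin X {x \<in> topspace X. collapse A x \<in> K}"
    then show "\<Union> \<K> \<subseteq> insert None (collapse A ` topspace X)" by blast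
    have "{x \<in> topspace X. collapse A x \<in> \<Union> \<K>} = (\<Union>K\<in>\<K>. {x \<in> topspace X. collapse A x \<in> K})"
      by auto
    then show "openin X {x \<in> topspace X. collapse A x \<in> \<Union> \<K>}" using * by auto
  qed
  then show ?thesis by (simp add: quotient_space_def topology_inverse')
qed

lemma topspace_quotient_space:
  "topspace (quotient_space X A) = insert None (collapse A ` topspace X)"
proof -
  have "{x \<in> topspace X. collapse A x \<in> insert None (collapse A ` topspace X)} = topspace X"
    by auto
  then have "openin (quotient_space X A) (insert None (collapse A ` topspace X))"
    by (simp add: openin_quotient_space)
  then show ?thesis
    by (meson openin_quotient_space openin_subset openin_topspace subset_antisym)
qed

lemma quotient_map_collapse:
  assumes "A \<inter> topspace X \<noteq> {}"
  shows "quotient_map X (quotient_space X A) (collapse A)"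
proof -
  have "None \<in> collapse A ` topspace X" using assms by (force simp: collapse_def)
  then show ?thesis
    unfolding quotient_map_def
    by (auto simp: topspace_quotient_space openin_quotient_space insert_absorb)
qed

definition reduced_suspension :: "'a topology \<Rightarrow> 'a \<Rightarrow> ('a \<times> real) option topology" where
  "reduced_suspension X x0 =
     quotient_space (prod_topology X unit_interval)
       (topspace X \<times> {0, 1} \<union> {x0} \<times> {0..1})"

text \<open>The wedge of the spheres of dimension \<open>d i\<close> for \<open>i \<in> I\<close>; a single point if \<open>I = {}\<close>.\<close>

definition wedge_of_spheres :: "'i set \<Rightarrow> ('i \<Rightarrow> nat) \<Rightarrow> ('i \<times> (nat \<Rightarrow> real)) option topology" where
  "wedge_of_spheres I d =
     quotient_space (sum_topology (\<lambda>i. nsphere (d i)) I) (I \<times> {sphere_base})"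

end

theory Submission
  imports Defs
begin

text \<open>
  For a locally compact Hausdorff space \<open>A\<close>, continuous maps \<open>W \<rightarrow> map(A, Z)\<close> and continuous maps
  \<open>W \<times> A \<rightarrow> Z\<close> correspond to each other (\<open>continuous_map_curry\<close>, \<open>continuous_map_uncurry\<close>).  Both
  parts of the corollary are consequences of this exponential law.  Write \<open>M\<close> for \<open>map(X, Y; 0)\<close>.

  \<^bold>\<open>T-spaces.\<close>  A free loop in \<open>M\<close> is the same thing as a continuous family of free loops in \<open>Y\<close>, one for each
  point of \<open>X\<close>, whose base points form an element of \<open>M\<close>; the rest of the loop then stays in the
  path component \<open>M\<close> because the circle is path connected.  A fibre homotopy trivialization of the
  free loop fibration of \<open>Y\<close>, applied to every member of such a family, therefore gives one for \<open>M\<close>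
  (\<open>T_space_null_component\<close>).

  \<^bold>\<open>G-spaces.\<close>  A space \<open>Z\<close> is a G-space exactly if the evaluation \<open>aut\<^sub>1 Z \<rightarrow> Z\<close> is onto on homotopy
  groups (\<open>G_space_iff\<close>).  The adjoint of a based map \<open>S\<^sup>n \<rightarrow> M\<close> is a map \<open>\<alpha> : S\<^sup>n \<times> X \<rightarrow> Y\<close> that is
  constant on \<open>* \<times> X\<close>.  Suppose that \<open>\<alpha>\<close> is homotopic, relative to \<open>* \<times> X\<close>, to the evaluation of
  some \<open>A : S\<^sup>n \<times> X \<rightarrow> aut\<^sub>1 Y\<close> that is the identity on \<open>* \<times> X\<close>.  Then \<open>s\<close> acts on \<open>g \<in> M\<close> by
  \<open>x \<mapsto> A(s, x)(g(x))\<close>; this is a based map \<open>S\<^sup>n \<rightarrow> aut\<^sub>1 M\<close>, and its evaluation at the null map is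
  homotopic to the given map \<open>S\<^sup>n \<rightarrow> M\<close>.

  It remains to find \<open>A\<close> for \<open>n \<ge> 1\<close>, which is a lifting problem for a map \<open>p : E \<rightarrow> B\<close> that is onto on homotopy
  groups (\<open>lift_sphere_family\<close>).  Since \<open>S\<^sup>n\<close> is the smash product of \<open>S\<^sup>k\<close>, \<open>k = n - 1\<close>, and a circle,
  \<open>\<alpha>\<close> is a family, indexed by \<open>X\<close>, of loops in the \<open>k\<close>-fold loop space of \<open>B\<close>.  Since the smash
  product of \<open>S\<^sup>d\<close> and \<open>S\<^sup>k\<close> is \<open>S\<^sup>d\<^sup>+\<^sup>k\<close>, the \<open>k\<close>-fold looping of \<open>p\<close> is again onto on homotopy groups
  (\<open>onto_homotopy_groups_sphere_loops\<close>).  So only families of loops in \<open>B\<close> have to be lifted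
  (\<open>lift_family_of_loops\<close>).

  Such a family is the product of a family that is trivial at \<open>x0\<close> and the constant family with value
  the loop over \<open>x0\<close>; this uses that \<open>X\<close> is well-pointed.  The latter lifts by hypothesis.  The former
  is a map \<open>f : \<Sigma>X \<rightarrow> B\<close>, and composing it with a homotopy equivalence from a wedge of spheres one can
  lift it sphere by sphere.  The homotopy equivalence need not respect base points, so what results
  is a map \<open>F\<close> from \<open>\<Sigma>X\<close> to \<open>E\<close> such that \<open>p \<circ> F\<close> is only freely homotopic to \<open>f\<close>.  This is repaired by
  conjugation: because loops in \<open>B\<close> lift, there is a path in \<open>E\<close> lying over the track of the base
  point, and conjugating \<open>F\<close> with this path gives a family of loops in \<open>E\<close> that lies over \<open>f\<close> up to
  a homotopy fixing the end points.
\<close>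

section \<open>Continuity and homotopies on products\<close>

lemma continuous_map_comp:
  assumes "continuous_map Y Z g" "continuous_map X Y f"
  shows "continuous_map X Z (\<lambda>x. g (f x))"
  using continuous_map_compose[OF assms(2,1)] by (simp add: o_def)

lemma continuous_map_mem: "continuous_map X Y f \<Longrightarrow> x \<in> topspace X \<Longrightarrow> f x \<in> topspace Y"
  by (auto simp: continuous_map_def)

lemma continuous_map_unit_interval_real:
  "continuous_map Z unit_interval f \<Longrightarrow> continuous_map Z euclideanreal f"
  by (simp add: continuous_map_in_subtopology)

lemma continuous_map_real_unit_interval:
  "continuous_map Z euclideanreal f \<Longrightarrow> (\<And>z. z \<in> topspace Z \<Longrightarrow> 0 \<le> f z \<and> f z \<le> 1)
    \<Longrightarrow> continuous_map Z unit_interval f"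
  by (auto simp: continuous_map_in_subtopology)

lemma continuous_map_fst_comp:
  "continuous_map Z (prod_topology X Y) f \<Longrightarrow> continuous_map Z X (\<lambda>z. fst (f z))"
  by (rule continuous_map_comp[OF continuous_map_fst])

lemma continuous_map_snd_comp:
  "continuous_map Z (prod_topology X Y) f \<Longrightarrow> continuous_map Z Y (\<lambda>z. snd (f z))"
  by (rule continuous_map_comp[OF continuous_map_snd])

lemma continuous_map_paste:
  assumes "continuous_map Z euclideanreal \<tau>" "continuous_map Z B f" "continuous_map Z B g"
    and "\<And>z. z \<in> topspace Z \<Longrightarrow> \<tau> z = c \<Longrightarrow> f z = g z"
  shows "continuous_map Z B (\<lambda>z. if \<tau> z \<le> c then f z else g z)"
  by (rule continuous_map_cases_le) (use assms in \<open>auto intro: continuous_map_from_subtopology\<close>)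

lemma continuous_map_id': "continuous_map Z Z (\<lambda>z. z)"
  by (simp add: continuous_map_id[unfolded id_def])

lemmas cmap_intros = continuous_map_pairedI continuous_map_fst continuous_map_snd continuous_map_id'
  continuous_map_fst_comp[OF continuous_map_fst] continuous_map_fst_comp[OF continuous_map_snd]
  continuous_map_snd_comp[OF continuous_map_fst] continuous_map_snd_comp[OF continuous_map_snd]

lemma homotopic_withI:
  assumes "continuous_map (prod_topology unit_interval Z) B h"
    and "\<And>z. z \<in> topspace Z \<Longrightarrow> h (0, z) = f z" "\<And>z. z \<in> topspace Z \<Longrightarrow> h (1, z) = g z"
    and "\<And>u. 0 \<le> u \<Longrightarrow> u \<le> 1 \<Longrightarrow> P (\<lambda>z. h (u, z))"
    and "\<And>h k. (\<And>x. x \<in> topspace Z \<Longrightarrow> h x = k x) \<Longrightarrow> P h = P k"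
  shows "homotopic_with P Z B f g"
proof (subst homotopic_with)
  show "\<And>h k. (\<And>x. x \<in> topspace Z \<Longrightarrow> h x = k x) \<Longrightarrow> P h = P k" by (rule assms(5))
  show "\<exists>h. continuous_map (prod_topology unit_interval Z) B h \<and> (\<forall>x\<in>topspace Z. h (0, x) = f x) \<and>
        (\<forall>x\<in>topspace Z. h (1, x) = g x) \<and> (\<forall>t\<in>{0..1}. P (\<lambda>x. h (t, x)))"
    by (rule exI[of _ h]) (simp add: assms(1-4))
qed

section \<open>Mapping spaces\<close>

text \<open>
  The subbasic condition that \<open>f(w, -)\<close> maps the compact set \<open>K\<close> into \<open>U\<close> is open in \<open>w\<close> by the tube
  lemma.
\<close>
lemma continuous_map_curry:
  assumes f: "continuous_map (prod_topology W A) Z f"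
  shows "continuous_map W (mapping_space A Z) (\<lambda>w. \<lambda>a \<in> topspace A. f (w, a))"
  unfolding mapping_space_def
proof (rule continuous_on_generated_topo)
  let ?F = "\<lambda>w. \<lambda>a \<in> topspace A. f (w, a)"
  have maps: "?F w \<in> maps A Z" if "w \<in> topspace W" for w
  proof -
    have "continuous_map A Z (\<lambda>a. f (w, a))"
      by (rule continuous_map_comp[OF f]) (use that in \<open>auto intro!: continuous_intros\<close>)
    then have "continuous_map A Z (?F w)" by (rule continuous_map_eq) auto
    then show ?thesis by (simp add: maps_def)
  qed
  have "maps A Z = {f \<in> maps A Z. f ` {} \<subseteq> {}}" by simp
  then have "maps A Z \<in> {{f \<in> maps A Z. f ` K \<subseteq> U} |K U. compactin A K \<and> openin Z U}"
    using compactin_empty openin_empty by blast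
  then show "?F ` topspace W \<subseteq> \<Union> {{f \<in> maps A Z. f ` K \<subseteq> U} |K U. compactin A K \<and> openin Z U}"
    using maps by blast
  fix S assume "S \<in> {{f \<in> maps A Z. f ` K \<subseteq> U} |K U. compactin A K \<and> openin Z U}"
  then obtain K U where S: "S = {f \<in> maps A Z. f ` K \<subseteq> U}" and K: "compactin A K" and U: "openin Z U"
    by blast
  have KA: "K \<subseteq> topspace A" using K compactin_subset_topspace by blast
  define O' where "O' = {z \<in> topspace (prod_topology W A). f z \<in> U}"
  have O': "openin (prod_topology W A) O'"
    unfolding O'_def by (rule openin_continuous_map_preimage[OF f U])
  show "openin W (?F -` S \<inter> topspace W)"
  proof (subst openin_subopen, intro ballI)
    fix w assume w: "w \<in> ?F -` S \<inter> topspace W"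
    then have "{w} \<times> K \<subseteq> O'" using KA by (fastforce simp: S O'_def)
    then obtain V V' where V: "openin W V" "w \<in> V" "K \<subseteq> V'" "V \<times> V' \<subseteq> O'"
      using tube_lemma_right[OF O' K, of w] w by blast
    have "V \<subseteq> ?F -` S \<inter> topspace W"
    proof
      fix v assume v: "v \<in> V"
      then have vW: "v \<in> topspace W" using V(1) openin_subset by blast
      have "f (v, a) \<in> U" if "a \<in> K" for a
        using V v that by (auto simp: O'_def)
      then show "v \<in> ?F -` S \<inter> topspace W"
        using maps[OF vW] vW KA by (auto simp: S)
    qed
    then show "\<exists>T. openin W T \<and> w \<in> T \<and> T \<subseteq> ?F -` S \<inter> topspace W" using V by blast
  qed
qed

text \<open>
  Every neighbourhood of a point of \<open>A\<close> contains a compact one, and such a compact set \<open>K\<close> gives the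
  subbasic neighbourhood of \<open>g\<close> that is needed.
\<close>
lemma continuous_map_eval:
  assumes A: "locally_compact_space A" "Hausdorff_space A"
  shows "continuous_map (prod_topology (mapping_space A Z) A) Z (\<lambda>z. (fst z) (snd z))"
  unfolding continuous_map
proof (intro conjI allI impI)
  show "(\<lambda>z. (fst z) (snd z)) ` topspace (prod_topology (mapping_space A Z) A) \<subseteq> topspace Z"
    by (auto simp: maps_def continuous_map_def)
  fix U assume U: "openin Z U"
  show "openin (prod_topology (mapping_space A Z) A)
          {z \<in> topspace (prod_topology (mapping_space A Z) A). fst z (snd z) \<in> U}" (is "openin _ ?S")
    unfolding openin_prod_topology_alt
  proof (intro allI impI)
    fix g a assume "(g, a) \<in> ?S"
    then have g: "g \<in> maps A Z" and a: "a \<in> topspace A" and gU: "g a \<in> U" by auto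
    have "continuous_map A Z g" using g by (simp add: maps_def)
    then have "openin A {x \<in> topspace A. g x \<in> U}" using U openin_continuous_map_preimage by blast
    moreover have "neighbourhood_base_of (compactin A) A"
      using A locally_compact_space_neighbourhood_base by blast
    ultimately obtain V K where V: "openin A V" "compactin A K" "a \<in> V" "V \<subseteq> K"
      "K \<subseteq> {x \<in> topspace A. g x \<in> U}"
      unfolding neighbourhood_base_of using a gU by (metis (no_types, lifting) mem_Collect_eq)
    let ?M = "{f \<in> maps A Z. f ` K \<subseteq> U}"
    have "openin (mapping_space A Z) ?M"
      unfolding mapping_space_def by (rule topology_generated_by_Basis) (use V U in blast)
    moreover have "g \<in> ?M" using g V by auto
    moreover have "?M \<times> V \<subseteq> ?S" using V openin_subset[OF V(1)] by (auto simp: subset_iff)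
    ultimately show "\<exists>M V. openin (mapping_space A Z) M \<and> openin A V \<and> g \<in> M \<and> a \<in> V \<and> M \<times> V \<subseteq> ?S"
      using V by blast
  qed
qed

lemma continuous_map_uncurry:
  assumes A: "locally_compact_space A" "Hausdorff_space A"
    and f: "continuous_map W (mapping_space A Z) f" and g: "continuous_map W A g"
  shows "continuous_map W Z (\<lambda>w. f w (g w))"
  using continuous_map_comp[OF continuous_map_eval[OF A, where Z=Z] continuous_map_pairedI[OF f g]] by simp

lemma mapsD: "f \<in> maps A Z \<Longrightarrow> continuous_map A Z f" "f \<in> maps A Z \<Longrightarrow> f \<in> extensional (topspace A)"
  by (auto simp: maps_def)

lemma restrict_in_maps: "continuous_map A Z f \<Longrightarrow> restrict f (topspace A) \<in> maps A Z"
  by (auto simp: maps_def intro: continuous_map_eq)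

lemma unit_interval_compact: "compact_space unit_interval"
  by (simp add: compact_space_subtopology)

lemma unit_interval_Hausdorff: "Hausdorff_space unit_interval"
  by (simp add: Hausdorff_space_subtopology)

lemma unit_interval_locally_compact: "locally_compact_space unit_interval"
  by (simp add: compact_imp_locally_compact_space unit_interval_compact)

lemmas uncurry_unit_interval =
  continuous_map_uncurry[OF unit_interval_locally_compact unit_interval_Hausdorff]

section \<open>Families of paths\<close>

text \<open>
  A map \<open>X \<times> I \<rightarrow> B\<close> is regarded as a family of paths in \<open>B\<close> indexed by \<open>X\<close>.  The minimum and the
  maximum do not change the values for parameters in \<open>I\<close>; they make each branch continuous on all of
  \<open>X \<times> I\<close>, so that no restriction to the two halves is necessary.
\<close>
definition family_join :: "('x \<times> real \<Rightarrow> 'b) \<Rightarrow> ('x \<times> real \<Rightarrow> 'b) \<Rightarrow> 'x \<times> real \<Rightarrow> 'b" where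
  "family_join q r z = (if snd z \<le> 1/2 then q (fst z, min 1 (2 * snd z))
                        else r (fst z, max 0 (2 * snd z - 1)))"

definition family_reverse :: "('x \<times> real \<Rightarrow> 'b) \<Rightarrow> 'x \<times> real \<Rightarrow> 'b" where
  "family_reverse q z = q (fst z, 1 - snd z)"

definition homotopic_rel_ends ::
  "'x topology \<Rightarrow> 'b topology \<Rightarrow> ('x \<times> real \<Rightarrow> 'b) \<Rightarrow> ('x \<times> real \<Rightarrow> 'b) \<Rightarrow> bool" where
  "homotopic_rel_ends X B q r \<longleftrightarrow>
     homotopic_with (\<lambda>h. \<forall>x \<in> topspace X. h (x, 0) = q (x, 0) \<and> h (x, 1) = q (x, 1))
       (prod_topology X unit_interval) B q r"

lemma homotopic_rel_endsI:
  assumes "continuous_map (prod_topology unit_interval (prod_topology X unit_interval)) B h"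
    and "\<And>x t. x \<in> topspace X \<Longrightarrow> 0 \<le> t \<Longrightarrow> t \<le> 1 \<Longrightarrow> h (0, (x, t)) = q (x, t)"
    and "\<And>x t. x \<in> topspace X \<Longrightarrow> 0 \<le> t \<Longrightarrow> t \<le> 1 \<Longrightarrow> h (1, (x, t)) = r (x, t)"
    and "\<And>x u. x \<in> topspace X \<Longrightarrow> 0 \<le> u \<Longrightarrow> u \<le> 1 \<Longrightarrow> h (u, (x, 0)) = q (x, 0)"
    and "\<And>x u. x \<in> topspace X \<Longrightarrow> 0 \<le> u \<Longrightarrow> u \<le> 1 \<Longrightarrow> h (u, (x, 1)) = q (x, 1)"
  shows "homotopic_rel_ends X B q r"
  unfolding homotopic_rel_ends_def
  by (rule homotopic_withI[OF assms(1)]) (use assms in auto)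

lemma homotopic_rel_endsE:
  assumes "homotopic_rel_ends X B q r"
  obtains h where "continuous_map (prod_topology unit_interval (prod_topology X unit_interval)) B h"
    and "\<And>z. h (0, z) = q z" "\<And>z. h (1, z) = r z"
    and "\<And>x u. x \<in> topspace X \<Longrightarrow> 0 \<le> u \<Longrightarrow> u \<le> 1 \<Longrightarrow> h (u, (x, 0)) = q (x, 0)"
    and "\<And>x u. x \<in> topspace X \<Longrightarrow> 0 \<le> u \<Longrightarrow> u \<le> 1 \<Longrightarrow> h (u, (x, 1)) = q (x, 1)"
  using assms unfolding homotopic_rel_ends_def homotopic_with_def by fastforce

lemma homotopic_rel_ends_ends:
  assumes "homotopic_rel_ends X B q r" "x \<in> topspace X"
  shows "r (x, 0) = q (x, 0)" "r (x, 1) = q (x, 1)"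
  using homotopic_with_imp_property[OF assms(1)[unfolded homotopic_rel_ends_def]] assms(2) by auto

lemma homotopic_rel_ends_refl:
  "continuous_map (prod_topology X unit_interval) B q \<Longrightarrow> homotopic_rel_ends X B q q"
  by (simp add: homotopic_rel_ends_def)

lemma homotopic_rel_ends_cong:
  assumes "homotopic_rel_ends X B q r"
    and "\<And>x t. x \<in> topspace X \<Longrightarrow> 0 \<le> t \<Longrightarrow> t \<le> 1 \<Longrightarrow> q (x, t) = q' (x, t)"
    and "\<And>x t. x \<in> topspace X \<Longrightarrow> 0 \<le> t \<Longrightarrow> t \<le> 1 \<Longrightarrow> r (x, t) = r' (x, t)"
  shows "homotopic_rel_ends X B q' r'"
  using assms(1)
proof (rule homotopic_rel_endsE)
  fix h assume h: "continuous_map (prod_topology unit_interval (prod_topology X unit_interval)) B h"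
    "\<And>z. h (0, z) = q z" "\<And>z. h (1, z) = r z"
    "\<And>x u. x \<in> topspace X \<Longrightarrow> 0 \<le> u \<Longrightarrow> u \<le> 1 \<Longrightarrow> h (u, (x, 0)) = q (x, 0)"
    "\<And>x u. x \<in> topspace X \<Longrightarrow> 0 \<le> u \<Longrightarrow> u \<le> 1 \<Longrightarrow> h (u, (x, 1)) = q (x, 1)"
  show ?thesis
    by (rule homotopic_rel_endsI[OF h(1)]) (use h assms(2,3) in auto)
qed

lemma homotopic_rel_ends_sym:
  assumes "homotopic_rel_ends X B q r"
  shows "homotopic_rel_ends X B r q"
proof -
  have "homotopic_with (\<lambda>h. \<forall>x \<in> topspace X. h (x, 0) = q (x, 0) \<and> h (x, 1) = q (x, 1))
       (prod_topology X unit_interval) B r q"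
    using assms by (simp add: homotopic_rel_ends_def homotopic_with_sym)
  then show ?thesis
    unfolding homotopic_rel_ends_def
    by (rule homotopic_with_mono) (use homotopic_rel_ends_ends[OF assms] in auto)
qed

lemma homotopic_rel_ends_trans:
  assumes "homotopic_rel_ends X B q r" "homotopic_rel_ends X B r s"
  shows "homotopic_rel_ends X B q s"
proof -
  have "homotopic_with (\<lambda>h. \<forall>x \<in> topspace X. h (x, 0) = q (x, 0) \<and> h (x, 1) = q (x, 1))
       (prod_topology X unit_interval) B r s"
    using assms(2) unfolding homotopic_rel_ends_def
    by (rule homotopic_with_mono) (use homotopic_rel_ends_ends[OF assms(1)] in auto)
  then show ?thesis
    using assms(1) unfolding homotopic_rel_ends_def by (rule homotopic_with_trans[rotated])
qed

lemma continuous_map_family: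
  assumes "continuous_map (prod_topology X unit_interval) B q"
    and "continuous_map Z X f" "continuous_map Z euclideanreal \<tau>"
    and "\<And>z. z \<in> topspace Z \<Longrightarrow> 0 \<le> \<tau> z \<and> \<tau> z \<le> 1"
  shows "continuous_map Z B (\<lambda>z. q (f z, \<tau> z))"
  by (rule continuous_map_comp[OF assms(1)])
    (use assms in \<open>auto intro!: continuous_map_pairedI continuous_map_real_unit_interval\<close>)

lemma continuous_map_snd_real:
  "continuous_map Z (prod_topology X unit_interval) f \<Longrightarrow> continuous_map Z euclideanreal (\<lambda>z. snd (f z))"
  by (rule continuous_map_unit_interval_real, rule continuous_map_snd_comp)

lemma continuous_map_fst_real:
  "continuous_map Z (prod_topology unit_interval X) f \<Longrightarrow> continuous_map Z euclideanreal (\<lambda>z. fst (f z))"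
  by (rule continuous_map_unit_interval_real, rule continuous_map_fst_comp)

lemma continuous_family_join:
  assumes q: "continuous_map (prod_topology X unit_interval) B q"
    and r: "continuous_map (prod_topology X unit_interval) B r"
    and qr: "\<And>x. x \<in> topspace X \<Longrightarrow> q (x, 1) = r (x, 0)"
  shows "continuous_map (prod_topology X unit_interval) B (family_join q r)"
  unfolding family_join_def
proof (rule continuous_map_paste)
  have t: "continuous_map (prod_topology X unit_interval) euclideanreal snd"
    by (rule continuous_map_unit_interval_real, rule continuous_map_snd)
  then show "continuous_map (prod_topology X unit_interval) euclideanreal snd" .
  show "continuous_map (prod_topology X unit_interval) B (\<lambda>z. q (fst z, min 1 (2 * snd z)))"
    by (rule continuous_map_family[OF q]) (auto intro!: continuous_intros t)
  show "continuous_map (prod_topology X unit_interval) B (\<lambda>z. r (fst z, max 0 (2 * snd z - 1)))"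
    by (rule continuous_map_family[OF r]) (auto intro!: continuous_intros t)
qed (use qr in auto)

lemma continuous_family_reverse:
  assumes q: "continuous_map (prod_topology X unit_interval) B q"
  shows "continuous_map (prod_topology X unit_interval) B (family_reverse q)"
  unfolding family_reverse_def
proof (rule continuous_map_family[OF q])
  have t: "continuous_map (prod_topology X unit_interval) euclideanreal snd"
    by (rule continuous_map_unit_interval_real, rule continuous_map_snd)
  show "continuous_map (prod_topology X unit_interval) euclideanreal (\<lambda>z. 1 - snd z)"
    by (auto intro!: continuous_intros t)
qed (auto intro!: continuous_intros)

lemma family_join_ends [simp]:
  "family_join q r (x, 0) = q (x, 0)" "family_join q r (x, 1) = r (x, 1)"
  by (simp_all add: family_join_def)

lemma family_reverse_ends [simp]:
  "family_reverse q (x, 0) = q (x, 1)" "family_reverse q (x, 1) = q (x, 0)"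
  by (simp_all add: family_reverse_def)

lemma family_join_image: "p \<circ> family_join q r = family_join (p \<circ> q) (p \<circ> r)"
  by (auto simp: family_join_def fun_eq_iff)

lemma family_reverse_image: "p \<circ> family_reverse q = family_reverse (p \<circ> q)"
  by (auto simp: family_reverse_def fun_eq_iff)

lemma family_reverse_reverse: "family_reverse (family_reverse q) = q"
  by (auto simp: family_reverse_def fun_eq_iff)

lemma homotopic_rel_ends_join:
  assumes q: "homotopic_rel_ends X B q q'" and r: "homotopic_rel_ends X B r r'"
    and qr: "\<And>x. x \<in> topspace X \<Longrightarrow> q (x, 1) = r (x, 0)"
  shows "homotopic_rel_ends X B (family_join q r) (family_join q' r')"
  using q
proof (rule homotopic_rel_endsE)
  fix h assume h: "continuous_map (prod_topology unit_interval (prod_topology X unit_interval)) B h"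
    "\<And>z. h (0, z) = q z" "\<And>z. h (1, z) = q' z"
    "\<And>x u. x \<in> topspace X \<Longrightarrow> 0 \<le> u \<Longrightarrow> u \<le> 1 \<Longrightarrow> h (u, (x, 0)) = q (x, 0)"
    "\<And>x u. x \<in> topspace X \<Longrightarrow> 0 \<le> u \<Longrightarrow> u \<le> 1 \<Longrightarrow> h (u, (x, 1)) = q (x, 1)"
  obtain k where k: "continuous_map (prod_topology unit_interval (prod_topology X unit_interval)) B k"
    "\<And>z. k (0, z) = r z" "\<And>z. k (1, z) = r' z"
    "\<And>x u. x \<in> topspace X \<Longrightarrow> 0 \<le> u \<Longrightarrow> u \<le> 1 \<Longrightarrow> k (u, (x, 0)) = r (x, 0)"
    "\<And>x u. x \<in> topspace X \<Longrightarrow> 0 \<le> u \<Longrightarrow> u \<le> 1 \<Longrightarrow> k (u, (x, 1)) = r (x, 1)"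
    by (rule homotopic_rel_endsE[OF r]) (rule that)
  let ?Z = "prod_topology unit_interval (prod_topology X unit_interval)"
  let ?H = "\<lambda>z. if snd (snd z) \<le> 1/2 then h (fst z, (fst (snd z), min 1 (2 * snd (snd z))))
                else k (fst z, (fst (snd z), max 0 (2 * snd (snd z) - 1)))"
  have t: "continuous_map ?Z euclideanreal (\<lambda>z. snd (snd z))"
    by (rule continuous_map_snd_real, rule continuous_map_snd)
  have "continuous_map ?Z B ?H"
  proof (rule continuous_map_paste[OF t])
    show "continuous_map ?Z B (\<lambda>z. h (fst z, (fst (snd z), min 1 (2 * snd (snd z)))))"
      by (rule continuous_map_comp[OF h(1)])
        (auto intro!: cmap_intros continuous_map_real_unit_interval continuous_intros t)
    show "continuous_map ?Z B (\<lambda>z. k (fst z, (fst (snd z), max 0 (2 * snd (snd z) - 1))))"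
      by (rule continuous_map_comp[OF k(1)])
        (auto intro!: cmap_intros continuous_map_real_unit_interval continuous_intros t)
  qed (use h k qr in auto)
  then show ?thesis
    by (rule homotopic_rel_endsI) (use h k qr in \<open>auto simp: family_join_def\<close>)
qed

lemma homotopic_rel_ends_reverse:
  assumes "homotopic_rel_ends X B q r"
  shows "homotopic_rel_ends X B (family_reverse q) (family_reverse r)"
  using assms
proof (rule homotopic_rel_endsE)
  fix h assume h: "continuous_map (prod_topology unit_interval (prod_topology X unit_interval)) B h"
    "\<And>z. h (0, z) = q z" "\<And>z. h (1, z) = r z"
    "\<And>x u. x \<in> topspace X \<Longrightarrow> 0 \<le> u \<Longrightarrow> u \<le> 1 \<Longrightarrow> h (u, (x, 0)) = q (x, 0)"
    "\<And>x u. x \<in> topspace X \<Longrightarrow> 0 \<le> u \<Longrightarrow> u \<le> 1 \<Longrightarrow> h (u, (x, 1)) = q (x, 1)"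
  let ?Z = "prod_topology unit_interval (prod_topology X unit_interval)"
  have t: "continuous_map ?Z euclideanreal (\<lambda>z. snd (snd z))"
    by (rule continuous_map_snd_real, rule continuous_map_snd)
  have "continuous_map ?Z unit_interval (\<lambda>z. 1 - snd (snd z))"
    by (rule continuous_map_real_unit_interval) (auto intro!: continuous_intros t)
  then have "continuous_map ?Z B (\<lambda>z. h (fst z, (fst (snd z), 1 - snd (snd z))))"
    by (intro continuous_map_comp[OF h(1)] cmap_intros)
  then show ?thesis
    by (rule homotopic_rel_endsI) (use h in \<open>auto simp: family_reverse_def\<close>)
qed

lemma convex_bounds:
  fixes u a b :: real
  assumes "0 \<le> u" "u \<le> 1" "0 \<le> a" "a \<le> 1" "0 \<le> b" "b \<le> 1"
  shows "0 \<le> (1 - u) * a + u * b \<and> (1 - u) * a + u * b \<le> 1"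
  using assms convex_bound_le[of a 1 b "1 - u" u] by simp

text \<open>
  The reparametrization \<open>c\<close> is joined to the identity by straight lines in \<open>I\<close>.
\<close>
lemma homotopic_rel_ends_reparametrize:
  assumes q: "continuous_map (prod_topology X unit_interval) B q"
    and c: "continuous_on {0..1} c" "\<And>t. 0 \<le> t \<Longrightarrow> t \<le> 1 \<Longrightarrow> 0 \<le> c t \<and> c t \<le> 1" "c 0 = 0" "c 1 = (1::real)"
  shows "homotopic_rel_ends X B (\<lambda>z. q (fst z, c (snd z))) q"
proof (rule homotopic_rel_endsI)
  let ?Z = "prod_topology unit_interval (prod_topology X unit_interval)"
  let ?h = "\<lambda>z. q (fst (snd z), (1 - fst z) * c (snd (snd z)) + fst z * snd (snd z))"
  have t: "continuous_map ?Z unit_interval (\<lambda>z. snd (snd z))"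
    by (auto intro!: cmap_intros)
  have ct: "continuous_map ?Z euclideanreal (\<lambda>z. c (snd (snd z)))"
    by (rule continuous_map_comp[OF _ t]) (use c in simp)
  have u: "continuous_map ?Z euclideanreal fst"
    by (rule continuous_map_unit_interval_real, rule continuous_map_fst)
  show "continuous_map ?Z B ?h"
  proof (rule continuous_map_family[OF q])
    show "continuous_map ?Z euclideanreal (\<lambda>z. (1 - fst z) * c (snd (snd z)) + fst z * snd (snd z))"
      by (auto intro!: continuous_intros ct u continuous_map_unit_interval_real[OF t])
    fix z assume "z \<in> topspace ?Z"
    then have *: "0 \<le> fst z" "fst z \<le> 1" "0 \<le> snd (snd z)" "snd (snd z) \<le> 1" by auto
    then show "0 \<le> (1 - fst z) * c (snd (snd z)) + fst z * snd (snd z) \<and>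
      (1 - fst z) * c (snd (snd z)) + fst z * snd (snd z) \<le> 1"
      using c(2) by (intro convex_bounds) auto
  next
    show "continuous_map ?Z X (\<lambda>z. fst (snd z))" by (intro cmap_intros)
  qed
qed (use c in auto)

text \<open>
  The detour along \<open>r\<close> runs from \<open>r(x, 1)\<close> to \<open>r(x, 0)\<close> and back, following the parameter
  \<open>max (2 - 4t) (2t - 1)\<close>.  Replacing this parameter by its maximum with \<open>u\<close>, for \<open>u\<close> from 0 to 1,
  retracts the detour to its starting point; what is left is \<open>q\<close> run at four times the speed.
\<close>
lemma family_join_reverse_cancel:
  assumes q: "continuous_map (prod_topology X unit_interval) B q"
    and r: "continuous_map (prod_topology X unit_interval) B r"
    and qr: "\<And>x. x \<in> topspace X \<Longrightarrow> q (x, 1) = r (x, 1)"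
  shows "homotopic_rel_ends X B (family_join (family_join q (family_reverse r)) r) q"
proof (rule homotopic_rel_ends_trans)
  let ?Z = "prod_topology unit_interval (prod_topology X unit_interval)"
  let ?c = "\<lambda>t::real. min (4 * t) 1"
  let ?v = "\<lambda>t::real. max (2 - 4 * t) (2 * t - 1)"
  have t: "continuous_map ?Z euclideanreal (\<lambda>z. snd (snd z))"
    by (rule continuous_map_snd_real, rule continuous_map_snd)
  have u: "continuous_map ?Z euclideanreal fst"
    by (rule continuous_map_unit_interval_real, rule continuous_map_fst)
  let ?h = "\<lambda>z. if snd (snd z) \<le> 1/4 then q (fst (snd z), max 0 (?c (snd (snd z))))
      else r (fst (snd z), min 1 (max (fst z) (?v (snd (snd z)))))"
  show "homotopic_rel_ends X B (family_join (family_join q (family_reverse r)) r) (\<lambda>z. q (fst z, ?c (snd z)))"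
  proof (rule homotopic_rel_endsI)
    show "continuous_map ?Z B ?h"
    proof (rule continuous_map_paste[OF t])
      show "continuous_map ?Z B (\<lambda>z. q (fst (snd z), max 0 (?c (snd (snd z)))))"
        by (rule continuous_map_family[OF q]) (auto intro!: cmap_intros continuous_intros t)
      show "continuous_map ?Z B (\<lambda>z. r (fst (snd z), min 1 (max (fst z) (?v (snd (snd z))))))"
        by (rule continuous_map_family[OF r]) (auto intro!: cmap_intros continuous_intros t u)
      show "q (fst (snd z), max 0 (?c (snd (snd z)))) = r (fst (snd z), min 1 (max (fst z) (?v (snd (snd z)))))"
        if "z \<in> topspace ?Z" "snd (snd z) = 1/4" for z
        unfolding that(2) using that(1) qr by auto
    qed
    show "?h (0, (x, t)) = family_join (family_join q (family_reverse r)) r (x, t)"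
      if "x \<in> topspace X" "0 \<le> t" "t \<le> 1" for x t
    proof -
      consider "t \<le> 1/4" | "1/4 < t" "t \<le> 1/2" | "1/2 < t" by linarith
      then show ?thesis
      proof cases
        case 1
        have "min (4 * t) 1 = 4 * t" "max 0 (4 * t) = 4 * t" "min 1 (4 * t) = 4 * t" "min 1 (2 * t) = 2 * t"
          using 1 that by auto
        then show ?thesis using 1 that by (simp add: family_join_def)
      next
        case 2
        have "max 0 (2 - 4 * t) = 2 - 4 * t" "min 1 (2 - 4 * t) = 2 - 4 * t"
          "max (2 - 4 * t) (2 * t - 1) = 2 - 4 * t" using 2 by auto
        then show ?thesis using 2 that
          by (simp add: family_join_def family_reverse_def)
      next
        case 3
        have "max 0 (2 * t - 1) = 2 * t - 1" "min 1 (2 * t - 1) = 2 * t - 1"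
          "max (2 - 4 * t) (2 * t - 1) = 2 * t - 1" using 3 that by auto
        then show ?thesis using 3 that
          by (simp add: family_join_def family_reverse_def)
      qed
    qed
  qed (use qr in \<open>auto simp: max_def min_def\<close>)
  show "homotopic_rel_ends X B (\<lambda>z. q (fst z, ?c (snd z))) q"
    by (rule homotopic_rel_ends_reparametrize[OF q]) (auto intro!: continuous_intros)
qed

text \<open>
  A free homotopy of families of loops becomes a homotopy with fixed ends after conjugation with the
  track \<open>\<gamma>\<close> of the base points.  Both sides are images under \<open>h\<close> of paths in a square with the same
  ends: one goes around three sides of it, the other along the fourth.  The straight-line homotopy
  between the two paths stays in the square, because the square is convex.
\<close>
lemma free_homotopy_conjugate:
  assumes h: "continuous_map (prod_topology unit_interval (prod_topology X unit_interval)) B h"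
    and h0: "\<And>x u. x \<in> topspace X \<Longrightarrow> 0 \<le> u \<Longrightarrow> u \<le> 1 \<Longrightarrow> h (u, (x, 0)) = \<gamma> (x, u)"
    and h1: "\<And>x u. x \<in> topspace X \<Longrightarrow> 0 \<le> u \<Longrightarrow> u \<le> 1 \<Longrightarrow> h (u, (x, 1)) = \<gamma> (x, u)"
  shows "homotopic_rel_ends X B
    (family_join (family_join (family_reverse \<gamma>) (\<lambda>z. h (0, z))) \<gamma>) (\<lambda>z. h (1, z))"
proof (rule homotopic_rel_endsI)
  let ?Z = "prod_topology unit_interval (prod_topology X unit_interval)"
  let ?\<alpha> = "\<lambda>t::real. max 0 (max (1 - 4 * t) (2 * t - 1))"
  let ?\<beta> = "\<lambda>t::real. max 0 (min 1 (4 * t - 1))"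
  let ?k = "\<lambda>z. h ((1 - fst z) * ?\<alpha> (snd (snd z)) + fst z * 1,
                  (fst (snd z), (1 - fst z) * ?\<beta> (snd (snd z)) + fst z * snd (snd z)))"
  have t: "continuous_map ?Z euclideanreal (\<lambda>z. snd (snd z))"
    by (rule continuous_map_snd_real, rule continuous_map_snd)
  have u: "continuous_map ?Z euclideanreal fst"
    by (rule continuous_map_unit_interval_real, rule continuous_map_fst)
  show "continuous_map ?Z B ?k"
  proof (rule continuous_map_comp[OF h], intro continuous_map_pairedI)
    show "continuous_map ?Z unit_interval (\<lambda>z. (1 - fst z) * ?\<alpha> (snd (snd z)) + fst z * 1)"
    proof (rule continuous_map_real_unit_interval)
      show "continuous_map ?Z euclideanreal (\<lambda>z. (1 - fst z) * ?\<alpha> (snd (snd z)) + fst z * 1)"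
        by (intro continuous_intros t u) simp_all
    qed (rule convex_bounds, auto)
    show "continuous_map ?Z unit_interval (\<lambda>z. (1 - fst z) * ?\<beta> (snd (snd z)) + fst z * snd (snd z))"
    proof (rule continuous_map_real_unit_interval)
      show "continuous_map ?Z euclideanreal (\<lambda>z. (1 - fst z) * ?\<beta> (snd (snd z)) + fst z * snd (snd z))"
        by (intro continuous_intros t u) simp_all
    qed (rule convex_bounds, auto)
    show "continuous_map ?Z X (\<lambda>z. fst (snd z))" by (intro cmap_intros)
  qed
  show "?k (0, (x, t)) = family_join (family_join (family_reverse \<gamma>) (\<lambda>z. h (0, z))) \<gamma> (x, t)"
    if "x \<in> topspace X" "0 \<le> t" "t \<le> 1" for x t
  proof -
    consider "t \<le> 1/4" | "1/4 < t" "t \<le> 1/2" | "1/2 < t" by linarith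
    then show ?thesis
    proof cases
      case 1
      have "?\<alpha> t = 1 - 4 * t" "?\<beta> t = 0" "min 1 (2 * t) = 2 * t" "min 1 (2 * (2 * t)) = 4 * t"
        using 1 that by auto
      then show ?thesis using 1 that h0[of x "1 - 4 * t"]
        by (simp add: family_join_def family_reverse_def)
    next
      case 2
      have "?\<alpha> t = 0" "?\<beta> t = 4 * t - 1" "min 1 (2 * t) = 2 * t" "max 0 (2 * (2 * t) - 1) = 4 * t - 1"
        using 2 that by auto
      then show ?thesis using 2 that by (simp add: family_join_def)
    next
      case 3
      have "?\<alpha> t = 2 * t - 1" "?\<beta> t = 1" "max 0 (2 * t - 1) = 2 * t - 1"
        using 3 that by auto
      then show ?thesis using 3 that h1[of x "2 * t - 1"] by (simp add: family_join_def)
    qed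
  qed
qed (use h0 h1 in auto)

section \<open>Spheres\<close>

lemma in_nsphere: "x \<in> topspace (nsphere n) \<longleftrightarrow> (\<Sum>i\<le>n. (x i)\<^sup>2) = 1 \<and> (\<forall>i>n. x i = 0)"
  by (simp add: nsphere)

text \<open>
  The coordinate that distinguishes the base point is separated from the others.
\<close>
lemma in_nsphere_split:
  "x \<in> topspace (nsphere n) \<longleftrightarrow> (x 0)\<^sup>2 + (\<Sum>i<n. (x (Suc i))\<^sup>2) = 1 \<and> (\<forall>i>n. x i = 0)"
  by (simp add: in_nsphere lessThan_Suc_atMost[symmetric] sum.lessThan_Suc_shift del: sum.lessThan_Suc)

lemma continuous_map_into_nsphere:
  assumes "\<And>i. continuous_map Z euclideanreal (\<lambda>z. f z i)"
    and "\<And>z. z \<in> topspace Z \<Longrightarrow> f z \<in> topspace (nsphere n)"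
  shows "continuous_map Z (nsphere n) f"
  unfolding nsphere
  by (rule continuous_map_into_subtopology)
    (use assms in \<open>auto simp: continuous_map_componentwise_UNIV nsphere\<close>)

lemma continuous_map_nsphere_coord:
  "continuous_map Z (nsphere n) f \<Longrightarrow> continuous_map Z euclideanreal (\<lambda>z. f z i)"
  by (rule continuous_map_comp[OF continuous_map_nsphere_projection])

lemma nsphere_Hausdorff: "Hausdorff_space (nsphere n)"
  by (simp add: nsphere Hausdorff_space_subtopology Hausdorff_space_product_topology)

lemma nsphere_coord_bounds:
  assumes "x \<in> topspace (nsphere n)" shows "-1 \<le> x i" "x i \<le> 1"
proof -
  have "(x i)\<^sup>2 \<le> 1"
  proof (cases "i \<le> n")
    case True
    then have "(x i)\<^sup>2 \<le> (\<Sum>i\<le>n. (x i)\<^sup>2)"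
      by (intro member_le_sum) auto
    then show ?thesis using assms by (simp add: in_nsphere)
  qed (use assms in \<open>auto simp: in_nsphere\<close>)
  then show "-1 \<le> x i" "x i \<le> 1" by (simp_all add: abs_square_le_1 abs_le_iff)
qed

lemma nsphere_compact: "compact_space (nsphere n)"
proof -
  let ?P = "powertop_real (UNIV :: nat set)"
  let ?S = "topspace (nsphere n)"
  have 1: "closedin ?P {x \<in> topspace ?P. (\<Sum>i\<le>n. (x i)\<^sup>2) \<in> {1}}"
    by (rule closedin_continuous_map_preimage[where Y=euclideanreal]) (auto intro!: continuous_intros)
  have "closedin ?P {x \<in> topspace ?P. x i \<in> {0}}" for i
    by (rule closedin_continuous_map_preimage[where Y=euclideanreal]) (auto intro!: continuous_intros)
  then have 2: "closedin ?P (\<Inter>i\<in>{n<..}. {x \<in> topspace ?P. x i \<in> {0}})"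
    by (intro closedin_Inter) auto
  have S: "?S = {x \<in> topspace ?P. (\<Sum>i\<le>n. (x i)\<^sup>2) \<in> {1}} \<inter> (\<Inter>i\<in>{n<..}. {x \<in> topspace ?P. x i \<in> {0}})"
    by (auto simp: in_nsphere)
  have "compactin ?P (PiE UNIV (\<lambda>i. {-1..1}))"
    by (simp add: compactin_PiE)
  moreover have "?S \<subseteq> PiE UNIV (\<lambda>i. {-1..1})" using nsphere_coord_bounds by fastforce
  moreover have "closedin ?P ?S" unfolding S by (rule closedin_Int[OF 1 2])
  ultimately have "compactin ?P ?S" by (rule closed_compactin)
  then have "compact_space (subtopology ?P ?S)" by (rule compact_space_subtopology)
  moreover have "subtopology ?P ?S = nsphere n" by (simp add: nsphere)
  ultimately show ?thesis by simp
qed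

lemma nsphere_locally_compact: "locally_compact_space (nsphere n)"
  by (simp add: compact_imp_locally_compact_space nsphere_compact)

lemmas uncurry_nsphere = continuous_map_uncurry[OF nsphere_locally_compact nsphere_Hausdorff]

text \<open>
  The two hemispheres of coordinate 1 are contractible, and both contain the base point.
\<close>
lemma nsphere_path_connected:
  assumes "n \<ge> 1" shows "path_connected_space (nsphere n)"
proof -
  have "path_component_of (nsphere n) sphere_base x" if x: "x \<in> topspace (nsphere n)" for x
  proof -
    let ?H = "if 0 \<le> x 1 then {x. 0 \<le> x 1} else {x :: nat \<Rightarrow> real. x 1 \<le> 0}"
    have "path_connected_space (subtopology (nsphere n) ?H)"
      using contractible_space_upper_hemisphere[OF assms] contractible_space_lower_hemisphere[OF assms]
      by (auto intro: contractible_imp_path_connected_space)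
    then have "path_connectedin (nsphere n) (topspace (nsphere n) \<inter> ?H)"
      by (metis inf_le1 path_connectedin_def subtopology_restrict)
    moreover have "sphere_base \<in> topspace (nsphere n) \<inter> ?H" "x \<in> topspace (nsphere n) \<inter> ?H"
      using x sphere_base_in_nsphere by (auto simp: sphere_base_def)
    ultimately show ?thesis unfolding path_component_of by blast
  qed
  then show ?thesis
    unfolding path_connected_space_iff_path_component
    by (meson path_component_of_sym path_component_of_trans)
qed

lemma nsphere_base_iff:
  assumes "x \<in> topspace (nsphere n)" shows "x 0 = 1 \<longleftrightarrow> x = sphere_base"
proof
  assume 1: "x 0 = 1"
  have *: "(x 0)\<^sup>2 + (\<Sum>i<n. (x (Suc i))\<^sup>2) = 1" "\<forall>i>n. x i = 0" using assms by (auto simp: in_nsphere_split)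
  then have "(\<Sum>i<n. (x (Suc i))\<^sup>2) = 0" using 1 by simp
  then have "\<forall>i<n. x (Suc i) = 0" by (simp add: sum_nonneg_eq_0_iff)
  then have "x i = 0" if "i > 0" for i
    using that *(2) by (cases "i > n") (auto simp: gr0_conv_Suc)
  then show "x = sphere_base" using 1 by (auto simp: sphere_base_def fun_eq_iff)
qed (simp add: sphere_base_def)

lemma sphere_base_0 [simp]: "sphere_base 0 = 1" by (simp add: sphere_base_def)

subsection \<open>Collapsing a cap\<close>

text \<open>
  The points of the cap \<open>x 0 \<ge> 1/2\<close> are moved along great circles into the base point: the formula is
  the normalization of a point on the segment from \<open>x\<close> to the base point.  The points with \<open>x 0 \<le> 0\<close> do
  not move, so the segment never passes through the origin.
\<close>
definition cap_slide :: "real \<times> (nat \<Rightarrow> real) \<Rightarrow> nat \<Rightarrow> real" where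
  "cap_slide z i =
     (let \<kappa> = fst z * max 0 (min 1 (2 * snd z 0))
      in ((1 - \<kappa>) * snd z i + \<kappa> * sphere_base i) / sqrt ((1 - \<kappa>)\<^sup>2 + 2 * \<kappa> * (1 - \<kappa>) * snd z 0 + \<kappa>\<^sup>2))"

lemma cap_slide_norm:
  fixes \<kappa> c :: real
  assumes "0 \<le> \<kappa>" "\<kappa> \<le> 1" "0 < \<kappa> \<Longrightarrow> 0 \<le> c"
  shows "(1 - \<kappa>)\<^sup>2 + 2 * \<kappa> * (1 - \<kappa>) * c + \<kappa>\<^sup>2 > 0"
proof (cases "\<kappa> = 0")
  case False
  then have "0 < \<kappa>\<^sup>2" "0 \<le> 2 * \<kappa> * (1 - \<kappa>) * c" using assms by auto
  then show ?thesis using zero_le_power2[of "1 - \<kappa>"] by linarith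
qed simp

lemma continuous_cap_slide:
  "continuous_map (prod_topology unit_interval (nsphere n)) (nsphere n) (cap_slide)"
proof (rule continuous_map_into_nsphere)
  let ?Z = "prod_topology unit_interval (nsphere n)"
  define \<kappa> where "\<kappa> = (\<lambda>z :: real \<times> (nat \<Rightarrow> real). fst z * max 0 (min 1 (2 * snd z 0)))"
  define N where "N = (\<lambda>z. (1 - \<kappa> z)\<^sup>2 + 2 * \<kappa> z * (1 - \<kappa> z) * snd z 0 + (\<kappa> z)\<^sup>2)"
  have cs: "cap_slide z i = ((1 - \<kappa> z) * snd z i + \<kappa> z * sphere_base i) / sqrt (N z)" for z i
    by (simp add: cap_slide_def \<kappa>_def N_def Let_def)
  have \<kappa>01: "0 \<le> \<kappa> z" "\<kappa> z \<le> 1" "0 < \<kappa> z \<Longrightarrow> 0 \<le> snd z 0" if "z \<in> topspace ?Z" for z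
    using that by (auto simp: \<kappa>_def mult_le_one zero_less_mult_iff)
  have N: "N z > 0" if "z \<in> topspace ?Z" for z
    unfolding N_def by (rule cap_slide_norm) (use \<kappa>01[OF that] in auto)
  have x: "continuous_map ?Z euclideanreal (\<lambda>z. snd z i)" for i
    by (rule continuous_map_nsphere_coord[OF continuous_map_snd])
  have u: "continuous_map ?Z euclideanreal fst"
    by (rule continuous_map_unit_interval_real, rule continuous_map_fst)
  have c\<kappa>: "continuous_map ?Z euclideanreal \<kappa>"
    unfolding \<kappa>_def by (intro continuous_intros u x) simp_all
  have cN: "continuous_map ?Z euclideanreal N"
    unfolding N_def by (intro continuous_intros c\<kappa> x) simp_all
  show "continuous_map ?Z euclideanreal (\<lambda>z. cap_slide z i)" for i
    unfolding cs by (intro continuous_intros cN c\<kappa> x) (use N in fastforce)+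
  show "cap_slide z \<in> topspace (nsphere n)" if z: "z \<in> topspace ?Z" for z
  proof -
    have s: "(snd z 0)\<^sup>2 + (\<Sum>i<n. (snd z (Suc i))\<^sup>2) = 1" and s0: "\<forall>i>n. snd z i = 0"
      using z by (auto simp: in_nsphere_split)
    have "(cap_slide z 0)\<^sup>2 = ((1 - \<kappa> z) * snd z 0 + \<kappa> z)\<^sup>2 / N z"
      using N[OF z] by (simp add: cs power_divide)
    moreover have "(\<Sum>i<n. (cap_slide z (Suc i))\<^sup>2) = (1 - \<kappa> z)\<^sup>2 * (\<Sum>i<n. (snd z (Suc i))\<^sup>2) / N z"
      using N[OF z]
      by (simp add: cs power_divide power_mult_distrib sphere_base_def sum_distrib_left sum_divide_distrib)
    moreover have "((1 - \<kappa> z) * snd z 0 + \<kappa> z)\<^sup>2 + (1 - \<kappa> z)\<^sup>2 * (\<Sum>i<n. (snd z (Suc i))\<^sup>2) = N z"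
    proof -
      have e: "(\<Sum>i<n. (snd z (Suc i))\<^sup>2) = 1 - (snd z 0)\<^sup>2" using s by simp
      show ?thesis unfolding e N_def by algebra
    qed
    ultimately have "(cap_slide z 0)\<^sup>2 + (\<Sum>i<n. (cap_slide z (Suc i))\<^sup>2) = 1"
      using N[OF z] by (simp add: add_divide_distrib[symmetric])
    then show ?thesis using s0 by (auto simp: in_nsphere_split cs sphere_base_def)
  qed
qed

lemma cap_slide_0: "cap_slide (0, x) = x"
  by (simp add: cap_slide_def Let_def fun_eq_iff)

lemma cap_slide_base:
  assumes "0 \<le> u" "u \<le> 1" shows "cap_slide (u, sphere_base) = sphere_base"
proof -
  have "(1 - u)\<^sup>2 + 2 * u * (1 - u) + u\<^sup>2 = 1" by algebra
  then show ?thesis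
    by (auto simp: cap_slide_def Let_def fun_eq_iff algebra_simps)
qed

lemma cap_slide_1: "x 0 \<ge> 1/2 \<Longrightarrow> cap_slide (1, x) = sphere_base"
  by (auto simp: cap_slide_def Let_def fun_eq_iff)

subsection \<open>The smash product of two spheres\<close>

text \<open>
  Stereographic projection from the base point identifies \<open>S\<^sup>n\<close> with the one-point compactification of
  \<open>\<real>\<^sup>n\<close>.  In these coordinates the present map is the identification of \<open>\<real>\<^sup>k \<times> \<real>\<^sup>m\<close> with \<open>\<real>\<^sup>k\<^sup>+\<^sup>m\<close>, and
  everything at infinity goes to infinity.  If \<open>u = x' / a\<close> and \<open>v = y' / b\<close> are the projections of the
  two points, then \<open>\<bar>u\<bar>\<^sup>2 + \<bar>v\<bar>\<^sup>2 + 1 = D / (a b)\<close>, which gives the formula below.  When both points are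
  base points, \<open>D = 0\<close>, and division by zero yields the base point, as it should.
\<close>
definition sphere_smash :: "nat \<Rightarrow> nat \<Rightarrow> (nat \<Rightarrow> real) \<times> (nat \<Rightarrow> real) \<Rightarrow> nat \<Rightarrow> real" where
  "sphere_smash k m z i =
     (let a = 1 - fst z 0; b = 1 - snd z 0; D = 2 * a + 2 * b - a * b in
      if i = 0 then 1 - 2 * a * b / D
      else if i \<le> k then 2 * b * fst z i / D
      else if i \<le> k + m then 2 * a * snd z (i - k) / D else 0)"

text \<open>
  At a zero of \<open>D\<close> the quotient has the value 0, and near it the quotient is bounded by \<open>e\<close>, which tends
  to 0 there.
\<close>
lemma continuous_map_real_quotient_null:
  assumes N: "continuous_map Z euclideanreal N" and D: "continuous_map Z euclideanreal D"
    and e: "continuous_map Z euclideanreal e"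
    and bound: "\<And>z. z \<in> topspace Z \<Longrightarrow> \<bar>N z\<bar> \<le> \<bar>D z\<bar> * e z"
    and null: "\<And>z. z \<in> topspace Z \<Longrightarrow> D z = 0 \<Longrightarrow> e z = 0"
  shows "continuous_map Z euclideanreal (\<lambda>z. N z / D z)"
  unfolding continuous_map_atin
proof (intro ballI, unfold limitin_canonical_iff)
  fix z assume z: "z \<in> topspace Z"
  have lim: "(f \<longlongrightarrow> f z) (atin Z z)" if "continuous_map Z euclideanreal f" for f
    using that z by (simp add: continuous_map_atin)
  show "((\<lambda>z. N z / D z) \<longlongrightarrow> N z / D z) (atin Z z)"
  proof (cases "D z = 0")
    case False
    then show ?thesis by (intro tendsto_divide lim N D)
  next
    case True
    have "\<forall>\<^sub>F x in atin Z z. norm (N x / D x) \<le> e x"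
    proof -
      have "norm (N x / D x) \<le> e x" if "x \<in> topspace Z" for x
      proof (cases "D x = 0")
        case True then show ?thesis using null[OF that] by simp
      next
        case False then show ?thesis using bound[OF that] by (simp add: abs_divide divide_le_eq mult.commute)
      qed
      then show ?thesis by (auto simp: eventually_atin)
    qed
    then have "((\<lambda>x. N x / D x) \<longlongrightarrow> 0) (atin Z z)"
      by (rule Lim_null_comparison) (use lim[OF e] null[OF z True] in simp)
    then show ?thesis using True by simp
  qed
qed

text \<open>
  The factors \<open>2 - a\<close> and \<open>2 - b\<close> are nonnegative, so \<open>D = a (2 - b) + 2 b = 2 a + b (2 - a)\<close> dominates
  both \<open>a\<close> and \<open>b\<close>.  In particular \<open>D\<close> vanishes only at the pair of base points, and the coordinates of
  the smash map tend there to those of the base point.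
\<close>
lemma smash_denominator:
  fixes a b :: real
  assumes "0 \<le> a" "a \<le> 2" "0 \<le> b" "b \<le> 2"
  shows "a \<le> 2 * a + 2 * b - a * b" "b \<le> 2 * a + 2 * b - a * b"
proof -
  have "a * b \<le> 2 * b" "a * b \<le> a * 2" using assms by (auto intro: mult_right_mono mult_left_mono)
  then show "a \<le> 2 * a + 2 * b - a * b" "b \<le> 2 * a + 2 * b - a * b" using assms by linarith+
qed

lemma sum_nat_add_split: "(\<Sum>i<k + m. g i) = (\<Sum>i<k. g i) + (\<Sum>j<m. g (k + j))" for g :: "nat \<Rightarrow> real"
  by (induction m) auto

lemma continuous_sphere_smash:
  "continuous_map (prod_topology (nsphere k) (nsphere m)) (nsphere (k + m)) (sphere_smash k m)"
proof (rule continuous_map_into_nsphere)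
  let ?Z = "prod_topology (nsphere k) (nsphere m)"
  define a where "a = (\<lambda>z :: (nat \<Rightarrow> real) \<times> (nat \<Rightarrow> real). 1 - fst z 0)"
  define b where "b = (\<lambda>z :: (nat \<Rightarrow> real) \<times> (nat \<Rightarrow> real). 1 - snd z 0)"
  define D where "D = (\<lambda>z. 2 * a z + 2 * b z - a z * b z)"
  have sm: "sphere_smash k m z i = (if i = 0 then 1 - 2 * a z * b z / D z
      else if i \<le> k then 2 * b z * fst z i / D z
      else if i \<le> k + m then 2 * a z * snd z (i - k) / D z else 0)" for z i
    by (simp add: sphere_smash_def a_def b_def D_def Let_def)
  have ab: "0 \<le> a z" "a z \<le> 2" "0 \<le> b z" "b z \<le> 2" if "z \<in> topspace ?Z" for z
    using that nsphere_coord_bounds[of "fst z" k 0] nsphere_coord_bounds[of "snd z" m 0]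
    by (auto simp: a_def b_def)
  have Dge: "a z \<le> D z" "b z \<le> D z" if "z \<in> topspace ?Z" for z
    unfolding D_def using smash_denominator ab[OF that] by blast+
  have D0: "a z = 0" "b z = 0" if "z \<in> topspace ?Z" "D z = 0" for z
    using Dge[OF that(1)] ab[OF that(1)] that(2) by auto
  have x: "continuous_map ?Z euclideanreal (\<lambda>z. fst z i)" for i
    by (rule continuous_map_nsphere_coord[OF continuous_map_fst])
  have y: "continuous_map ?Z euclideanreal (\<lambda>z. snd z i)" for i
    by (rule continuous_map_nsphere_coord[OF continuous_map_snd])
  have ca: "continuous_map ?Z euclideanreal a" and cb: "continuous_map ?Z euclideanreal b"
    unfolding a_def b_def by (intro continuous_intros x y; simp)+
  have cD: "continuous_map ?Z euclideanreal D"
    unfolding D_def by (intro continuous_intros ca cb) simp_all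
  have c0: "continuous_map ?Z euclideanreal (\<lambda>z. 2 * a z * b z / D z)"
  proof (rule continuous_map_real_quotient_null[where e = "\<lambda>z. 2 * a z"])
    show "\<bar>2 * a z * b z\<bar> \<le> \<bar>D z\<bar> * (2 * a z)" if "z \<in> topspace ?Z" for z
      using mult_left_mono[OF Dge(2)[OF that], of "2 * a z"] ab[OF that] Dge[OF that]
      by (simp add: abs_mult mult_ac)
  qed (use D0 in \<open>auto intro!: continuous_intros ca cb cD\<close>)
  have cx: "continuous_map ?Z euclideanreal (\<lambda>z. 2 * b z * fst z i / D z)" if "i > 0" for i
  proof (rule continuous_map_real_quotient_null[where e = "\<lambda>z. 2 * \<bar>fst z i\<bar>"])
    show "\<bar>2 * b z * fst z i\<bar> \<le> \<bar>D z\<bar> * (2 * \<bar>fst z i\<bar>)" if "z \<in> topspace ?Z" for z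
      using mult_left_mono[OF Dge(2)[OF that], of "2 * \<bar>fst z i\<bar>"] ab[OF that] Dge[OF that]
      by (simp add: abs_mult mult_ac)
    show "2 * \<bar>fst z i\<bar> = 0" if "z \<in> topspace ?Z" "D z = 0" for z
    proof -
      have "fst z = sphere_base"
        using nsphere_base_iff[of "fst z" k] D0[OF that] that(1) by (auto simp: a_def)
      then show ?thesis using \<open>i > 0\<close> by (simp add: sphere_base_def)
    qed
  qed (auto intro!: continuous_intros ca cb cD x)
  have cy: "continuous_map ?Z euclideanreal (\<lambda>z. 2 * a z * snd z i / D z)" if "i > 0" for i
  proof (rule continuous_map_real_quotient_null[where e = "\<lambda>z. 2 * \<bar>snd z i\<bar>"])
    show "\<bar>2 * a z * snd z i\<bar> \<le> \<bar>D z\<bar> * (2 * \<bar>snd z i\<bar>)" if "z \<in> topspace ?Z" for z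
      using mult_left_mono[OF Dge(1)[OF that], of "2 * \<bar>snd z i\<bar>"] ab[OF that] Dge[OF that]
      by (simp add: abs_mult mult_ac)
    show "2 * \<bar>snd z i\<bar> = 0" if "z \<in> topspace ?Z" "D z = 0" for z
    proof -
      have "snd z = sphere_base"
        using nsphere_base_iff[of "snd z" m] D0[OF that] that(1) by (auto simp: b_def)
      then show ?thesis using \<open>i > 0\<close> by (simp add: sphere_base_def)
    qed
  qed (auto intro!: continuous_intros ca cb cD y)
  show "continuous_map ?Z euclideanreal (\<lambda>z. sphere_smash k m z i)" for i
  proof -
    consider "i = 0" | "0 < i" "i \<le> k" | "k < i" "i \<le> k + m" | "k + m < i" by linarith
    then show ?thesis
    proof cases
      case 1 then show ?thesis by (auto simp: sm intro!: continuous_intros c0)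
    next
      case 2 then show ?thesis using cx[of i] by (simp add: sm)
    next
      case 3 then show ?thesis using cy[of "i - k"] by (simp add: sm)
    next
      case 4 then show ?thesis by (simp add: sm)
    qed
  qed
  show "sphere_smash k m z \<in> topspace (nsphere (k + m))" if z: "z \<in> topspace ?Z" for z
  proof -
    have sx: "(\<Sum>i<k. (fst z (Suc i))\<^sup>2) = a z * (2 - a z)"
      and sy: "(\<Sum>i<m. (snd z (Suc i))\<^sup>2) = b z * (2 - b z)"
      using z by (auto simp: in_nsphere_split a_def b_def algebra_simps power2_eq_square)
    have s: "(\<Sum>i<k + m. (sphere_smash k m z (Suc i))\<^sup>2)
      = (4 * (b z)\<^sup>2 * (a z * (2 - a z)) + 4 * (a z)\<^sup>2 * (b z * (2 - b z))) / (D z)\<^sup>2"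
    proof -
      have "(\<Sum>i<k. (sphere_smash k m z (Suc i))\<^sup>2) = (\<Sum>i<k. 4 * (b z)\<^sup>2 / (D z)\<^sup>2 * (fst z (Suc i))\<^sup>2)"
        by (rule sum.cong) (auto simp: sm power_divide power_mult_distrib)
      moreover have "(\<Sum>j<m. (sphere_smash k m z (Suc (k + j)))\<^sup>2)
          = (\<Sum>j<m. 4 * (a z)\<^sup>2 / (D z)\<^sup>2 * (snd z (Suc j))\<^sup>2)"
        by (rule sum.cong) (auto simp: sm power_divide power_mult_distrib Suc_diff_le)
      ultimately show ?thesis
        unfolding sum_nat_add_split sum_distrib_left[symmetric] sx sy by (simp add: add_divide_distrib)
    qed
    have "(sphere_smash k m z 0)\<^sup>2 + (\<Sum>i<k + m. (sphere_smash k m z (Suc i))\<^sup>2) = 1"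
    proof (cases "D z = 0")
      case True then show ?thesis unfolding s by (simp add: sm)
    next
      case False
      then have "(1 - 2 * a z * b z / D z)\<^sup>2
        + (4 * (b z)\<^sup>2 * (a z * (2 - a z)) + 4 * (a z)\<^sup>2 * (b z * (2 - b z))) / (D z)\<^sup>2
        = ((D z - 2 * a z * b z)\<^sup>2
        + (4 * (b z)\<^sup>2 * (a z * (2 - a z)) + 4 * (a z)\<^sup>2 * (b z * (2 - b z)))) / (D z)\<^sup>2"
        by (simp add: field_simps power2_eq_square)
      also have "(D z - 2 * a z * b z)\<^sup>2
        + (4 * (b z)\<^sup>2 * (a z * (2 - a z)) + 4 * (a z)\<^sup>2 * (b z * (2 - b z))) = (D z)\<^sup>2"
        unfolding D_def by algebra
      finally show ?thesis using False unfolding s by (simp add: sm)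
    qed
    then show ?thesis by (auto simp: in_nsphere_split sm)
  qed
qed

lemma sphere_smash_base:
  "fst z = sphere_base \<Longrightarrow> sphere_smash k m z = sphere_base"
  "snd z = sphere_base \<Longrightarrow> sphere_smash k m z = sphere_base"
  by (auto simp: sphere_smash_def sphere_base_def Let_def fun_eq_iff)

text \<open>
  Off the wedge, one minus the first coordinate of the image is \<open>2 a b / D\<close>, and dividing the other
  coordinates by it recovers the stereographic coordinates \<open>x' / a\<close> and \<open>y' / b\<close>, and the norm of these determines \<open>a\<close> and \<open>b\<close>, because
  \<open>\<bar>x'\<bar>\<^sup>2 / a\<^sup>2 = 2 / a - 1\<close>.
\<close>
lemma sphere_smash_inj:
  assumes z: "z \<in> topspace (prod_topology (nsphere k) (nsphere m))"
    and z': "z' \<in> topspace (prod_topology (nsphere k) (nsphere m))"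
    and eq: "sphere_smash k m z = sphere_smash k m z'"
  shows "z = z' \<or> (fst z = sphere_base \<or> snd z = sphere_base) \<and> (fst z' = sphere_base \<or> snd z' = sphere_base)"
proof -
  define a where "a = (\<lambda>z :: (nat \<Rightarrow> real) \<times> (nat \<Rightarrow> real). 1 - fst z 0)"
  define b where "b = (\<lambda>z :: (nat \<Rightarrow> real) \<times> (nat \<Rightarrow> real). 1 - snd z 0)"
  define D where "D = (\<lambda>z. 2 * a z + 2 * b z - a z * b z)"
  let ?Z = "prod_topology (nsphere k) (nsphere m)"
  have sm: "sphere_smash k m z i = (if i = 0 then 1 - 2 * a z * b z / D z
      else if i \<le> k then 2 * b z * fst z i / D z
      else if i \<le> k + m then 2 * a z * snd z (i - k) / D z else 0)" for z i
    by (simp add: sphere_smash_def a_def b_def D_def Let_def)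
  have ab: "0 \<le> a z" "a z \<le> 2" "0 \<le> b z" "b z \<le> 2" if "z \<in> topspace ?Z" for z
    using that nsphere_coord_bounds[of "fst z" k 0] nsphere_coord_bounds[of "snd z" m 0]
    by (auto simp: a_def b_def)
  have D0: "D z > 0" if "z \<in> topspace ?Z" "a z * b z \<noteq> 0" for z
  proof -
    have "a z \<noteq> 0" using that(2) by auto
    then show ?thesis
      using smash_denominator(1)[OF ab[OF that(1)]] ab(1)[OF that(1)] unfolding D_def by linarith
  qed
  have quot0: "a z * b z / D z = 0 \<longleftrightarrow> a z * b z = 0" if "z \<in> topspace ?Z" for z
  proof (cases "a z * b z = 0")
    case False
    then have "D z \<noteq> 0" using D0[OF that] by simp
    then show ?thesis by (simp only: divide_eq_0_iff simp_thms)
  qed (simp only: div_0 simp_thms)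
  have wedge: "fst z = sphere_base \<or> snd z = sphere_base" if "z \<in> topspace ?Z" "a z * b z = 0" for z
    using that nsphere_base_iff[of "fst z" k] nsphere_base_iff[of "snd z" m] by (auto simp: a_def b_def)
  have sx: "(\<Sum>i<k. (fst z (Suc i))\<^sup>2) = a z * (2 - a z)"
    and sy: "(\<Sum>i<m. (snd z (Suc i))\<^sup>2) = b z * (2 - b z)" if "z \<in> topspace ?Z" for z
    using that by (auto simp: in_nsphere_split a_def b_def algebra_simps power2_eq_square)
  have eq0: "a z * b z / D z = a z' * b z' / D z'"
    using fun_cong[OF eq, of 0] by (simp add: sm)
  show ?thesis
  proof (cases "a z * b z = 0 \<or> a z' * b z' = 0")
    case True
    moreover have "a z * b z = 0 \<longleftrightarrow> a z' * b z' = 0"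
      using eq0 quot0[OF z] quot0[OF z'] by metis
    ultimately have "a z * b z = 0" "a z' * b z' = 0" by blast+
    then show ?thesis using wedge z z' by blast
  next
    case False
    then have nz: "a z \<noteq> 0" "b z \<noteq> 0" "a z' \<noteq> 0" "b z' \<noteq> 0" and D: "D z > 0" "D z' > 0"
      using D0 z z' by auto
    define r where "r = a z * b z / D z"
    have r': "r = a z' * b z' / D z'" by (simp add: r_def eq0)
    have "r \<noteq> 0" unfolding r_def using nz D by simp
    moreover have "b z / D z = r / a z" "a z / D z = r / b z" unfolding r_def using nz by simp_all
    moreover have "b z' / D z' = r / a z'" "a z' / D z' = r / b z'" unfolding r' using nz by simp_all
    ultimately have r: "r \<noteq> 0" "b z / D z = r / a z" "b z' / D z' = r / a z'"
      "a z / D z = r / b z" "a z' / D z' = r / b z'" by blast+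
    have xe: "fst z (Suc i) / a z = fst z' (Suc i) / a z'" if "i < k" for i
    proof -
      have "b z * fst z (Suc i) / D z = b z' * fst z' (Suc i) / D z'"
        using fun_cong[OF eq, of "Suc i"] that by (simp add: sm)
      then have "r * (fst z (Suc i) / a z) = r * (fst z' (Suc i) / a z')"
        using r(2,3) by (metis times_divide_eq_left times_divide_eq_right)
      then show ?thesis using r(1) mult_left_cancel by blast
    qed
    have ye: "snd z (Suc i) / b z = snd z' (Suc i) / b z'" if "i < m" for i
    proof -
      have "a z * snd z (Suc i) / D z = a z' * snd z' (Suc i) / D z'"
        using fun_cong[OF eq, of "Suc (k + i)"] that by (simp add: sm Suc_diff_le)
      then have "r * (snd z (Suc i) / b z) = r * (snd z' (Suc i) / b z')"
        using r(4,5) by (metis times_divide_eq_left times_divide_eq_right)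
      then show ?thesis using r(1) mult_left_cancel by blast
    qed
    have "(\<Sum>i<k. (fst z (Suc i) / a z)\<^sup>2) = (\<Sum>i<k. (fst z' (Suc i) / a z')\<^sup>2)"
      by (rule sum.cong) (use xe in auto)
    then have "a z * (2 - a z) / (a z)\<^sup>2 = a z' * (2 - a z') / (a z')\<^sup>2"
      unfolding power_divide sum_divide_distrib[symmetric] sx[OF z] sx[OF z'] .
    then have ae: "a z = a z'" using nz by (simp add: field_simps power2_eq_square)
    have "(\<Sum>i<m. (snd z (Suc i) / b z)\<^sup>2) = (\<Sum>i<m. (snd z' (Suc i) / b z')\<^sup>2)"
      by (rule sum.cong) (use ye in auto)
    then have "b z * (2 - b z) / (b z)\<^sup>2 = b z' * (2 - b z') / (b z')\<^sup>2"
      unfolding power_divide sum_divide_distrib[symmetric] sy[OF z] sy[OF z'] .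
    then have be: "b z = b z'" using nz by (simp add: field_simps power2_eq_square)
    have "fst z i = fst z' i" for i
    proof (cases i)
      case 0 then show ?thesis using ae by (simp add: a_def)
    next
      case (Suc j) then show ?thesis using xe[of j] ae nz z z' by (cases "j < k") (auto simp: in_nsphere_split)
    qed
    moreover have "snd z i = snd z' i" for i
    proof (cases i)
      case 0 then show ?thesis using be by (simp add: b_def)
    next
      case (Suc j) then show ?thesis using ye[of j] be nz z z' by (cases "j < m") (auto simp: in_nsphere_split)
    qed
    ultimately show ?thesis by (auto simp: prod_eq_iff)
  qed
qed

text \<open>
  The stereographic coordinates of the point \<open>w\<close> are split into a block of length \<open>k\<close> and a block of
  length \<open>m\<close>, with squared norms \<open>U\<close> and \<open>V\<close>.  The inverse projections of the two blocks are at
  distance \<open>a = 2 / (U + 1)\<close> and \<open>b = 2 / (V + 1)\<close> from the base points, in the first coordinate.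
\<close>
lemma sphere_smash_surj:
  "sphere_smash k m ` topspace (prod_topology (nsphere k) (nsphere m)) = topspace (nsphere (k + m))"
proof
  show "sphere_smash k m ` topspace (prod_topology (nsphere k) (nsphere m)) \<subseteq> topspace (nsphere (k + m))"
    using continuous_sphere_smash continuous_map_image_subset_topspace by blast
  show "topspace (nsphere (k + m)) \<subseteq> sphere_smash k m ` topspace (prod_topology (nsphere k) (nsphere m))"
  proof
    fix w assume w: "w \<in> topspace (nsphere (k + m))"
    show "w \<in> sphere_smash k m ` topspace (prod_topology (nsphere k) (nsphere m))"
    proof (cases "w = sphere_base")
      case True
      then show ?thesis
        by (intro image_eqI[of _ _ "(sphere_base, sphere_base)"])
          (simp_all add: sphere_smash_base sphere_base_in_nsphere)
    next
      case False
      define c where "c = 1 - w 0"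
      have c: "c > 0" using False nsphere_coord_bounds[OF w, of 0] nsphere_base_iff[OF w] by (auto simp: c_def)
      define U where "U = (\<Sum>i<k. (w (Suc i) / c)\<^sup>2)"
      define V where "V = (\<Sum>i<m. (w (Suc (k + i)) / c)\<^sup>2)"
      have UV0: "U \<ge> 0" "V \<ge> 0" by (simp_all add: U_def V_def sum_nonneg)
      have "(\<Sum>i<k. (w (Suc i))\<^sup>2) + (\<Sum>i<m. (w (Suc (k + i)))\<^sup>2) = c * (2 - c)"
        using w by (simp add: in_nsphere_split sum_nat_add_split c_def algebra_simps power2_eq_square)
      then have UV: "U + V = (2 - c) / c"
        using c by (simp add: U_def V_def power_divide sum_divide_distrib[symmetric] add_divide_distrib[symmetric])
          (simp add: power2_eq_square)
      define a where "a = 2 / (U + 1)"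
      define b where "b = 2 / (V + 1)"
      define x where "x = (\<lambda>i. if i = 0 then 1 - a else if i \<le> k then a * (w i / c) else 0)"
      define y where "y = (\<lambda>i. if i = 0 then 1 - b else if i \<le> m then b * (w (k + i) / c) else 0)"
      have "U + 1 \<noteq> 0" "V + 1 \<noteq> 0" using UV0 by linarith+
      then have aU: "a * (U + 1) = 2" "b * (V + 1) = 2"
        using a_def b_def nonzero_eq_divide_eq by metis+
      have ab: "a > 0" "b > 0" using UV0 by (auto simp: a_def b_def)
      have "(\<Sum>i<k. (x (Suc i))\<^sup>2) = a\<^sup>2 * U"
        unfolding U_def sum_distrib_left by (rule sum.cong) (auto simp: x_def power_mult_distrib power_divide)
      moreover have "(1 - a)\<^sup>2 + a\<^sup>2 * U = 1 - 2 * a + a * (a * (U + 1))"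
        by (simp add: power2_eq_square algebra_simps)
      then have "(1 - a)\<^sup>2 + a\<^sup>2 * U = 1" by (simp add: aU)
      ultimately have x: "x \<in> topspace (nsphere k)" by (auto simp: in_nsphere_split x_def)
      have "(\<Sum>i<m. (y (Suc i))\<^sup>2) = b\<^sup>2 * V"
        unfolding V_def sum_distrib_left by (rule sum.cong) (auto simp: y_def power_mult_distrib power_divide)
      moreover have "(1 - b)\<^sup>2 + b\<^sup>2 * V = 1 - 2 * b + b * (b * (V + 1))"
        by (simp add: power2_eq_square algebra_simps)
      then have "(1 - b)\<^sup>2 + b\<^sup>2 * V = 1" by (simp add: aU)
      ultimately have y: "y \<in> topspace (nsphere m)" by (auto simp: in_nsphere_split y_def)
      define D where "D = 2 * a + 2 * b - a * b"
      have UVc: "(U + V + 1) * c = 2" using UV c by (simp add: field_simps)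
      have "D = a * (U + 1) * b + b * (V + 1) * a - a * b" unfolding D_def aU by simp
      also have "\<dots> = a * b * (U + V + 1)" by (simp add: algebra_simps)
      finally have "D * c = a * b * ((U + V + 1) * c)" by simp
      then have Dc: "D * c = 2 * (a * b)" unfolding UVc by simp
      have D: "D > 0" using Dc c ab by (metis mult_pos_pos zero_less_mult_pos2 zero_less_numeral)
      have Dc': "2 * (a * b) / D = c" using Dc D by (simp add: field_simps)
      have "sphere_smash k m (x, y) i = w i" for i
      proof -
        have sm: "sphere_smash k m (x, y) i = (if i = 0 then 1 - 2 * a * b / D
            else if i \<le> k then 2 * b * x i / D
            else if i \<le> k + m then 2 * a * y (i - k) / D else 0)"
          by (simp add: sphere_smash_def D_def Let_def x_def y_def)
        consider "i = 0" | "0 < i" "i \<le> k" | "k < i" "i \<le> k + m" | "k + m < i" by linarith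
        then show ?thesis
        proof cases
          case 1 then show ?thesis unfolding sm using Dc' by (simp add: c_def mult.assoc)
        next
          case 2
          then have "sphere_smash k m (x, y) i = (2 * (a * b) / D) * (w i / c)"
            unfolding sm by (simp add: x_def mult_ac)
          then show ?thesis using c by (simp add: Dc')
        next
          case 3
          then have "sphere_smash k m (x, y) i = (2 * (a * b) / D) * (w i / c)"
            unfolding sm by (simp add: y_def mult_ac)
          then show ?thesis using c by (simp add: Dc')
        next
          case 4 then show ?thesis using w unfolding sm by (simp add: in_nsphere)
        qed
      qed
      then show ?thesis using x y by (intro image_eqI[of _ _ "(x, y)"]) auto
    qed
  qed
qed

lemma sphere_smash_quotient:
  "quotient_map (prod_topology (nsphere k) (nsphere m)) (nsphere (k + m)) (sphere_smash k m)"
proof (rule continuous_closed_imp_quotient_map[OF continuous_sphere_smash _ sphere_smash_surj])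
  show "closed_map (prod_topology (nsphere k) (nsphere m)) (nsphere (k + m)) (sphere_smash k m)"
    by (rule continuous_imp_closed_map[OF continuous_sphere_smash _ nsphere_Hausdorff])
      (simp add: compact_space_prod_topology nsphere_compact)
qed

subsection \<open>The circle as a quotient of the interval\<close>

definition circle_path :: "real \<Rightarrow> nat \<Rightarrow> real" where
  "circle_path t i = (if i = 0 then cos (2 * pi * t) else if i = 1 then sin (2 * pi * t) else 0)"

lemma continuous_circle_path: "continuous_map unit_interval (nsphere 1) circle_path"
proof (rule continuous_map_into_nsphere)
  show "continuous_map unit_interval euclideanreal (\<lambda>t. circle_path t i)" for i
    unfolding circle_path_def
    by (cases "i = 0"; cases "i = 1") (auto intro!: continuous_intros)
qed (auto simp: in_nsphere_split circle_path_def)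

lemma circle_path_ends [simp]: "circle_path 0 = sphere_base" "circle_path 1 = sphere_base"
  by (auto simp: circle_path_def sphere_base_def fun_eq_iff)

lemma circle_path_inj:
  assumes "0 \<le> s" "s \<le> 1" "0 \<le> t" "t \<le> 1" "circle_path s = circle_path t"
  shows "s = t \<or> s \<in> {0, 1} \<and> t \<in> {0, 1}"
proof -
  have "cos (2 * pi * s) = cos (2 * pi * t)" "sin (2 * pi * s) = sin (2 * pi * t)"
    using fun_cong[OF assms(5), of 0] fun_cong[OF assms(5), of 1] by (auto simp: circle_path_def)
  then have "\<exists>k::int. 2 * pi * s = 2 * pi * t + 2 * pi * of_int k"
    using sin_cos_eq_iff[of "2 * pi * s" "2 * pi * t"] by (auto elim!: Ints_cases)
  then obtain k :: int where "2 * pi * s = 2 * pi * (t + of_int k)" by (auto simp: distrib_left)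
  then have s: "s = t + of_int k" by simp
  have "-1 \<le> k" "k \<le> 1" using s assms by linarith+
  then have "k = -1 \<or> k = 0 \<or> k = 1" by linarith
  then show ?thesis using s assms by auto
qed

lemma circle_path_surj: "circle_path ` topspace unit_interval = topspace (nsphere 1)"
proof
  show "circle_path ` topspace unit_interval \<subseteq> topspace (nsphere 1)"
    using continuous_circle_path continuous_map_image_subset_topspace by blast
  show "topspace (nsphere 1) \<subseteq> circle_path ` topspace unit_interval"
  proof
    fix x assume x: "x \<in> topspace (nsphere 1)"
    then have "(x 0)\<^sup>2 + (x 1)\<^sup>2 = 1" by (simp add: in_nsphere_split)
    then obtain \<theta> where \<theta>: "0 \<le> \<theta>" "\<theta> < 2 * pi" "x 0 = cos \<theta>" "x 1 = sin \<theta>"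
      using sincos_total_2pi by metis
    have "x i = circle_path (\<theta> / (2 * pi)) i" for i
    proof -
      consider "i = 0" | "i = 1" | "i > 1" by linarith
      then show ?thesis using \<theta> x by cases (auto simp: circle_path_def in_nsphere_split)
    qed
    then show "x \<in> circle_path ` topspace unit_interval"
      using \<theta> by (intro image_eqI[of _ _ "\<theta> / (2 * pi)"]) (auto simp: fun_eq_iff divide_simps)
  qed
qed

lemma circle_path_quotient: "quotient_map unit_interval (nsphere 1) circle_path"
proof (rule continuous_closed_imp_quotient_map[OF continuous_circle_path _ circle_path_surj])
  show "closed_map unit_interval (nsphere 1) circle_path"
    by (rule continuous_imp_closed_map[OF continuous_circle_path unit_interval_compact nsphere_Hausdorff])
qed

section \<open>Lifting through maps that are onto on homotopy groups\<close>

definition onto_homotopy_groups :: "'e topology \<Rightarrow> 'e \<Rightarrow> ('e \<Rightarrow> 'b) \<Rightarrow> 'b topology \<Rightarrow> bool" where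
  "onto_homotopy_groups E e0 p B \<longleftrightarrow>
     (\<forall>d \<ge> 1. \<forall>f \<in> based_maps d B (p e0). \<exists>F \<in> based_maps d E e0.
        homotopic_with (\<lambda>h. h sphere_base = p e0) (nsphere d) B (p \<circ> F) f)"

text \<open>
  A loop is a map on the circle.  The homotopy is stated as one of constant families, which is how
  it is used.
\<close>
lemma lift_loop:
  assumes onto: "onto_homotopy_groups E e0 p B"
    and \<gamma>: "continuous_map unit_interval B \<gamma>" "\<gamma> 0 = p e0" "\<gamma> 1 = p e0"
  obtains \<delta> where "continuous_map unit_interval E \<delta>" "\<delta> 0 = e0" "\<delta> 1 = e0"
    "homotopic_rel_ends X B (\<lambda>z. p (\<delta> (snd z))) (\<lambda>z. \<gamma> (snd z))"
proof -
  obtain f where f: "continuous_map (nsphere 1) B f" "\<And>t. t \<in> topspace unit_interval \<Longrightarrow> f (circle_path t) = \<gamma> t"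
  proof (rule quotient_map_lift_exists[OF circle_path_quotient \<gamma>(1)])
    fix s t assume "s \<in> topspace unit_interval" "t \<in> topspace unit_interval" "circle_path s = circle_path t"
    then show "\<gamma> s = \<gamma> t" using circle_path_inj[of s t] \<gamma> by auto
  qed (rule that)
  have "f sphere_base = p e0" using f(2)[of 0] \<gamma>(2) by simp
  then have "f \<in> based_maps 1 B (p e0)" using f(1) by (simp add: based_maps_def)
  then obtain F where F: "F \<in> based_maps 1 E e0"
    and "homotopic_with (\<lambda>h. h sphere_base = p e0) (nsphere 1) B (p \<circ> F) f"
    using onto unfolding onto_homotopy_groups_def by blast
  then obtain h where h: "continuous_map (prod_topology unit_interval (nsphere 1)) B h"
    "\<And>z. h (0, z) = p (F z)" "\<And>z. h (1, z) = f z" "\<And>u. 0 \<le> u \<Longrightarrow> u \<le> 1 \<Longrightarrow> h (u, sphere_base) = p e0"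
    unfolding homotopic_with_def by auto
  let ?Z = "prod_topology unit_interval (prod_topology X unit_interval)"
  have "continuous_map ?Z B (\<lambda>z. h (fst z, circle_path (snd (snd z))))"
    by (intro continuous_map_comp[OF h(1)] continuous_map_pairedI continuous_map_comp[OF continuous_circle_path]
        cmap_intros)
  then have "homotopic_rel_ends X B (\<lambda>z. p (F (circle_path (snd z)))) (\<lambda>z. \<gamma> (snd z))"
    by (rule homotopic_rel_endsI) (use h f F in \<open>auto simp: based_maps_def\<close>)
  moreover have "continuous_map unit_interval E (\<lambda>t. F (circle_path t))"
    by (rule continuous_map_comp[OF _ continuous_circle_path]) (use F in \<open>simp add: based_maps_def\<close>)
  ultimately show ?thesis using that[of "\<lambda>t. F (circle_path t)"] F by (auto simp: based_maps_def)
qed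

lemma continuous_const_family:
  "continuous_map unit_interval B \<gamma> \<Longrightarrow> continuous_map (prod_topology X unit_interval) B (\<lambda>z. \<gamma> (snd z))"
  by (rule continuous_map_comp[OF _ continuous_map_snd])

text \<open>
  The path \<open>\<gamma>\<close> followed by the reverse of \<open>p \<circ> \<delta>\<close> is a loop.  It lifts, up to homotopy, to a loop \<open>\<eta>\<close> at \<open>e0\<close>,
  and \<open>\<eta>\<close> followed by \<open>\<delta>\<close> is a path over \<open>\<gamma>\<close> with the prescribed ends.
\<close>
lemma lift_path_with_end:
  assumes onto: "onto_homotopy_groups E e0 p B" and p: "continuous_map E B p"
    and \<delta>: "continuous_map unit_interval E \<delta>" "\<delta> 0 = e0"
    and \<gamma>: "continuous_map unit_interval B \<gamma>" "\<gamma> 0 = p e0" "\<gamma> 1 = p (\<delta> 1)"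
  obtains \<zeta> where "continuous_map (prod_topology X unit_interval) E \<zeta>" "\<And>x. \<zeta> (x, 0) = e0" "\<And>x. \<zeta> (x, 1) = \<delta> 1"
    "homotopic_rel_ends X B (p \<circ> \<zeta>) (\<lambda>z. \<gamma> (snd z))"
proof -
  let ?\<Gamma> = "\<lambda>z :: 'c \<times> real. \<gamma> (snd z)"
  let ?\<Delta> = "\<lambda>z :: 'c \<times> real. \<delta> (snd z)"
  let ?\<epsilon> = "family_join ?\<Gamma> (family_reverse (p \<circ> ?\<Delta>))"
  have \<Gamma>: "continuous_map (prod_topology X unit_interval) B ?\<Gamma>" for X :: "'c topology"
    by (rule continuous_const_family[OF \<gamma>(1)])
  have \<Delta>: "continuous_map (prod_topology X unit_interval) E ?\<Delta>" for X :: "'c topology"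
    by (rule continuous_const_family[OF \<delta>(1)])
  have p\<Delta>: "continuous_map (prod_topology X unit_interval) B (p \<circ> ?\<Delta>)" for X :: "'c topology"
    by (rule continuous_map_compose[OF \<Delta> p])
  have \<epsilon>: "continuous_map (prod_topology X unit_interval) B ?\<epsilon>" for X :: "'c topology"
    by (rule continuous_family_join[OF \<Gamma> continuous_family_reverse[OF p\<Delta>]]) (use \<gamma> in simp)
  have \<epsilon>x: "?\<epsilon> (x, t) = ?\<epsilon> (undefined, t)" for x t
    by (simp add: family_join_def family_reverse_def)
  have "continuous_map unit_interval B (\<lambda>t. ?\<epsilon> (undefined, t))"
    by (rule continuous_map_comp[OF \<epsilon>[of "discrete_topology UNIV"]]) (auto intro!: cmap_intros)
  then obtain \<eta> where \<eta>: "continuous_map unit_interval E \<eta>" "\<eta> 0 = e0" "\<eta> 1 = e0"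
    "homotopic_rel_ends X B (\<lambda>z. p (\<eta> (snd z))) (\<lambda>z. ?\<epsilon> (undefined, snd z))"
    by (rule lift_loop[OF onto, where X=X]) (use \<gamma> \<delta> in auto)
  let ?\<zeta> = "family_join (\<lambda>z. \<eta> (snd z)) ?\<Delta>"
  have *: "homotopic_rel_ends X B (p \<circ> (\<lambda>z. \<eta> (snd z))) ?\<epsilon>"
    by (rule homotopic_rel_ends_cong[OF \<eta>(4)]) (simp_all add: \<epsilon>x[symmetric])
  have "homotopic_rel_ends X B (family_join (p \<circ> (\<lambda>z. \<eta> (snd z))) (p \<circ> ?\<Delta>)) (family_join ?\<epsilon> (p \<circ> ?\<Delta>))"
    by (rule homotopic_rel_ends_join[OF * homotopic_rel_ends_refl[OF p\<Delta>]]) (simp add: \<eta> \<delta>)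
  moreover have "homotopic_rel_ends X B (family_join ?\<epsilon> (p \<circ> ?\<Delta>)) ?\<Gamma>"
    by (rule family_join_reverse_cancel[OF \<Gamma> p\<Delta>]) (simp add: \<gamma>)
  ultimately have "homotopic_rel_ends X B (p \<circ> ?\<zeta>) ?\<Gamma>"
    unfolding family_join_image by (rule homotopic_rel_ends_trans)
  moreover have "continuous_map (prod_topology X unit_interval) E ?\<zeta>"
    by (rule continuous_family_join[OF continuous_const_family[OF \<eta>(1)] \<Delta>]) (simp add: \<eta> \<delta>)
  ultimately show ?thesis using that[of ?\<zeta>] by (simp add: \<eta>)
qed

text \<open>
  After multiplication with the reverse of the loop at \<open>x0\<close>, the loop over \<open>x0\<close> is contractible.  The
  contraction is extended to the whole family by the homotopy extension property of \<open>(X, {x0})\<close>.  Its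
  target here is the space \<open>L\<close> of loops in \<open>B\<close> at \<open>b0\<close>, and this keeps the ends of all paths fixed during
  the homotopy.
\<close>
lemma family_trivial_at_base_point:
  assumes X: "Hausdorff_space X" "well_pointed X x0"
    and a: "continuous_map (prod_topology X unit_interval) B a"
    and ends: "\<And>x. x \<in> topspace X \<Longrightarrow> a (x, 0) = b0 \<and> a (x, 1) = b0"
  obtains b where "continuous_map (prod_topology X unit_interval) B b"
    "homotopic_rel_ends X B (family_join a (family_reverse (\<lambda>z. a (x0, snd z)))) b"
    "\<And>t. 0 \<le> t \<Longrightarrow> t \<le> 1 \<Longrightarrow> b (x0, t) = b0"
proof -
  let ?a0 = "\<lambda>t. a (x0, t)"
  let ?c = "family_join a (family_reverse (\<lambda>z. ?a0 (snd z)))"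
  \<comment> \<open>The loop over \<open>x0\<close> runs along \<open>?a0\<close> and back; cutting \<open>?w\<close> off at \<open>1 - u\<close> contracts it.\<close>
  let ?w = "\<lambda>t::real. min (2 * t) (2 - 2 * t)"
  let ?M = "mapping_space unit_interval B"
  define L where "L = subtopology ?M {q. q 0 = b0 \<and> q 1 = b0}"
  have x0: "x0 \<in> topspace X" using X(2) by (simp add: well_pointed_def)
  have a0: "continuous_map unit_interval B ?a0"
    by (rule continuous_map_comp[OF a]) (use x0 in \<open>auto intro!: continuous_map_pairedI continuous_map_id'\<close>)
  have c: "continuous_map (prod_topology X unit_interval) B ?c"
    by (rule continuous_family_join[OF a continuous_family_reverse[OF continuous_const_family[OF a0]]])
      (use ends x0 in simp)
  have c0: "?c (x0, t) = ?a0 (?w t)" if "0 \<le> t" "t \<le> 1" for t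
    using that by (auto simp: family_join_def family_reverse_def min_def max_def field_simps)
  let ?f = "\<lambda>x. \<lambda>t \<in> topspace unit_interval. ?c (x, t)"
  have f: "continuous_map X L ?f"
    unfolding L_def
    by (rule continuous_map_into_subtopology[OF continuous_map_curry[OF c]]) (use ends x0 in auto)
  let ?X0 = "prod_topology unit_interval (subtopology X {x0})"
  let ?h = "\<lambda>z. \<lambda>t \<in> topspace unit_interval. ?a0 (max 0 (min (?w t) (1 - fst z)))"
  have "continuous_map (prod_topology ?X0 unit_interval) B
      (\<lambda>z. ?a0 (max 0 (min (?w (snd z)) (1 - fst (fst z)))))"
  proof (rule continuous_map_comp[OF a0], rule continuous_map_real_unit_interval)
    have t: "continuous_map (prod_topology ?X0 unit_interval) euclideanreal snd"
      by (rule continuous_map_unit_interval_real, rule continuous_map_snd)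
    have u: "continuous_map (prod_topology ?X0 unit_interval) euclideanreal (\<lambda>z. fst (fst z))"
      by (rule continuous_map_fst_real, rule continuous_map_fst)
    show "continuous_map (prod_topology ?X0 unit_interval) euclideanreal
      (\<lambda>z. max 0 (min (?w (snd z)) (1 - fst (fst z))))"
      by (intro continuous_intros t u) simp_all
  qed auto
  then have "continuous_map ?X0 ?M ?h"
    using continuous_map_curry[of ?X0 unit_interval B "\<lambda>z. ?a0 (max 0 (min (?w (snd z)) (1 - fst (fst z))))"]
    by simp
  then have h: "continuous_map ?X0 L ?h"
    unfolding L_def by (rule continuous_map_into_subtopology) (use ends x0 in auto)
  have fh: "\<forall>x \<in> topspace X \<inter> {x0}. ?h (0, x) = ?f x"
    using c0 by (auto simp: restrict_def fun_eq_iff)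
  obtain H where H: "continuous_map (prod_topology unit_interval X) L H"
    "\<forall>x\<in>topspace X. H (0, x) = ?f x"
    "\<forall>u\<in>{0..1}. \<forall>x\<in>topspace X \<inter> {x0}. H (u, x) = ?h (u, x)"
    using well_pointed_homotopy_extension[OF X(2,1), of L] f h fh
    unfolding homotopy_extension_def by blast
  have HM: "continuous_map (prod_topology unit_interval X) ?M H"
    and Hends: "\<And>u x. 0 \<le> u \<Longrightarrow> u \<le> 1 \<Longrightarrow> x \<in> topspace X \<Longrightarrow> H (u, x) 0 = b0 \<and> H (u, x) 1 = b0"
    using H(1) unfolding L_def continuous_map_in_subtopology by auto
  let ?b = "\<lambda>z. H (1, fst z) (snd z)"
  have b: "continuous_map (prod_topology X unit_interval) B ?b"
    by (rule uncurry_unit_interval[OF continuous_map_comp[OF HM]])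
      (auto intro!: cmap_intros)
  have "continuous_map (prod_topology unit_interval (prod_topology X unit_interval)) B
      (\<lambda>z. H (fst z, fst (snd z)) (snd (snd z)))"
    by (rule uncurry_unit_interval[OF continuous_map_comp[OF HM]]) (auto intro!: cmap_intros)
  then have "homotopic_rel_ends X B ?c ?b"
    by (rule homotopic_rel_endsI) (use H(2) Hends ends x0 in auto)
  moreover have "?b (x0, t) = b0" if "0 \<le> t" "t \<le> 1" for t
    using H(3) x0 that ends by auto
  ultimately show ?thesis using that b by blast
qed

subsection \<open>Wedges of spheres\<close>

text \<open>
  The universal property of the wedge.  The base point \<open>None\<close> needs its own clause: for \<open>I = {}\<close> it is
  the only point, and it does not come from a sphere.
\<close>
lemma continuous_map_from_wedge:
  fixes I :: "'i set"
  assumes z: "z \<in> topspace Z"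
    and f: "\<And>i. i \<in> I \<Longrightarrow> continuous_map (nsphere (d i)) Z (f i)" "\<And>i. i \<in> I \<Longrightarrow> f i sphere_base = z"
  shows "continuous_map (wedge_of_spheres I d) Z (\<lambda>v. case v of None \<Rightarrow> z | Some w \<Rightarrow> f (fst w) (snd w))"
    (is "continuous_map _ _ ?g")
proof -
  let ?S = "sum_topology (\<lambda>i. nsphere (d i)) I"
  let ?c = "collapse (I \<times> {sphere_base})"
  have g: "?g (?c (i, s)) = f i s" if "i \<in> I" for i s
    using that f(2) by (auto simp: collapse_def)
  show ?thesis
    unfolding continuous_map
  proof (intro conjI allI impI)
    show "?g ` topspace (wedge_of_spheres I d) \<subseteq> topspace Z"
    proof -
      have "?g (?c (i, s)) \<in> topspace Z" if "i \<in> I" "s \<in> topspace (nsphere (d i))" for i s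
        using f(1)[OF that(1)] that by (auto simp: g continuous_map_def)
      then show ?thesis using z by (auto simp: wedge_of_spheres_def topspace_quotient_space)
    qed
    fix U assume U: "openin Z U"
    let ?P = "{v \<in> topspace (wedge_of_spheres I d). ?g v \<in> U}"
    have "{x \<in> topspace ?S. ?c x \<in> ?P} = Sigma I (\<lambda>i. {s \<in> topspace (nsphere (d i)). f i s \<in> U})"
    proof (rule set_eqI)
      fix w :: "'i \<times> (nat \<Rightarrow> real)"
      obtain i s where w: "w = (i, s)" by (cases w)
      have "?c (i, s) \<in> topspace (wedge_of_spheres I d)" if "i \<in> I" "s \<in> topspace (nsphere (d i))"
        using that by (auto simp: wedge_of_spheres_def topspace_quotient_space)
      then show "w \<in> {x \<in> topspace ?S. ?c x \<in> ?P}
        \<longleftrightarrow> w \<in> Sigma I (\<lambda>i. {s \<in> topspace (nsphere (d i)). f i s \<in> U})"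
        using g[of i s] unfolding w by auto
    qed
    moreover have "openin ?S (Sigma I (\<lambda>i. {s \<in> topspace (nsphere (d i)). f i s \<in> U}))"
      unfolding openin_disjoint_union using openin_continuous_map_preimage[OF f(1) U] by blast
    ultimately show "openin (wedge_of_spheres I d) ?P"
      unfolding wedge_of_spheres_def openin_quotient_space
      by (auto simp: topspace_quotient_space)
  qed
qed

lemma continuous_map_into_wedge:
  assumes i: "i \<in> I"
  shows "continuous_map (nsphere (d i)) (wedge_of_spheres I d) (\<lambda>s. collapse (I \<times> {sphere_base}) (i, s))"
  unfolding continuous_map
proof (intro conjI allI impI)
  show "(\<lambda>s. collapse (I \<times> {sphere_base}) (i, s)) ` topspace (nsphere (d i)) \<subseteq> topspace (wedge_of_spheres I d)"
    using i by (auto simp: wedge_of_spheres_def topspace_quotient_space)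
  fix U assume "openin (wedge_of_spheres I d) U"
  then have "openin (sum_topology (\<lambda>i. nsphere (d i)) I)
    {x \<in> topspace (sum_topology (\<lambda>i. nsphere (d i)) I). collapse (I \<times> {sphere_base}) x \<in> U}"
    by (simp add: wedge_of_spheres_def openin_quotient_space)
  then have "openin (nsphere (d i))
    {s. (i, s) \<in> {x \<in> topspace (sum_topology (\<lambda>i. nsphere (d i)) I). collapse (I \<times> {sphere_base}) x \<in> U}}"
    using i unfolding openin_sum_topology by blast
  then show "openin (nsphere (d i)) {s \<in> topspace (nsphere (d i)). collapse (I \<times> {sphere_base}) (i, s) \<in> U}"
    using i by simp
qed

text \<open>
  A map \<open>g\<close> on a sphere lifts up to a free homotopy \<open>H\<close>, whatever its value at the base point, provided
  that this value can be joined to \<open>p e0\<close> by a path \<open>\<delta>\<close>.  It is important that the track of the base point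
  under \<open>H\<close> depends only on \<open>\<delta>\<close>: then the homotopies on the spheres of a wedge fit together.

  The homotopy has three stages.  The first makes \<open>g\<close> constant on a cap around the base point, the second
  lets the cap run out along \<open>\<delta>\<close>, which makes the map based, and the third exists by hypothesis.  The
  zero-dimensional sphere has no such hypothesis; there the third stage is a path that joins the value
  at the second point to \<open>p e0\<close>, and the lift is constant.
\<close>
lemma lift_sphere_up_to_track:
  assumes onto: "onto_homotopy_groups E e0 p B" and p: "continuous_map E B p" and e0: "e0 \<in> topspace E"
    and g: "continuous_map (nsphere d) B g"
    and comp: "\<And>s. s \<in> topspace (nsphere d) \<Longrightarrow> path_component_of B (p e0) (g s)"
    and \<delta>: "continuous_map unit_interval B \<delta>" "\<delta> 0 = g sphere_base" "\<delta> 1 = p e0"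
  shows "\<exists>G H. continuous_map (nsphere d) E G \<and> G sphere_base = e0 \<and>
    (\<forall>s \<in> topspace (nsphere d). path_component_of E e0 (G s)) \<and>
    continuous_map (prod_topology (nsphere d) unit_interval) B H \<and>
    (\<forall>s \<in> topspace (nsphere d). H (s, 0) = g s \<and> H (s, 1) = p (G s)) \<and>
    (\<forall>t. 0 \<le> t \<longrightarrow> t \<le> 1 \<longrightarrow> H (sphere_base, t) =
       family_join (family_join (\<lambda>z. \<delta> 0) (\<lambda>z. \<delta> (snd z))) (\<lambda>z. \<delta> 1) (sphere_base, t))"
proof -
  let ?S = "nsphere d"
  let ?Z = "prod_topology ?S unit_interval"
  let ?q1 = "\<lambda>z. g (cap_slide (snd z, fst z))"
  let ?q2 = "\<lambda>z. if fst z 0 \<le> 1/2 then g (cap_slide (1, fst z))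
                  else \<delta> (snd z * max 0 (min 1 (2 * fst z 0 - 1)))"
  have x: "continuous_map ?Z euclideanreal (\<lambda>z. fst z i)" for i
    by (rule continuous_map_nsphere_coord[OF continuous_map_fst])
  have u: "continuous_map ?Z euclideanreal snd"
    by (rule continuous_map_unit_interval_real, rule continuous_map_snd)
  have q1: "continuous_map ?Z B ?q1"
    by (intro continuous_map_comp[OF g] continuous_map_comp[OF continuous_cap_slide] cmap_intros)
  have slide1: "continuous_map ?S ?S (\<lambda>s. cap_slide (1, s))"
    by (rule continuous_map_comp[OF continuous_cap_slide]) (auto intro!: continuous_map_pairedI continuous_map_id')
  have q2: "continuous_map ?Z B ?q2"
  proof (rule continuous_map_paste[OF x])
    show "continuous_map ?Z B (\<lambda>z. g (cap_slide (1, fst z)))"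
      by (intro continuous_map_comp[OF g] continuous_map_comp[OF slide1] continuous_map_fst)
    show "continuous_map ?Z B (\<lambda>z. \<delta> (snd z * max 0 (min 1 (2 * fst z 0 - 1))))"
    proof (rule continuous_map_comp[OF \<delta>(1)], rule continuous_map_real_unit_interval)
      show "continuous_map ?Z euclideanreal (\<lambda>z. snd z * max 0 (min 1 (2 * fst z 0 - 1)))"
        by (intro continuous_intros u x) simp_all
    qed (auto intro!: mult_le_one)
    show "g (cap_slide (1, fst z)) = \<delta> (snd z * max 0 (min 1 (2 * fst z 0 - 1)))"
      if "z \<in> topspace ?Z" "fst z 0 = 1/2" for z
      using that \<delta> by (simp add: cap_slide_1)
  qed
  have q12: "?q1 (s, 1) = ?q2 (s, 0)" if "s \<in> topspace ?S" for s
    using \<delta> by (simp add: cap_slide_1)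
  let ?g' = "\<lambda>s. ?q2 (s, 1)"
  have g': "continuous_map ?S B ?g'"
    by (rule continuous_map_comp[OF q2]) (auto intro!: continuous_map_pairedI continuous_map_id')
  have g'b: "?g' sphere_base = p e0" using \<delta> by simp
  have "\<exists>G q3. continuous_map ?S E G \<and> G sphere_base = e0 \<and>
    (\<forall>s \<in> topspace ?S. path_component_of E e0 (G s)) \<and> continuous_map ?Z B q3 \<and>
    (\<forall>s \<in> topspace ?S. q3 (s, 0) = ?g' s \<and> q3 (s, 1) = p (G s)) \<and>
    (\<forall>t. 0 \<le> t \<longrightarrow> t \<le> 1 \<longrightarrow> q3 (sphere_base, t) = p e0)"
  proof (cases "d = 0")
    case True
    define m :: "nat \<Rightarrow> real" where "m = (\<lambda>i. if i = 0 then -1 else 0)"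
    have m: "m \<in> topspace ?S" using True by (simp add: in_nsphere m_def)
    have S0: "s = sphere_base \<or> s = m" if "s \<in> topspace ?S" for s
    proof -
      have "(s 0)\<^sup>2 = 1" "\<forall>i>0. s i = 0" using that True by (auto simp: in_nsphere)
      then show ?thesis by (auto simp: power2_eq_1_iff sphere_base_def m_def fun_eq_iff)
    qed
    have "cap_slide (1, m) \<in> topspace ?S"
      using slide1 m by (auto simp: continuous_map_def)
    then have "path_component_of B (?g' m) (p e0)"
      using comp path_component_of_sym by (force simp: m_def)
    then obtain \<eta> where \<eta>: "continuous_map unit_interval B \<eta>" "\<eta> 0 = ?g' m" "\<eta> 1 = p e0"
      unfolding path_component_of_def pathin_def by blast
    let ?q3 = "\<lambda>z. if fst z 0 \<le> 0 then \<eta> (snd z) else p e0"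
    have pe0: "p e0 \<in> topspace B" using p e0 by (auto simp: continuous_map_def)
    have "continuous_map ?Z B ?q3"
    proof (rule continuous_map_paste[OF x])
      show "\<eta> (snd z) = p e0" if "z \<in> topspace ?Z" "fst z 0 = 0" for z
        using S0[of "fst z"] that by (auto simp: m_def sphere_base_def)
    qed (use pe0 in \<open>auto intro!: continuous_const_family \<eta>\<close>)
    moreover have "?q3 (s, 0) = ?g' s \<and> ?q3 (s, 1) = p e0" if "s \<in> topspace ?S" for s
      using S0[OF that] \<eta> \<delta> by (auto simp: m_def)
    ultimately show ?thesis
      using e0 by (intro exI[of _ "\<lambda>s. e0"] exI[of _ ?q3]) (simp add: path_component_of_refl)
  next
    case False
    then have d: "d \<ge> 1" by simp
    have "?g' \<in> based_maps d B (p e0)" using g' g'b by (simp add: based_maps_def)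
    then obtain G where G: "G \<in> based_maps d E e0"
      and Gg': "homotopic_with (\<lambda>h. h sphere_base = p e0) ?S B (p \<circ> G) ?g'"
      using onto d unfolding onto_homotopy_groups_def by blast
    obtain h where h: "continuous_map (prod_topology unit_interval ?S) B h"
      "\<And>z. h (0, z) = ?g' z" "\<And>z. h (1, z) = p (G z)" "\<And>u. 0 \<le> u \<Longrightarrow> u \<le> 1 \<Longrightarrow> h (u, sphere_base) = p e0"
      using homotopic_with_symD[OF Gg'] unfolding homotopic_with_def by auto
    have cG: "continuous_map ?S E G" "G sphere_base = e0" using G by (auto simp: based_maps_def)
    have "path_component_of E e0 (G s)" if "s \<in> topspace ?S" for s
    proof -
      have "path_component_of ?S sphere_base s"
        using nsphere_path_connected[OF d] that sphere_base_in_nsphere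
        by (simp add: path_connected_space_iff_path_component)
      then show ?thesis using path_component_of_continuous_image[OF cG(1)] cG(2) by metis
    qed
    moreover have "continuous_map ?Z B (\<lambda>z. h (snd z, fst z))"
      by (intro continuous_map_comp[OF h(1)] cmap_intros)
    ultimately show ?thesis
      using cG h by (intro exI[of _ G] exI[of _ "\<lambda>z. h (snd z, fst z)"]) simp
  qed
  then obtain G q3 where G: "continuous_map ?S E G" "G sphere_base = e0"
    "\<And>s. s \<in> topspace ?S \<Longrightarrow> path_component_of E e0 (G s)" and q3: "continuous_map ?Z B q3"
    "\<And>s. s \<in> topspace ?S \<Longrightarrow> q3 (s, 0) = ?g' s \<and> q3 (s, 1) = p (G s)"
    "\<And>t. 0 \<le> t \<Longrightarrow> t \<le> 1 \<Longrightarrow> q3 (sphere_base, t) = p e0" by blast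
  let ?H = "family_join (family_join ?q1 ?q2) q3"
  have "continuous_map ?Z B ?H"
    by (intro continuous_family_join q1 q2 q3(1)) (use q12 q3 in auto)
  moreover have "?H (s, 0) = g s \<and> ?H (s, 1) = p (G s)" if "s \<in> topspace ?S" for s
    using q3(2)[OF that] by (simp add: cap_slide_0)
  moreover have "?H (sphere_base, t) =
       family_join (family_join (\<lambda>z. \<delta> 0) (\<lambda>z. \<delta> (snd z))) (\<lambda>z. \<delta> 1) (sphere_base, t)"
    if "0 \<le> t" "t \<le> 1" for t
    using that q3(3) \<delta> by (auto simp: family_join_def cap_slide_base)
  ultimately show ?thesis using G by (intro exI[of _ G] exI[of _ ?H]) blast
qed

text \<open>
  The homotopies of \<open>lift_sphere_up_to_track\<close> are glued as maps from the spheres into the space of paths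
  in \<open>B\<close>, all of which send the base point to the common track \<open>\<tau>\<close>.
\<close>
lemma lift_wedge_of_spheres:
  assumes onto: "onto_homotopy_groups E e0 p B" and p: "continuous_map E B p" and e0: "e0 \<in> topspace E"
    and g: "continuous_map (wedge_of_spheres I d) B g"
    and comp: "\<And>v. v \<in> topspace (wedge_of_spheres I d) \<Longrightarrow> path_component_of B (p e0) (g v)"
  obtains G where "continuous_map (wedge_of_spheres I d) E G"
    "\<And>v. v \<in> topspace (wedge_of_spheres I d) \<Longrightarrow> path_component_of E e0 (G v)"
    "homotopic_with (\<lambda>h. True) (wedge_of_spheres I d) B (p \<circ> G) g"
proof -
  let ?V = "wedge_of_spheres I d"
  let ?c = "collapse (I \<times> {sphere_base})"
  have topV: "topspace ?V = insert None (?c ` (SIGMA i:I. topspace (nsphere (d i))))"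
    by (simp add: wedge_of_spheres_def topspace_quotient_space o_def)
  have "path_component_of B (g None) (p e0)" using comp topV by (simp add: path_component_of_sym)
  then obtain \<delta> where \<delta>: "continuous_map unit_interval B \<delta>" "\<delta> 0 = g None" "\<delta> 1 = p e0"
    unfolding path_component_of_def pathin_def by blast
  let ?\<tau> = "\<lambda>t. family_join (family_join (\<lambda>z. \<delta> 0) (\<lambda>z. \<delta> (snd z))) (\<lambda>z. \<delta> 1) (sphere_base, t)"
  let ?g = "\<lambda>i s. g (?c (i, s))"
  have gi: "continuous_map (nsphere (d i)) B (?g i)" if "i \<in> I" for i
    by (rule continuous_map_comp[OF g continuous_map_into_wedge[OF that]])
  have "\<forall>i \<in> I. \<exists>G H. continuous_map (nsphere (d i)) E G \<and> G sphere_base = e0 \<and>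
    (\<forall>s \<in> topspace (nsphere (d i)). path_component_of E e0 (G s)) \<and>
    continuous_map (prod_topology (nsphere (d i)) unit_interval) B H \<and>
    (\<forall>s \<in> topspace (nsphere (d i)). H (s, 0) = ?g i s \<and> H (s, 1) = p (G s)) \<and>
    (\<forall>t. 0 \<le> t \<longrightarrow> t \<le> 1 \<longrightarrow> H (sphere_base, t) = ?\<tau> t)"
  proof
    fix i assume i: "i \<in> I"
    show "\<exists>G H. continuous_map (nsphere (d i)) E G \<and> G sphere_base = e0 \<and>
      (\<forall>s \<in> topspace (nsphere (d i)). path_component_of E e0 (G s)) \<and>
      continuous_map (prod_topology (nsphere (d i)) unit_interval) B H \<and>
      (\<forall>s \<in> topspace (nsphere (d i)). H (s, 0) = ?g i s \<and> H (s, 1) = p (G s)) \<and>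
      (\<forall>t. 0 \<le> t \<longrightarrow> t \<le> 1 \<longrightarrow> H (sphere_base, t) = ?\<tau> t)"
    proof (rule lift_sphere_up_to_track[OF onto p e0 gi[OF i] _ \<delta>(1) _ \<delta>(3)])
      show "path_component_of B (p e0) (?g i s)" if "s \<in> topspace (nsphere (d i))" for s
        by (rule comp) (use that i topV in blast)
      show "\<delta> 0 = ?g i sphere_base" using \<delta>(2) i by (simp add: collapse_def)
    qed
  qed
  then obtain G H where GH: "\<forall>i \<in> I. continuous_map (nsphere (d i)) E (G i) \<and> G i sphere_base = e0 \<and>
    (\<forall>s \<in> topspace (nsphere (d i)). path_component_of E e0 (G i s)) \<and>
    continuous_map (prod_topology (nsphere (d i)) unit_interval) B (H i) \<and>
    (\<forall>s \<in> topspace (nsphere (d i)). H i (s, 0) = ?g i s \<and> H i (s, 1) = p (G i s)) \<and>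
    (\<forall>t. 0 \<le> t \<longrightarrow> t \<le> 1 \<longrightarrow> H i (sphere_base, t) = ?\<tau> t)"
    unfolding bchoice_iff by blast
  let ?G = "\<lambda>v. case v of None \<Rightarrow> e0 | Some w \<Rightarrow> G (fst w) (snd w)"
  have cG: "continuous_map ?V E ?G"
    by (rule continuous_map_from_wedge[OF e0]) (use GH in auto)
  have "path_component_of E e0 (?G v)" if "v \<in> topspace ?V" for v
    using that GH e0 unfolding topV by (auto simp: collapse_def path_component_of_refl)
  let ?M = "mapping_space unit_interval B"
  let ?T = "\<lambda>t \<in> topspace unit_interval. ?\<tau> t"
  let ?K = "\<lambda>v. case v of None \<Rightarrow> ?T | Some w \<Rightarrow> (\<lambda>t \<in> topspace unit_interval. H (fst w) (snd w, t))"
  have "continuous_map (prod_topology (nsphere 0) unit_interval) B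
     (family_join (family_join (\<lambda>z. \<delta> 0) (\<lambda>z. \<delta> (snd z))) (\<lambda>z. \<delta> 1))"
  proof -
    have "\<delta> 0 \<in> topspace B" "\<delta> 1 \<in> topspace B" using \<delta>(1) by (auto simp: continuous_map_def)
    then show ?thesis by (intro continuous_family_join continuous_const_family[OF \<delta>(1)]) auto
  qed
  then have \<tau>: "continuous_map unit_interval B ?\<tau>"
    by (rule continuous_map_comp)
      (auto intro!: continuous_map_pairedI continuous_map_id' sphere_base_in_nsphere)
  have T: "?T \<in> topspace ?M" by (simp add: restrict_in_maps[OF \<tau>, simplified])
  have K: "continuous_map ?V ?M ?K"
  proof (rule continuous_map_from_wedge[where f = "\<lambda>i s. \<lambda>t \<in> topspace unit_interval. H i (s, t)", OF T])
    fix i assume i: "i \<in> I"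
    show "continuous_map (nsphere (d i)) ?M (\<lambda>s. \<lambda>t \<in> topspace unit_interval. H i (s, t))"
      by (rule continuous_map_curry) (use GH i in blast)
    show "(\<lambda>t \<in> topspace unit_interval. H i (sphere_base, t)) = ?T"
      using GH i by (auto simp: restrict_def fun_eq_iff)
  qed
  have cK: "continuous_map (prod_topology unit_interval ?V) B (\<lambda>z. ?K (snd z) (fst z))"
    by (rule uncurry_unit_interval[OF continuous_map_comp[OF K continuous_map_snd] continuous_map_fst])
  have K01: "?K v 0 = g v \<and> ?K v 1 = p (?G v)" if v: "v \<in> topspace ?V" for v
  proof (cases v)
    case None then show ?thesis using \<delta> by simp
  next
    case (Some w)
    then have w: "fst w \<in> I" "snd w \<in> topspace (nsphere (d (fst w)))" "?c w = Some w"
      using v unfolding topV by (auto simp: collapse_def split: if_splits)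
    then have "g v = ?g (fst w) (snd w)" using Some by simp
    then show ?thesis using w GH Some by simp
  qed
  have "homotopic_with (\<lambda>h. True) ?V B g (p \<circ> ?G)"
    by (rule homotopic_withI[OF cK]) (simp_all add: K01)
  then have "homotopic_with (\<lambda>h. True) ?V B (p \<circ> ?G) g" by (rule homotopic_with_symD)
  then show ?thesis using that cG \<open>\<And>v. v \<in> topspace ?V \<Longrightarrow> path_component_of E e0 (?G v)\<close> by blast
qed

subsection \<open>Lifting families of loops\<close>

text \<open>
  The lift is \<open>(\<zeta> \<cdot> F \<cdot> \<zeta>\<^sup>-\<^sup>1) \<cdot> \<alpha>\<close>.  Here \<open>F\<close> is a map on \<open>\<Sigma>X\<close>, seen as a family of paths, such that
  \<open>p \<circ> F\<close> is freely homotopic to \<open>a \<cdot> a0\<^sup>-\<^sup>1\<close>, where \<open>a0\<close> is the loop over \<open>x0\<close>; \<open>\<zeta>\<close> is a path from \<open>e0\<close> to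
  \<open>F(None)\<close> over the track of the base point; and the loop \<open>\<alpha>\<close> lifts \<open>a0\<close>.
\<close>
theorem lift_family_of_loops:
  fixes X :: "'x topology" and I :: "'i set"
  assumes onto: "onto_homotopy_groups E e0 p B" and p: "continuous_map E B p" and e0: "e0 \<in> topspace E"
    and X: "Hausdorff_space X" "well_pointed X x0"
    and susp: "reduced_suspension X x0 homotopy_equivalent_space wedge_of_spheres I d"
    and a: "continuous_map (prod_topology X unit_interval) B a"
    and ends: "\<And>x. x \<in> topspace X \<Longrightarrow> a (x, 0) = p e0 \<and> a (x, 1) = p e0"
  obtains A where "continuous_map (prod_topology X unit_interval) E A"
    "\<And>x. x \<in> topspace X \<Longrightarrow> A (x, 0) = e0 \<and> A (x, 1) = e0"
    "homotopic_rel_ends X B (p \<circ> A) a"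
proof -
  let ?XI = "prod_topology X unit_interval"
  let ?a0 = "\<lambda>z :: 'x \<times> real. a (x0, snd z)"
  have x0: "x0 \<in> topspace X" using X(2) by (simp add: well_pointed_def)
  have a0: "continuous_map unit_interval B (\<lambda>t. a (x0, t))"
    by (rule continuous_map_comp[OF a]) (use x0 in \<open>auto intro!: continuous_map_pairedI continuous_map_id'\<close>)
  have ca0: "continuous_map ?XI B ?a0" by (rule continuous_const_family[OF a0])
  obtain b where b: "continuous_map ?XI B b" "homotopic_rel_ends X B (family_join a (family_reverse ?a0)) b"
    "\<And>t. 0 \<le> t \<Longrightarrow> t \<le> 1 \<Longrightarrow> b (x0, t) = p e0"
    by (rule family_trivial_at_base_point[OF X a ends]) (assumption, rule that)
  have bends: "b (x, 0) = p e0" "b (x, 1) = p e0" if "x \<in> topspace X" for x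
    using homotopic_rel_ends_ends[OF b(2) that] ends[OF that] ends[OF x0] by auto

  define C where "C = topspace X \<times> {0, 1} \<union> {x0} \<times> {0..1::real}"
  let ?W = "reduced_suspension X x0"
  let ?V = "wedge_of_spheres I d"
  let ?c = "collapse C"
  have c: "quotient_map ?XI ?W ?c"
  proof -
    have "(x0, 0) \<in> C \<inter> topspace ?XI" by (simp add: C_def x0)
    then have "quotient_map ?XI (quotient_space ?XI C) ?c" by (intro quotient_map_collapse) blast
    then show ?thesis by (simp only: C_def reduced_suspension_def)
  qed
  have cc: "continuous_map ?XI ?W ?c" using c quotient_imp_continuous_map by blast
  have c01: "?c (x, 0) = None" "?c (x, 1) = None" if "x \<in> topspace X" for x
    using that by (auto simp: collapse_def C_def)
  obtain f where f: "continuous_map ?W B f" "\<And>z. z \<in> topspace ?XI \<Longrightarrow> f (?c z) = b z"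
  proof (rule quotient_map_lift_exists[OF c b(1)])
    fix y z assume yz: "y \<in> topspace ?XI" "z \<in> topspace ?XI" "?c y = ?c z"
    have "b z = p e0" if "z \<in> C" for z
      using that bends b(3) by (auto simp: C_def)
    then show "b y = b z" using yz(3) by (auto simp: collapse_def split: if_splits)
  qed (rule that)
  have fcomp: "path_component_of B (p e0) (f w)" if w: "w \<in> topspace ?W" for w
  proof -
    obtain x t where xt: "x \<in> topspace X" "0 \<le> t" "t \<le> 1" "w = ?c (x, t)"
    proof -
      have "w \<in> ?c ` topspace ?XI" using w quotient_imp_surjective_map[OF c] by simp
      then obtain z where z: "z \<in> topspace ?XI" "w = ?c z" by blast
      show thesis by (rule that[of "fst z" "snd z"]) (use z in auto)
    qed
    have "continuous_map unit_interval B (\<lambda>s. b (x, t * s))"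
    proof (rule continuous_map_family[OF b(1)])
      show "continuous_map unit_interval euclideanreal (\<lambda>s. t * s)"
        by (intro continuous_intros continuous_map_unit_interval_real[OF continuous_map_id']) simp
    qed (use xt in \<open>auto intro!: mult_le_one\<close>)
    then have "path_component_of B (b (x, t * 0)) (b (x, t * 1))"
      unfolding path_component_of_def pathin_def by fastforce
    then show ?thesis using xt bends f(2)[of "(x, t)"] by simp
  qed

  \<comment> \<open>The homotopy equivalence is not assumed to preserve base points, so \<open>p \<circ> F\<close> and \<open>f\<close> are joined
      only by the free homotopy \<open>k\<close>.\<close>
  obtain \<phi> \<psi> where \<phi>: "continuous_map ?W ?V \<phi>" and \<psi>: "continuous_map ?V ?W \<psi>"
    and \<psi>\<phi>: "homotopic_with (\<lambda>h. True) ?W ?W (\<psi> \<circ> \<phi>) id"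
    using susp unfolding homotopy_equivalent_space_def by blast
  obtain G where G: "continuous_map ?V E G"
    "\<And>v. v \<in> topspace ?V \<Longrightarrow> path_component_of E e0 (G v)"
    "homotopic_with (\<lambda>h. True) ?V B (p \<circ> G) (f \<circ> \<psi>)"
  proof (rule lift_wedge_of_spheres[OF onto p e0])
    show "continuous_map ?V B (f \<circ> \<psi>)" by (rule continuous_map_compose[OF \<psi> f(1)])
    show "path_component_of B (p e0) ((f \<circ> \<psi>) v)" if "v \<in> topspace ?V" for v
      using fcomp[of "\<psi> v"] that \<psi> by (auto simp: continuous_map_def)
  qed (rule that)
  let ?F = "G \<circ> \<phi>"
  have F: "continuous_map ?W E ?F" by (rule continuous_map_compose[OF \<phi> G(1)])
  have "homotopic_with (\<lambda>h. True) ?W B (p \<circ> G \<circ> \<phi>) (f \<circ> \<psi> \<circ> \<phi>)"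
    by (rule homotopic_with_compose_continuous_map_right[OF G(3) \<phi>]) simp
  moreover have "homotopic_with (\<lambda>h. True) ?W B (f \<circ> (\<psi> \<circ> \<phi>)) (f \<circ> id)"
    by (rule homotopic_with_compose_continuous_map_left[OF \<psi>\<phi> f(1)]) simp
  ultimately have "homotopic_with (\<lambda>h. True) ?W B (p \<circ> ?F) f"
    using homotopic_with_trans by (fastforce simp: comp_assoc)
  then obtain k where k: "continuous_map (prod_topology unit_interval ?W) B k"
    "\<And>w. k (0, w) = p (?F w)" "\<And>w. k (1, w) = f w"
    unfolding homotopic_with_def by auto

  have NW: "None \<in> topspace ?W" by (simp add: reduced_suspension_def topspace_quotient_space)
  have "path_component_of E e0 (?F None)"
    using G(2)[of "\<phi> None"] \<phi> NW by (auto simp: continuous_map_def)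
  then obtain \<delta> where \<delta>: "continuous_map unit_interval E \<delta>" "\<delta> 0 = e0" "\<delta> 1 = ?F None"
    unfolding path_component_of_def pathin_def by blast
  \<comment> \<open>The track of the base point of the suspension under the free homotopy.\<close>
  let ?\<Gamma> = "\<lambda>z :: 'x \<times> real. k (snd z, None)"
  let ?h = "\<lambda>z. k (fst z, ?c (snd z))"
  let ?Fc = "\<lambda>z. ?F (?c z)"
  have f0: "f None = p e0" using f(2)[of "(x0, 0)"] x0 bends c01 by simp
  have h: "continuous_map (prod_topology unit_interval ?XI) B ?h"
    by (intro continuous_map_comp[OF k(1)] continuous_map_pairedI continuous_map_fst
        continuous_map_comp[OF cc continuous_map_snd])
  have conj: "homotopic_rel_ends X B
     (family_join (family_join (family_reverse ?\<Gamma>) (p \<circ> ?Fc)) ?\<Gamma>) b"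
    by (rule homotopic_rel_ends_cong[OF free_homotopy_conjugate[OF h, of ?\<Gamma>]])
      (use c01 f(2) in \<open>auto simp: k(2,3) family_join_def\<close>)
  have \<gamma>: "continuous_map unit_interval B (\<lambda>t. k (1 - t, None))"
  proof (rule continuous_map_comp[OF k(1)], intro continuous_map_pairedI)
    show "continuous_map unit_interval unit_interval (\<lambda>t. 1 - t)"
      by (rule continuous_map_real_unit_interval)
        (auto intro!: continuous_intros continuous_map_unit_interval_real[OF continuous_map_id'])
  qed (use NW in simp)
  have k1: "k (1 - 0, None) = p e0" by (simp add: k(3) f0)
  have k0: "k (1 - 1, None) = p (\<delta> 1)" by (simp add: k(2) \<delta>(3))
  obtain \<zeta> where \<zeta>: "continuous_map ?XI E \<zeta>" "\<And>x. \<zeta> (x, 0) = e0" "\<And>x. \<zeta> (x, 1) = \<delta> 1"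
    "homotopic_rel_ends X B (p \<circ> \<zeta>) (\<lambda>z. k (1 - snd z, None))"
    by (rule lift_path_with_end[OF onto p \<delta>(1,2) \<gamma> k1 k0, where X=X]) (rule that)
  have \<zeta>\<Gamma>: "homotopic_rel_ends X B (p \<circ> \<zeta>) (family_reverse ?\<Gamma>)"
    using \<zeta>(4) by (simp add: family_reverse_def[abs_def])
  have Fc: "continuous_map ?XI E ?Fc" by (rule continuous_map_comp[OF F cc])
  have Fc01: "?Fc (x, 0) = \<delta> 1" "?Fc (x, 1) = \<delta> 1" if "x \<in> topspace X" for x
    using c01[OF that] \<delta>(3) by auto
  let ?A1 = "family_join (family_join \<zeta> ?Fc) (family_reverse \<zeta>)"
  have A1: "continuous_map ?XI E ?A1"
    by (intro continuous_family_join continuous_family_reverse \<zeta>(1) Fc) (use Fc01 \<zeta> in auto)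
  have pFc: "continuous_map ?XI B (p \<circ> ?Fc)" by (rule continuous_map_compose[OF Fc p])
  have "homotopic_rel_ends X B (p \<circ> ?A1)
     (family_join (family_join (family_reverse ?\<Gamma>) (p \<circ> ?Fc)) (family_reverse (family_reverse ?\<Gamma>)))"
    unfolding family_join_image family_reverse_image
    by (intro homotopic_rel_ends_join homotopic_rel_ends_reverse \<zeta>\<Gamma> homotopic_rel_ends_refl[OF pFc])
      (use Fc01 \<zeta> in auto)
  then have pA1: "homotopic_rel_ends X B (p \<circ> ?A1) b"
    unfolding family_reverse_reverse using conj by (rule homotopic_rel_ends_trans)
  \<comment> \<open>The factor \<open>a0\<close> that was split off is put back.\<close>
  obtain \<alpha> where \<alpha>: "continuous_map unit_interval E \<alpha>" "\<alpha> 0 = e0" "\<alpha> 1 = e0"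
    "homotopic_rel_ends X B (\<lambda>z. p (\<alpha> (snd z))) ?a0"
    by (rule lift_loop[OF onto a0 conjunct1[OF ends[OF x0]] conjunct2[OF ends[OF x0]], where X=X]) (rule that)
  let ?A = "family_join ?A1 (\<lambda>z. \<alpha> (snd z))"
  have A: "continuous_map ?XI E ?A"
    by (rule continuous_family_join[OF A1 continuous_const_family[OF \<alpha>(1)]]) (simp add: \<zeta> \<alpha>)
  have "homotopic_rel_ends X B (p \<circ> ?A) (family_join b ?a0)"
    unfolding family_join_image[of p ?A1]
    by (rule homotopic_rel_ends_join[OF pA1]) (use \<alpha> \<zeta> in \<open>auto simp: o_def\<close>)
  moreover have "homotopic_rel_ends X B (family_join (family_join a (family_reverse ?a0)) ?a0) (family_join b ?a0)"
    by (rule homotopic_rel_ends_join[OF b(2) homotopic_rel_ends_refl[OF ca0]]) (use ends x0 in simp)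
  moreover have "homotopic_rel_ends X B (family_join (family_join a (family_reverse ?a0)) ?a0) a"
    by (rule family_join_reverse_cancel[OF a ca0]) (use ends x0 in simp)
  ultimately have "homotopic_rel_ends X B (p \<circ> ?A) a"
    using homotopic_rel_ends_trans homotopic_rel_ends_sym by blast
  then show ?thesis using that[of ?A] A by (simp add: \<zeta> \<alpha>)
qed

section \<open>Iterated loop spaces\<close>

text \<open>
  The \<open>k\<close>-fold loop space.  Describing it by maps from \<open>S\<^sup>k\<close> instead of iterating the loop space keeps
  its type independent of \<open>k\<close>.
\<close>
definition sphere_loops :: "nat \<Rightarrow> 'b topology \<Rightarrow> 'b \<Rightarrow> ((nat \<Rightarrow> real) \<Rightarrow> 'b) topology" where
  "sphere_loops k B b0 = subtopology (mapping_space (nsphere k) B) {g. g sphere_base = b0}"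

lemma continuous_into_sphere_loops:
  assumes "continuous_map (prod_topology W (nsphere k)) B f"
    and "\<And>w. w \<in> topspace W \<Longrightarrow> f (w, sphere_base) = b0"
  shows "continuous_map W (sphere_loops k B b0) (\<lambda>w. \<lambda>s \<in> topspace (nsphere k). f (w, s))"
  unfolding sphere_loops_def
  by (rule continuous_map_into_subtopology[OF continuous_map_curry[OF assms(1)]])
    (use assms(2) sphere_base_in_nsphere in auto)

lemma continuous_from_sphere_loops:
  assumes "continuous_map W (sphere_loops k B b0) f" "continuous_map W (nsphere k) s"
  shows "continuous_map W B (\<lambda>w. f w (s w))"
  by (rule uncurry_nsphere[OF _ assms(2)])
    (use assms(1) in \<open>simp add: sphere_loops_def continuous_map_in_subtopology\<close>)

lemma continuous_sphere_loops_image: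
  assumes "continuous_map E B p"
  shows "continuous_map (sphere_loops k E e0) (sphere_loops k B (p e0))
    (\<lambda>g. \<lambda>s \<in> topspace (nsphere k). p (g s))"
proof -
  have "continuous_map (prod_topology (sphere_loops k E e0) (nsphere k)) B (\<lambda>z. p (fst z (snd z)))"
    by (rule continuous_map_comp[OF assms])
      (rule continuous_from_sphere_loops[OF continuous_map_fst continuous_map_snd])
  then have "continuous_map (sphere_loops k E e0) (sphere_loops k B (p e0))
    (\<lambda>g. \<lambda>s \<in> topspace (nsphere k). p (fst (g, s) (snd (g, s))))"
    by (rule continuous_into_sphere_loops) (simp add: sphere_loops_def)
  then show ?thesis by simp
qed

lemma sphere_loops_member:
  "g \<in> topspace (sphere_loops k B b0) \<Longrightarrow> g sphere_base = b0 \<and> g \<in> extensional (topspace (nsphere k))"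
  by (simp add: sphere_loops_def maps_def)

lemma const_in_sphere_loops:
  "b0 \<in> topspace B \<Longrightarrow> (\<lambda>s \<in> topspace (nsphere k). b0) \<in> topspace (sphere_loops k B b0)"
  using restrict_in_maps[of "nsphere k" B "\<lambda>s. b0"] sphere_base_in_nsphere by (simp add: sphere_loops_def)

text \<open>
  A based map from \<open>S\<^sup>d\<close> into the \<open>k\<close>-fold loop space is a map on \<open>S\<^sup>d \<times> S\<^sup>k\<close> that is constant on the wedge,
  hence a based map on \<open>S\<^sup>d\<^sup>+\<^sup>k\<close>; so the new condition in dimension \<open>d\<close> is the old one in dimension \<open>d + k\<close>.
\<close>
lemma onto_homotopy_groups_sphere_loops:
  assumes onto: "onto_homotopy_groups E e0 p B" and p: "continuous_map E B p"
  shows "onto_homotopy_groups (sphere_loops k E e0) (\<lambda>s \<in> topspace (nsphere k). e0)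
    (\<lambda>g. \<lambda>s \<in> topspace (nsphere k). p (g s)) (sphere_loops k B (p e0))"
  unfolding onto_homotopy_groups_def
proof (intro allI impI ballI)
  let ?K = "topspace (nsphere k)"
  let ?c = "\<lambda>s \<in> ?K. p e0"
  let ?\<sigma> = "sphere_smash"
  have c: "(\<lambda>s \<in> ?K. p ((\<lambda>s \<in> ?K. e0) s)) = ?c" by auto
  fix d :: nat and f
  assume d: "1 \<le> d" and "f \<in> based_maps d (sphere_loops k B (p e0)) (\<lambda>s \<in> ?K. p ((\<lambda>s \<in> ?K. e0) s))"
  then have f: "continuous_map (nsphere d) (sphere_loops k B (p e0)) f" and fb: "f sphere_base = ?c"
    unfolding based_maps_def c by auto
  have fx: "f x sphere_base = p e0" "f x \<in> extensional ?K" if "x \<in> topspace (nsphere d)" for x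
    using sphere_loops_member[of "f x" k B "p e0"] f that by (auto simp: continuous_map_def)
  have f': "continuous_map (prod_topology (nsphere d) (nsphere k)) B (\<lambda>z. f (fst z) (snd z))"
    by (rule continuous_from_sphere_loops[OF continuous_map_comp[OF f continuous_map_fst] continuous_map_snd])
  obtain f2 where f2: "continuous_map (nsphere (d + k)) B f2"
    "\<And>z. z \<in> topspace (prod_topology (nsphere d) (nsphere k)) \<Longrightarrow> f2 (?\<sigma> d k z) = f (fst z) (snd z)"
  proof (rule quotient_map_lift_exists[OF sphere_smash_quotient f'])
    fix y z assume y: "y \<in> topspace (prod_topology (nsphere d) (nsphere k))"
      and z: "z \<in> topspace (prod_topology (nsphere d) (nsphere k))" and eq: "?\<sigma> d k y = ?\<sigma> d k z"
    have w: "f (fst z) (snd z) = p e0"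
      if "z \<in> topspace (prod_topology (nsphere d) (nsphere k))" "fst z = sphere_base \<or> snd z = sphere_base" for z
      using that fx fb by auto
    show "f (fst y) (snd y) = f (fst z) (snd z)"
      using sphere_smash_inj[OF y z eq] w[OF y] w[OF z] by auto
  qed (rule that)
  have "f2 sphere_base = p e0"
    using f2(2)[of "(sphere_base, sphere_base)"] by (simp add: sphere_base_in_nsphere sphere_smash_base fx)
  then have "f2 \<in> based_maps (d + k) B (p e0)" using f2(1) by (simp add: based_maps_def)
  moreover have "1 \<le> d + k" using d by simp
  ultimately obtain F2 where F2: "F2 \<in> based_maps (d + k) E e0"
    and "homotopic_with (\<lambda>h. h sphere_base = p e0) (nsphere (d + k)) B (p \<circ> F2) f2"
    using onto unfolding onto_homotopy_groups_def by blast
  then obtain h where h: "continuous_map (prod_topology unit_interval (nsphere (d + k))) B h"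
    "\<And>z. h (0, z) = p (F2 z)" "\<And>z. h (1, z) = f2 z" "\<And>u. 0 \<le> u \<Longrightarrow> u \<le> 1 \<Longrightarrow> h (u, sphere_base) = p e0"
    unfolding homotopic_with_def by auto
  have cF2: "continuous_map (nsphere (d + k)) E F2" "F2 sphere_base = e0"
    using F2 by (simp_all add: based_maps_def)
  let ?F = "\<lambda>x. \<lambda>s \<in> ?K. F2 (?\<sigma> d k (x, s))"
  have F: "continuous_map (nsphere d) (sphere_loops k E e0) ?F"
    by (rule continuous_into_sphere_loops[OF continuous_map_comp[OF cF2(1) continuous_sphere_smash]])
      (simp add: sphere_smash_base cF2)
  have Fb: "?F sphere_base = (\<lambda>s \<in> ?K. e0)" by (simp add: sphere_smash_base cF2)
  let ?k = "\<lambda>z. \<lambda>s \<in> ?K. h (fst z, ?\<sigma> d k (snd z, s))"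
  let ?Z = "prod_topology (prod_topology unit_interval (nsphere d)) (nsphere k)"
  have "continuous_map ?Z B (\<lambda>z. h (fst (fst z), ?\<sigma> d k (snd (fst z), snd z)))"
    by (intro continuous_map_comp[OF h(1)] continuous_map_pairedI continuous_map_comp[OF continuous_sphere_smash]
        cmap_intros)
  then have "continuous_map (prod_topology unit_interval (nsphere d)) (sphere_loops k B (p e0))
      (\<lambda>w. \<lambda>s \<in> ?K. h (fst (fst (w, s)), ?\<sigma> d k (snd (fst (w, s)), snd (w, s))))"
    by (rule continuous_into_sphere_loops) (auto simp: sphere_smash_base h)
  then have k: "continuous_map (prod_topology unit_interval (nsphere d)) (sphere_loops k B (p e0)) ?k"
    by simp
  have "homotopic_with (\<lambda>h. h sphere_base = ?c) (nsphere d) (sphere_loops k B (p e0))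
     ((\<lambda>g. \<lambda>s \<in> ?K. p (g s)) \<circ> ?F) f"
  proof (rule homotopic_withI[OF k])
    show "?k (0, x) = ((\<lambda>g. \<lambda>s \<in> ?K. p (g s)) \<circ> ?F) x" for x
      by (auto simp: h restrict_def fun_eq_iff)
    show "?k (1, x) = f x" if x: "x \<in> topspace (nsphere d)" for x
    proof (rule extensionalityI[where A = ?K])
      show "?k (1, x) s = f x s" if "s \<in> ?K" for s
        using f2(2)[of "(x, s)"] x that by (simp add: h)
    qed (use fx x in auto)
    show "?k (u, sphere_base) = ?c" if "0 \<le> u" "u \<le> 1" for u
      using that by (auto simp: sphere_smash_base h restrict_def fun_eq_iff)
    show "(h1 sphere_base = ?c) = (h2 sphere_base = ?c)"
      if "\<And>x. x \<in> topspace (nsphere d) \<Longrightarrow> h1 x = h2 x" for h1 h2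
      using that[OF sphere_base_in_nsphere] by simp
  qed
  then show "\<exists>F\<in>based_maps d (sphere_loops k E e0) (\<lambda>s \<in> ?K. e0).
     homotopic_with (\<lambda>h. h sphere_base = (\<lambda>s \<in> ?K. p ((\<lambda>s \<in> ?K. e0) s))) (nsphere d)
       (sphere_loops k B (p e0)) ((\<lambda>g. \<lambda>s \<in> ?K. p (g s)) \<circ> F) f"
    unfolding c by (intro bexI[of _ ?F]) (use F Fb in \<open>simp_all add: based_maps_def\<close>)
qed

section \<open>Lifting families of spheres through suspension\<close>

text \<open>
  The quotient map from \<open>S\<^sup>k \<times> I\<close> onto the reduced suspension \<open>S\<^sup>k\<^sup>+\<^sup>1\<close> of \<open>S\<^sup>k\<close>.
\<close>
definition suspend_sphere :: "nat \<Rightarrow> (nat \<Rightarrow> real) \<times> real \<Rightarrow> nat \<Rightarrow> real" where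
  "suspend_sphere k z = sphere_smash k 1 (fst z, circle_path (snd z))"

lemma suspend_sphere_quotient:
  "quotient_map (prod_topology (nsphere k) unit_interval) (nsphere (Suc k)) (suspend_sphere k)"
proof -
  have "quotient_map (prod_topology (nsphere k) unit_interval) (prod_topology (nsphere k) (nsphere 1))
      (\<lambda>(x, y). (x, circle_path y))"
    by (rule quotient_map_prod_right) (simp_all add: nsphere_locally_compact nsphere_Hausdorff circle_path_quotient[simplified])
  then have "quotient_map (prod_topology (nsphere k) unit_interval) (nsphere (k + 1))
    (sphere_smash k 1 \<circ> (\<lambda>(x, y). (x, circle_path y)))"
    using sphere_smash_quotient by (rule quotient_map_compose)
  then show ?thesis
    by (simp add: suspend_sphere_def[abs_def] o_def case_prod_unfold)
qed

lemma suspend_sphere_base: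
  "suspend_sphere k (sphere_base, t) = sphere_base"
  "suspend_sphere k (s, 0) = sphere_base" "suspend_sphere k (s, 1) = sphere_base"
  by (simp_all add: suspend_sphere_def sphere_smash_base)

lemma circle_path_base:
  assumes "0 \<le> t" "t \<le> 1" "circle_path t = sphere_base"
  shows "t \<in> {0, 1}"
  using circle_path_inj[OF assms(1,2), of 0] assms(3) by auto

lemma suspend_sphere_inj:
  assumes y: "y \<in> topspace (prod_topology (nsphere k) unit_interval)"
    and z: "z \<in> topspace (prod_topology (nsphere k) unit_interval)"
    and eq: "suspend_sphere k y = suspend_sphere k z"
  shows "y = z \<or> (fst y = sphere_base \<or> snd y \<in> {0, 1}) \<and> (fst z = sphere_base \<or> snd z \<in> {0, 1})"
proof -
  let ?c = "\<lambda>y. (fst y, circle_path (snd y))"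
  have c: "?c w \<in> topspace (prod_topology (nsphere k) (nsphere 1))"
    if "w \<in> topspace (prod_topology (nsphere k) unit_interval)" for w
    using that circle_path_surj by auto
  have b: "snd w \<in> {0, 1}"
    if "w \<in> topspace (prod_topology (nsphere k) unit_interval)" "circle_path (snd w) = sphere_base" for w
    using circle_path_base[of "snd w"] that by auto
  have "?c y = ?c z \<or> (fst y = sphere_base \<or> circle_path (snd y) = sphere_base) \<and>
      (fst z = sphere_base \<or> circle_path (snd z) = sphere_base)"
    using sphere_smash_inj[OF c[OF y] c[OF z]] eq by (simp add: suspend_sphere_def)
  moreover have "y = z \<or> snd y \<in> {0, 1} \<and> snd z \<in> {0, 1}" if "?c y = ?c z"
    using circle_path_inj[of "snd y" "snd z"] that y z by (auto simp: prod_eq_iff)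
  ultimately show ?thesis using b[OF y] b[OF z] by blast
qed

text \<open>
  The product of a quotient map with a locally compact Hausdorff space is a quotient map.
\<close>
lemma factor_through_suspend_sphere:
  assumes T: "locally_compact_space T" "Hausdorff_space T"
    and f: "continuous_map (prod_topology (prod_topology (nsphere k) unit_interval) T) Z f"
    and base: "\<And>s t y. s \<in> topspace (nsphere k) \<Longrightarrow> 0 \<le> t \<Longrightarrow> t \<le> 1 \<Longrightarrow> y \<in> topspace T \<Longrightarrow>
      s = sphere_base \<or> t \<in> {0, 1} \<Longrightarrow> f ((s, t), y) = z0"
  obtains g where "continuous_map (prod_topology (nsphere (Suc k)) T) Z g"
    "\<And>s t y. s \<in> topspace (nsphere k) \<Longrightarrow> 0 \<le> t \<Longrightarrow> t \<le> 1 \<Longrightarrow> y \<in> topspace T \<Longrightarrow>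
      g (suspend_sphere k (s, t), y) = f ((s, t), y)"
proof -
  let ?SI = "prod_topology (nsphere k) unit_interval"
  have q: "quotient_map (prod_topology ?SI T) (prod_topology (nsphere (Suc k)) T)
      (\<lambda>(x, y). (suspend_sphere k x, y))"
    by (rule quotient_map_prod_left[OF T(1) _ suspend_sphere_quotient]) (simp add: T)
  obtain g where g: "continuous_map (prod_topology (nsphere (Suc k)) T) Z g"
    "\<And>w. w \<in> topspace (prod_topology ?SI T) \<Longrightarrow> g ((\<lambda>(x, y). (suspend_sphere k x, y)) w) = f w"
  proof (rule quotient_map_lift_exists[OF q f])
    fix v w assume v: "v \<in> topspace (prod_topology ?SI T)" and w: "w \<in> topspace (prod_topology ?SI T)"
      and eq: "(\<lambda>(x, y). (suspend_sphere k x, y)) v = (\<lambda>(x, y). (suspend_sphere k x, y)) w"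
    have b: "f v = z0"
      if "v \<in> topspace (prod_topology ?SI T)" "fst (fst v) = sphere_base \<or> snd (fst v) \<in> {0, 1}" for v
      using base[of "fst (fst v)" "snd (fst v)" "snd v"] that by auto
    have "suspend_sphere k (fst v) = suspend_sphere k (fst w)" "snd v = snd w"
      using eq by (simp_all add: case_prod_unfold)
    then show "f v = f w"
      using suspend_sphere_inj[of "fst v" k "fst w"] v w b[OF v] b[OF w] by (auto simp: prod_eq_iff)
  qed (rule that)
  show ?thesis
    by (rule that[OF g(1)]) (use g(2) in fastforce)
qed

text \<open>
  Under the suspension map \<open>S\<^sup>k \<times> I \<rightarrow> S\<^sup>n\<close> the given map becomes a family of loops in the \<open>k\<close>-fold loop space
  of \<open>B\<close>.  The lift of this family and the homotopy are constant where the suspension map collapses, so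
  they descend to \<open>S\<^sup>n\<close>.
\<close>
theorem lift_sphere_family:
  fixes X :: "'x topology" and I :: "'i set"
  assumes onto: "onto_homotopy_groups E e0 p B" and p: "continuous_map E B p" and e0: "e0 \<in> topspace E"
    and X: "locally_compact_space X" "Hausdorff_space X" "well_pointed X x0"
    and susp: "reduced_suspension X x0 homotopy_equivalent_space wedge_of_spheres I d"
    and n: "n \<ge> 1"
    and \<alpha>: "continuous_map (prod_topology (nsphere n) X) B \<alpha>"
    and \<alpha>b: "\<And>x. x \<in> topspace X \<Longrightarrow> \<alpha> (sphere_base, x) = p e0"
  obtains A h where "continuous_map (prod_topology (nsphere n) X) E A"
    "\<And>x. x \<in> topspace X \<Longrightarrow> A (sphere_base, x) = e0"
    "continuous_map (prod_topology unit_interval (prod_topology (nsphere n) X)) B h"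
    "\<And>s x. s \<in> topspace (nsphere n) \<Longrightarrow> x \<in> topspace X \<Longrightarrow> h (0, (s, x)) = p (A (s, x))"
    "\<And>s x. s \<in> topspace (nsphere n) \<Longrightarrow> x \<in> topspace X \<Longrightarrow> h (1, (s, x)) = \<alpha> (s, x)"
    "\<And>u x. 0 \<le> u \<Longrightarrow> u \<le> 1 \<Longrightarrow> x \<in> topspace X \<Longrightarrow> h (u, (sphere_base, x)) = p e0"
proof -
  obtain k where k: "n = Suc k" using n by (cases n) auto
  let ?K = "topspace (nsphere k)"
  let ?L = "sphere_loops k"
  let ?p = "\<lambda>g. \<lambda>s \<in> ?K. p (g s)"
  let ?e = "\<lambda>s \<in> ?K. e0"
  let ?XI = "prod_topology X unit_interval"
  let ?SI = "prod_topology (nsphere k) unit_interval"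
  let ?q = "suspend_sphere k"
  have q: "continuous_map ?SI (nsphere n) ?q"
    using quotient_imp_continuous_map[OF suspend_sphere_quotient] k by simp
  let ?a = "\<lambda>z. \<lambda>s \<in> ?K. \<alpha> (?q (s, snd z), fst z)"
  have pe: "?p ?e = (\<lambda>s \<in> ?K. p e0)" by auto
  have "continuous_map (prod_topology ?XI (nsphere k)) B (\<lambda>w. \<alpha> (?q (snd w, snd (fst w)), fst (fst w)))"
    by (intro continuous_map_comp[OF \<alpha>] continuous_map_pairedI continuous_map_comp[OF q] cmap_intros)
  then have "continuous_map ?XI (?L B (p e0))
      (\<lambda>z. \<lambda>s \<in> ?K. \<alpha> (?q (snd (z, s), snd (fst (z, s))), fst (fst (z, s))))"
    by (rule continuous_into_sphere_loops) (auto simp: suspend_sphere_base \<alpha>b)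
  then have a: "continuous_map ?XI (?L B (p e0)) ?a" by simp
  have aends: "?a (x, 0) = ?p ?e \<and> ?a (x, 1) = ?p ?e" if "x \<in> topspace X" for x
    using that by (auto simp: pe suspend_sphere_base \<alpha>b)
  have onto': "onto_homotopy_groups (?L E e0) ?e ?p (?L B (p e0))"
    by (rule onto_homotopy_groups_sphere_loops[OF onto p])
  have p': "continuous_map (?L E e0) (?L B (p e0)) ?p" by (rule continuous_sphere_loops_image[OF p])
  have e': "?e \<in> topspace (?L E e0)" by (rule const_in_sphere_loops[OF e0])
  obtain A' where A': "continuous_map ?XI (?L E e0) A'"
    "\<And>x. x \<in> topspace X \<Longrightarrow> A' (x, 0) = ?e \<and> A' (x, 1) = ?e"
    and "homotopic_rel_ends X (?L B (p e0)) (?p \<circ> A') ?a"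
  proof (rule lift_family_of_loops[OF onto' p' e' X(2,3) susp a])
    fix x assume "x \<in> topspace X"
    then show "?a (x, 0) = ?p ?e \<and> ?a (x, 1) = ?p ?e" by (rule aends)
  qed (rule that)
  then obtain h' where h': "continuous_map (prod_topology unit_interval ?XI) (?L B (p e0)) h'"
    "\<And>z. h' (0, z) = ?p (A' z)" "\<And>z. h' (1, z) = ?a z"
    "\<And>x u. x \<in> topspace X \<Longrightarrow> 0 \<le> u \<Longrightarrow> u \<le> 1 \<Longrightarrow> h' (u, (x, 0)) = ?p (A' (x, 0))"
    "\<And>x u. x \<in> topspace X \<Longrightarrow> 0 \<le> u \<Longrightarrow> u \<le> 1 \<Longrightarrow> h' (u, (x, 1)) = ?p (A' (x, 1))"
    by (elim homotopic_rel_endsE) (simp add: that)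
  have A'b: "A' (x, t) sphere_base = e0" if "x \<in> topspace X" "0 \<le> t" "t \<le> 1" for x t
    using sphere_loops_member[OF continuous_map_mem[OF A'(1)], of "(x, t)"] that by simp
  have h'b: "h' (u, (x, t)) sphere_base = p e0" if "x \<in> topspace X" "0 \<le> t" "t \<le> 1" "0 \<le> u" "u \<le> 1" for x t u
    using sphere_loops_member[OF continuous_map_mem[OF h'(1)], of "(u, (x, t))"] that by simp

  have "continuous_map (prod_topology ?SI X) E (\<lambda>w. A' (snd w, snd (fst w)) (fst (fst w)))"
    by (rule continuous_from_sphere_loops[OF continuous_map_comp[OF A'(1)]]) (intro cmap_intros)+
  then obtain A where A: "continuous_map (prod_topology (nsphere (Suc k)) X) E A"
    "\<And>s t y. s \<in> ?K \<Longrightarrow> 0 \<le> t \<Longrightarrow> t \<le> 1 \<Longrightarrow> y \<in> topspace X \<Longrightarrow>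
      A (?q (s, t), y) = (\<lambda>w. A' (snd w, snd (fst w)) (fst (fst w))) ((s, t), y)"
  proof (rule factor_through_suspend_sphere[OF X(1,2), where ?z0.0 = e0])
    fix s y and t :: real assume "s \<in> ?K" "0 \<le> t" "t \<le> 1" "y \<in> topspace X" "s = sphere_base \<or> t \<in> {0, 1}"
    then show "(\<lambda>w. A' (snd w, snd (fst w)) (fst (fst w))) ((s, t), y) = e0"
      using A'b A'(2) by auto
  qed (rule that)
  let ?IX = "prod_topology unit_interval X"
  have IX: "locally_compact_space ?IX" "Hausdorff_space ?IX"
    using X unit_interval_locally_compact unit_interval_Hausdorff
    by (simp_all add: locally_compact_space_prod_topology Hausdorff_space_prod_topology)
  have "continuous_map (prod_topology ?SI ?IX) B
      (\<lambda>w. h' (fst (snd w), (snd (snd w), snd (fst w))) (fst (fst w)))"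
    by (rule continuous_from_sphere_loops[OF continuous_map_comp[OF h'(1)]])
      (intro cmap_intros continuous_map_fst_comp[OF continuous_map_snd_comp] continuous_map_snd_comp[OF continuous_map_snd_comp])+
  then obtain g where g: "continuous_map (prod_topology (nsphere (Suc k)) ?IX) B g"
    "\<And>s t y. s \<in> ?K \<Longrightarrow> 0 \<le> t \<Longrightarrow> t \<le> 1 \<Longrightarrow> y \<in> topspace ?IX \<Longrightarrow>
      g (?q (s, t), y) = (\<lambda>w. h' (fst (snd w), (snd (snd w), snd (fst w))) (fst (fst w))) ((s, t), y)"
  proof (rule factor_through_suspend_sphere[OF IX, where ?z0.0 = "p e0"])
    fix s y and t :: real assume "s \<in> ?K" "0 \<le> t" "t \<le> 1" "y \<in> topspace ?IX" "s = sphere_base \<or> t \<in> {0, 1}"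
    then show "(\<lambda>w. h' (fst (snd w), (snd (snd w), snd (fst w))) (fst (fst w))) ((s, t), y) = p e0"
      using h'b h'(4,5) A'(2) by auto
  qed (rule that)
  have surj: "\<exists>s' t. s' \<in> ?K \<and> 0 \<le> t \<and> t \<le> 1 \<and> s = ?q (s', t)" if "s \<in> topspace (nsphere n)" for s
  proof -
    have "s \<in> ?q ` topspace ?SI"
      using that k quotient_imp_surjective_map[OF suspend_sphere_quotient, of k] by simp
    then obtain z where "z \<in> topspace ?SI" "s = ?q z" by blast
    then show ?thesis by (intro exI[of _ "fst z"] exI[of _ "snd z"]) auto
  qed
  show ?thesis
  proof (rule that)
    show "continuous_map (prod_topology (nsphere n) X) E A" using A(1) k by simp
    show "A (sphere_base, x) = e0" if "x \<in> topspace X" for x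
      using A(2)[of sphere_base 0 x] A'b[OF that, of 0] that
      by (simp add: suspend_sphere_base sphere_base_in_nsphere)
    show "continuous_map (prod_topology unit_interval (prod_topology (nsphere n) X)) B
        (\<lambda>w. g (fst (snd w), (fst w, snd (snd w))))"
      unfolding k by (intro continuous_map_comp[OF g(1)] cmap_intros)
    show "(\<lambda>w. g (fst (snd w), (fst w, snd (snd w)))) (0, (s, x)) = p (A (s, x))"
      if s: "s \<in> topspace (nsphere n)" and x: "x \<in> topspace X" for s x
    proof -
      obtain s' t where "s' \<in> ?K" "0 \<le> t" "t \<le> 1" "s = ?q (s', t)" using surj[OF s] by blast
      then show ?thesis using g(2)[of s' t "(0, x)"] A(2)[of s' t x] x by (simp add: h')
    qed
    show "(\<lambda>w. g (fst (snd w), (fst w, snd (snd w)))) (1, (s, x)) = \<alpha> (s, x)"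
      if s: "s \<in> topspace (nsphere n)" and x: "x \<in> topspace X" for s x
    proof -
      obtain s' t where "s' \<in> ?K" "0 \<le> t" "t \<le> 1" "s = ?q (s', t)" using surj[OF s] by blast
      then show ?thesis using g(2)[of s' t "(1, x)"] x by (simp add: h')
    qed
    show "(\<lambda>w. g (fst (snd w), (fst w, snd (snd w)))) (u, (sphere_base, x)) = p e0"
      if "0 \<le> u" "u \<le> 1" "x \<in> topspace X" for u x
      using g(2)[of sphere_base 0 "(u, x)"] h'b[of x 0 u] that
      by (simp add: suspend_sphere_base sphere_base_in_nsphere)
  qed
qed

section \<open>Path components of mapping spaces\<close>

text \<open>
  To see that a map lands in a path component it suffices to look at one point of each path component
  of the source.
\<close>
lemma continuous_map_into_path_component:
  assumes f: "continuous_map W N f"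
    and comp: "\<And>w. w \<in> topspace W \<Longrightarrow>
      \<exists>w0. path_component_of W w0 w \<and> f w0 \<in> topspace (subtopology N (path_component_of_set N m))"
  shows "continuous_map W (subtopology N (path_component_of_set N m)) f"
proof (rule continuous_map_into_subtopology[OF f], rule Pi_I)
  fix w assume "w \<in> topspace W"
  then obtain w0 where w0: "path_component_of W w0 w" "path_component_of N m (f w0)"
    using comp by fastforce
  show "f w \<in> path_component_of_set N m"
    using path_component_of_trans[OF w0(2) path_component_of_continuous_image[OF f w0(1)]] by simp
qed

lemma base_in_path_component:
  "m \<in> topspace N \<Longrightarrow> m \<in> topspace (subtopology N (path_component_of_set N m))"
  by (simp add: path_component_of_refl)

lemma null_map_in_null_component:
  "y0 \<in> topspace Y \<Longrightarrow> null_map X y0 \<in> topspace (null_component X Y y0)"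
  unfolding null_component_def null_map_def
  by (rule base_in_path_component) (simp add: restrict_in_maps)

lemma null_component_member:
  "m \<in> topspace (null_component X Y y0) \<Longrightarrow> m \<in> maps X Y"
  by (simp add: null_component_def)

lemma continuous_from_null_component:
  assumes X: "locally_compact_space X" "Hausdorff_space X"
    and "continuous_map W (null_component X Y y0) m" "continuous_map W X b"
  shows "continuous_map W Y (\<lambda>w. m w (b w))"
  by (rule continuous_map_uncurry[OF X _ assms(4)])
    (use assms(3) in \<open>simp add: null_component_def continuous_map_in_subtopology\<close>)

lemma path_component_of_slice:
  assumes "n \<ge> 1" "s \<in> topspace (nsphere n)" "w \<in> topspace W"
  shows "path_component_of (prod_topology W (nsphere n)) (w, sphere_base) (w, s)"
proof -
  have "path_component_of (nsphere n) sphere_base s"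
    using assms(2) nsphere_path_connected[OF assms(1)] sphere_base_in_nsphere
    by (simp add: path_connected_space_iff_path_component)
  moreover have "continuous_map (nsphere n) (prod_topology W (nsphere n)) (\<lambda>s. (w, s))"
    using assms(3) by (intro continuous_map_pairedI continuous_map_id') simp
  ultimately show ?thesis using path_component_of_continuous_image by fastforce
qed

section \<open>T-spaces\<close>

text \<open>
  The functions \<open>loop_at\<close> and \<open>loop_of_loops\<close> exchange the two arguments of a loop of maps.  They are
  inverse to each other, which is the bijection between loops of maps and families of loops.
\<close>
definition loop_at :: "((nat \<Rightarrow> real) \<Rightarrow> 'a \<Rightarrow> 'b) \<Rightarrow> 'a \<Rightarrow> (nat \<Rightarrow> real) \<Rightarrow> 'b" where
  "loop_at \<gamma> x = (\<lambda>s \<in> topspace (nsphere 1). \<gamma> s x)"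

lemma continuous_loop_at:
  assumes X: "locally_compact_space X" "Hausdorff_space X"
    and a: "continuous_map W (free_loop_space (null_component X Y y0)) a" and b: "continuous_map W X b"
  shows "continuous_map W (free_loop_space Y) (\<lambda>w. loop_at (a w) (b w))"
proof -
  have "continuous_map (prod_topology W (nsphere 1)) (null_component X Y y0) (\<lambda>z. a (fst z) (snd z))"
    by (rule uncurry_nsphere[OF continuous_map_comp[OF a[unfolded free_loop_space_def] continuous_map_fst]
        continuous_map_snd])
  then have "continuous_map (prod_topology W (nsphere 1)) Y (\<lambda>z. a (fst z) (snd z) (b (fst z)))"
    by (rule continuous_from_null_component[OF X]) (rule continuous_map_comp[OF b continuous_map_fst])
  then have "continuous_map W (mapping_space (nsphere 1) Y)
      (\<lambda>w. \<lambda>s \<in> topspace (nsphere 1). a (fst (w, s)) (snd (w, s)) (b (fst (w, s))))"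
    by (rule continuous_map_curry)
  then show ?thesis by (simp add: free_loop_space_def loop_at_def)
qed

definition loop_of_loops ::
  "'a topology \<Rightarrow> ('a \<Rightarrow> (nat \<Rightarrow> real) \<Rightarrow> 'b) \<Rightarrow> (nat \<Rightarrow> real) \<Rightarrow> 'a \<Rightarrow> 'b" where
  "loop_of_loops X q = (\<lambda>s \<in> topspace (nsphere 1). \<lambda>x \<in> topspace X. q x s)"

text \<open>
  Only the base points of the loops have to form a map in the null component: the path from the base
  point of the circle to \<open>s\<close> keeps the rest of the loop in the same path component.
\<close>
lemma continuous_loop_of_loops:
  assumes Q: "continuous_map (prod_topology W X) (free_loop_space Y) (\<lambda>z. Q (fst z) (snd z))"
    and base: "\<And>w. w \<in> topspace W \<Longrightarrow> (\<lambda>x \<in> topspace X. Q w x sphere_base) \<in> topspace (null_component X Y y0)"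
  shows "continuous_map W (free_loop_space (null_component X Y y0)) (\<lambda>w. loop_of_loops X (Q w))"
proof -
  let ?N = "mapping_space X Y"
  let ?S = "nsphere 1"
  let ?f = "\<lambda>z. \<lambda>x \<in> topspace X. Q (fst z) x (snd z)"
  have Q': "continuous_map (prod_topology (prod_topology W ?S) X) (mapping_space ?S Y)
      (\<lambda>z. Q (fst (fst z)) (snd z))"
    using continuous_map_comp[OF Q[unfolded free_loop_space_def],
        of "prod_topology (prod_topology W ?S) X" "\<lambda>z. (fst (fst z), snd z)"]
    by (simp add: cmap_intros)
  have "continuous_map (prod_topology (prod_topology W ?S) X) Y (\<lambda>z. Q (fst (fst z)) (snd z) (snd (fst z)))"
    by (rule uncurry_nsphere[OF Q']) (intro cmap_intros)
  then have "continuous_map (prod_topology W ?S) ?N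
      (\<lambda>w. \<lambda>x \<in> topspace X. Q (fst (fst (w, x))) (snd (w, x)) (snd (fst (w, x))))"
    by (rule continuous_map_curry)
  then have f: "continuous_map (prod_topology W ?S) ?N ?f" by simp
  have "continuous_map (prod_topology W ?S) (null_component X Y y0) ?f"
    unfolding null_component_def
  proof (rule continuous_map_into_path_component[OF f])
    fix z assume z: "z \<in> topspace (prod_topology W ?S)"
    have "path_component_of (prod_topology W ?S) (fst z, sphere_base) z"
      using path_component_of_slice[of 1 "snd z" "fst z" W] z by auto
    moreover have "?f (fst z, sphere_base) \<in> topspace (null_component X Y y0)"
      using base[of "fst z"] z by auto
    ultimately show "\<exists>w0. path_component_of (prod_topology W ?S) w0 z \<and>
      ?f w0 \<in> topspace (subtopology ?N (path_component_of_set ?N (null_map X y0)))"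
      unfolding null_component_def by blast
  qed
  then have "continuous_map W (mapping_space ?S (null_component X Y y0))
      (\<lambda>w. \<lambda>s \<in> topspace ?S. \<lambda>x \<in> topspace X. Q (fst (w, s)) x (snd (w, s)))"
    by (rule continuous_map_curry)
  then show ?thesis by (simp add: free_loop_space_def loop_of_loops_def)
qed

lemma loop_at_loop_of_loops:
  assumes "x \<in> topspace X" "q x \<in> topspace (free_loop_space Y)"
  shows "loop_at (loop_of_loops X q) x = q x"
proof (rule extensionalityI[where A = "topspace (nsphere 1)"])
  show "q x \<in> extensional (topspace (nsphere 1))"
    using assms(2) by (simp add: free_loop_space_def maps_def)
qed (use assms(1) in \<open>auto simp: loop_at_def loop_of_loops_def\<close>)

lemma loop_of_loops_loop_at:
  assumes "\<gamma> \<in> topspace (free_loop_space (null_component X Y y0))"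
  shows "loop_of_loops X (loop_at \<gamma>) = \<gamma>"
proof (rule extensionalityI[where A = "topspace (nsphere 1)"])
  have \<gamma>: "\<gamma> \<in> maps (nsphere 1) (null_component X Y y0)"
    using assms by (simp add: free_loop_space_def)
  then show "\<gamma> \<in> extensional (topspace (nsphere 1))" by (rule mapsD)
  fix s assume s: "s \<in> topspace (nsphere 1)"
  have "\<gamma> s \<in> maps X Y"
    by (rule null_component_member[OF continuous_map_mem[OF mapsD(1)[OF \<gamma>] s]])
  then have "\<gamma> s \<in> extensional (topspace X)" by (rule mapsD)
  then show "loop_of_loops X (loop_at \<gamma>) s = \<gamma> s"
    using s by (simp add: loop_of_loops_def loop_at_def extensional_restrict)
qed (simp add: loop_of_loops_def)

lemma loop_of_loops_cong:
  "(\<And>x. x \<in> topspace X \<Longrightarrow> q x = r x) \<Longrightarrow> loop_of_loops X q = loop_of_loops X r"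
  by (auto simp: loop_of_loops_def restrict_def fun_eq_iff)

lemma loop_of_loops_base: "loop_of_loops X q sphere_base = (\<lambda>x \<in> topspace X. q x sphere_base)"
  by (simp add: loop_of_loops_def sphere_base_in_nsphere)

lemma loop_at_base: "loop_at \<gamma> x sphere_base = \<gamma> sphere_base x"
  by (simp add: loop_at_def sphere_base_in_nsphere)

text \<open>
  The fibre homotopy equivalences \<open>f\<close>, \<open>g\<close> for \<open>Y\<close> and the homotopies \<open>h\<close>, \<open>k\<close> are applied to each member
  of a family of loops.  Since they preserve base points of loops, the resulting maps are again over
  the null component; a member of a family over the null map is a loop at \<open>y0\<close>, so the fibres correspond
  too.
\<close>
theorem T_space_null_component:
  assumes X: "locally_compact_space X" "Hausdorff_space X"
    and y0: "y0 \<in> topspace Y" and T: "T_space Y y0"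
  shows "T_space (null_component X Y y0) (null_map X y0)"
proof -
  let ?M = "null_component X Y y0"
  let ?m = "null_map X y0"
  let ?LM = "free_loop_space ?M"
  let ?LY = "free_loop_space Y"
  let ?\<Omega>Y = "subtopology ?LY {e \<in> topspace ?LY. e sphere_base = y0}"
  let ?\<Omega>M = "subtopology ?LM {e \<in> topspace ?LM. e sphere_base = ?m}"
  let ?PY = "prod_topology Y ?\<Omega>Y"
  let ?PM = "prod_topology ?M ?\<Omega>M"
  obtain f g where f: "continuous_map ?LY ?PY f" "\<forall>e \<in> topspace ?LY. fst (f e) = e sphere_base"
    and g: "continuous_map ?PY ?LY g" "\<forall>e \<in> topspace ?PY. g e sphere_base = fst e"
    and "homotopic_with (\<lambda>h. \<forall>e \<in> topspace ?LY. h e sphere_base = e sphere_base) ?LY ?LY (g \<circ> f) id"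
    and "homotopic_with (\<lambda>h. \<forall>e \<in> topspace ?PY. fst (h e) = fst e) ?PY ?PY (f \<circ> g) id"
    using T unfolding T_space_def fibre_homotopically_trivial_def fibre_homotopy_equivalent_def by blast
  then obtain h k where h: "continuous_map (prod_topology unit_interval ?LY) ?LY h"
      "\<And>e. h (0, e) = g (f e)" "\<And>e. h (1, e) = e"
      "\<And>u e. 0 \<le> u \<Longrightarrow> u \<le> 1 \<Longrightarrow> e \<in> topspace ?LY \<Longrightarrow> h (u, e) sphere_base = e sphere_base"
    and k: "continuous_map (prod_topology unit_interval ?PY) ?PY k"
      "\<And>e. k (0, e) = f (g e)" "\<And>e. k (1, e) = e"
      "\<And>u e. 0 \<le> u \<Longrightarrow> u \<le> 1 \<Longrightarrow> e \<in> topspace ?PY \<Longrightarrow> fst (k (u, e)) = fst e"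
    unfolding homotopic_with_def by (auto simp: o_def)
  have m: "?m \<in> topspace ?M" by (rule null_map_in_null_component[OF y0])
  have \<Omega>L: "continuous_map Z ?LY e" if "continuous_map Z ?\<Omega>Y e" for Z :: "'c topology" and e
    using that by (simp add: continuous_map_in_subtopology)
  have \<Omega>Y: "e \<in> topspace ?LY" "e sphere_base = y0" if "e \<in> topspace ?\<Omega>Y" for e
    using that by auto
  have LMmem: "loop_at \<gamma> x \<in> topspace ?LY" if "\<gamma> \<in> topspace ?LM" "x \<in> topspace X" for \<gamma> x
    using continuous_map_mem[OF continuous_loop_at[OF X continuous_map_fst continuous_map_snd], of "(\<gamma>, x)"] that
    by simp
  have ev: "\<gamma> sphere_base \<in> topspace ?M" if "\<gamma> \<in> topspace ?LM" for \<gamma>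
    using that continuous_map_mem[OF mapsD(1) sphere_base_in_nsphere, of \<gamma> 1 ?M] by (simp add: free_loop_space_def)
  have Mext: "(\<lambda>x \<in> topspace X. \<mu> x) = \<mu>" if "\<mu> \<in> topspace ?M" for \<mu>
    using mapsD(2)[OF null_component_member[OF that]] by (simp add: extensional_restrict)
  have Mval: "\<mu> x \<in> topspace Y" if "\<mu> \<in> topspace ?M" "x \<in> topspace X" for \<mu> x
    using continuous_map_mem[OF mapsD(1)[OF null_component_member[OF that(1)]] that(2)] .
  have mnull: "(\<lambda>x \<in> topspace X. y0) = ?m" by (simp add: null_map_def)

  define f' where "f' = (\<lambda>\<gamma>. (\<gamma> sphere_base, loop_of_loops X (\<lambda>x. snd (f (loop_at \<gamma> x)))))"
  define g' where "g' = (\<lambda>z. loop_of_loops X (\<lambda>x. g (fst z x, loop_at (snd z) x)))"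

  \<comment> \<open>Families of based loops in \<open>Y\<close> are based loops in the mapping space; conversely a point of \<open>X\<close>
      turns a point of the trivial fibration over the mapping space into one over \<open>Y\<close>.\<close>
  have into\<Omega>: "continuous_map W ?\<Omega>M (\<lambda>w. loop_of_loops X (\<lambda>x. snd (Q w x)))"
    if Q: "continuous_map (prod_topology W X) ?PY (\<lambda>z. Q (fst z) (snd z))" for W :: "'c topology" and Q
  proof (rule continuous_map_into_subtopology)
    have sQ: "continuous_map (prod_topology W X) ?\<Omega>Y (\<lambda>z. snd (Q (fst z) (snd z)))"
      by (rule continuous_map_snd_comp[OF Q])
    have base: "(\<lambda>x \<in> topspace X. snd (Q w x) sphere_base) = ?m" if "w \<in> topspace W" for w
      unfolding null_map_def
      by (rule restrict_ext) (use \<Omega>Y(2)[OF continuous_map_mem[OF sQ]] that in force)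
    show c: "continuous_map W ?LM (\<lambda>w. loop_of_loops X (\<lambda>x. snd (Q w x)))"
      by (rule continuous_loop_of_loops)
        (use sQ base m in \<open>auto simp: continuous_map_in_subtopology\<close>)
    show "(\<lambda>w. loop_of_loops X (\<lambda>x. snd (Q w x))) \<in> topspace W \<rightarrow> {e \<in> topspace ?LM. e sphere_base = ?m}"
      using continuous_map_mem[OF c] base by (auto simp: loop_of_loops_base)
  qed
  have pair: "continuous_map W ?PY (\<lambda>w. (\<mu> w (b w), loop_at (\<omega> w) (b w)))"
    if \<mu>: "continuous_map W ?M \<mu>" and \<omega>: "continuous_map W ?\<Omega>M \<omega>" and b: "continuous_map W X b"
    for W :: "'d topology" and \<mu> \<omega> b
  proof (intro continuous_map_pairedI continuous_map_into_subtopology)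
    show "continuous_map W Y (\<lambda>w. \<mu> w (b w))" by (rule continuous_from_null_component[OF X \<mu> b])
    show c: "continuous_map W ?LY (\<lambda>w. loop_at (\<omega> w) (b w))"
      by (rule continuous_loop_at[OF X _ b, where ?y0.0 = y0]) (use \<omega> in \<open>simp add: continuous_map_in_subtopology\<close>)
    have "loop_at (\<omega> w) (b w) sphere_base = y0" if "w \<in> topspace W" for w
      using continuous_map_mem[OF \<omega> that] continuous_map_mem[OF b that]
      by (simp add: loop_at_base null_map_def)
    then show "(\<lambda>w. loop_at (\<omega> w) (b w)) \<in> topspace W \<rightarrow> {e \<in> topspace ?LY. e sphere_base = y0}"
      using continuous_map_mem[OF c] by auto
  qed

  have f': "continuous_map ?LM ?PM f'"
    unfolding f'_def
  proof (intro continuous_map_pairedI into\<Omega>)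
    show "continuous_map ?LM ?M (\<lambda>\<gamma>. \<gamma> sphere_base)"
      unfolding free_loop_space_def
      by (rule uncurry_nsphere[OF continuous_map_id']) (simp add: sphere_base_in_nsphere)
    show "continuous_map (prod_topology ?LM X) ?PY (\<lambda>z. f (loop_at (fst z) (snd z)))"
      by (rule continuous_map_comp[OF f(1)], rule continuous_loop_at[OF X, where ?y0.0 = y0]) (intro cmap_intros)+
  qed
  have f'b: "fst (f' \<gamma>) = \<gamma> sphere_base" for \<gamma> by (simp add: f'_def)
  have gb: "g (\<mu> x, loop_at \<omega> x) sphere_base = \<mu> x"
    if "\<mu> \<in> topspace ?M" "\<omega> \<in> topspace ?\<Omega>M" "x \<in> topspace X" for \<mu> \<omega> x
    using g(2) that Mval[OF that(1,3)] LMmem[of \<omega> x] by (auto simp: loop_at_base null_map_def)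
  have g': "continuous_map ?PM ?LM g'"
    unfolding g'_def
  proof (rule continuous_loop_of_loops)
    show "continuous_map (prod_topology ?PM X) ?LY (\<lambda>z. g (fst (fst z) (snd z), loop_at (snd (fst z)) (snd z)))"
      by (rule continuous_map_comp[OF g(1)], rule pair) (intro cmap_intros)+
    fix z assume z: "z \<in> topspace ?PM"
    have "(\<lambda>x \<in> topspace X. g (fst z x, loop_at (snd z) x) sphere_base) = (\<lambda>x \<in> topspace X. fst z x)"
      by (rule restrict_ext) (use gb z in auto)
    then show "(\<lambda>x \<in> topspace X. g (fst z x, loop_at (snd z) x) sphere_base) \<in> topspace ?M"
      using z Mext[of "fst z"] by auto
  qed
  have g'b: "g' z sphere_base = fst z" if z: "z \<in> topspace ?PM" for z
  proof -
    have "g' z sphere_base = (\<lambda>x \<in> topspace X. fst z x)"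
      unfolding g'_def loop_of_loops_base by (rule restrict_ext) (use gb z in auto)
    then show ?thesis using Mext[of "fst z"] z by auto
  qed

  have "homotopic_with (\<lambda>h. \<forall>e \<in> topspace ?LM. h e sphere_base = e sphere_base) ?LM ?LM (g' \<circ> f') id"
  proof (rule homotopic_withI)
    let ?h = "\<lambda>w. loop_of_loops X (\<lambda>x. h (fst w, loop_at (snd w) x))"
    have hb: "(\<lambda>x \<in> topspace X. h (u, loop_at \<gamma> x) sphere_base) = \<gamma> sphere_base"
      if "0 \<le> u" "u \<le> 1" "\<gamma> \<in> topspace ?LM" for u \<gamma>
    proof -
      have "(\<lambda>x \<in> topspace X. h (u, loop_at \<gamma> x) sphere_base) = (\<lambda>x \<in> topspace X. \<gamma> sphere_base x)"
        by (rule restrict_ext) (use h(4) that LMmem in \<open>simp add: loop_at_base\<close>)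
      then show ?thesis using Mext[OF ev[OF that(3)]] by simp
    qed
    show "continuous_map (prod_topology unit_interval ?LM) ?LM ?h"
    proof (rule continuous_loop_of_loops)
      show "continuous_map (prod_topology (prod_topology unit_interval ?LM) X) ?LY
          (\<lambda>z. h (fst (fst z), loop_at (snd (fst z)) (snd z)))"
        by (intro continuous_map_comp[OF h(1)] continuous_map_pairedI continuous_loop_at[OF X, where ?y0.0 = y0] cmap_intros)
      show "(\<lambda>x \<in> topspace X. h (fst w, loop_at (snd w) x) sphere_base) \<in> topspace ?M"
        if "w \<in> topspace (prod_topology unit_interval ?LM)" for w
        using that hb[of "fst w" "snd w"] ev[of "snd w"] by auto
    qed
    fix \<gamma> assume \<gamma>: "\<gamma> \<in> topspace ?LM"
    show "?h (0, \<gamma>) = (g' \<circ> f') \<gamma>"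
      unfolding g'_def f'_def o_def
    proof (rule loop_of_loops_cong)
      fix x assume x: "x \<in> topspace X"
      let ?e = "loop_at \<gamma> x"
      have "f ?e \<in> topspace ?PY" by (rule continuous_map_mem[OF f(1) LMmem[OF \<gamma> x]])
      then have "snd (f ?e) \<in> topspace ?LY"
        by (intro \<Omega>Y(1)) (simp only: topspace_prod_topology mem_Times_iff)
      then have "loop_at (loop_of_loops X (\<lambda>x. snd (f (loop_at \<gamma> x)))) x = snd (f ?e)"
        by (rule loop_at_loop_of_loops[where q = "\<lambda>x. snd (f (loop_at \<gamma> x))", OF x])
      moreover have "\<gamma> sphere_base x = fst (f ?e)"
        using f(2) LMmem[OF \<gamma> x] by (simp add: loop_at_base)
      ultimately show "h (fst (0, \<gamma>), loop_at (snd (0, \<gamma>)) x) =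
        g (fst (\<gamma> sphere_base, loop_of_loops X (\<lambda>x. snd (f (loop_at \<gamma> x)))) x,
           loop_at (snd (\<gamma> sphere_base, loop_of_loops X (\<lambda>x. snd (f (loop_at \<gamma> x))))) x)"
        by (simp add: h(2))
    qed
    show "?h (1, \<gamma>) = id \<gamma>"
      using loop_of_loops_loop_at[OF \<gamma>] by (simp add: h(3))
  next
    show "\<forall>e \<in> topspace ?LM. loop_of_loops X (\<lambda>x. h (fst (u, e), loop_at (snd (u, e)) x)) sphere_base = e sphere_base"
      if u: "0 \<le> u" "u \<le> 1" for u
    proof
      fix e assume e: "e \<in> topspace ?LM"
      have "(\<lambda>x \<in> topspace X. h (u, loop_at e x) sphere_base) = e sphere_base"
      proof -
        have "(\<lambda>x \<in> topspace X. h (u, loop_at e x) sphere_base) = (\<lambda>x \<in> topspace X. e sphere_base x)"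
          by (rule restrict_ext) (use h(4) u e LMmem in \<open>simp add: loop_at_base\<close>)
        then show ?thesis using Mext[OF ev[OF e]] by simp
      qed
      then show "loop_of_loops X (\<lambda>x. h (fst (u, e), loop_at (snd (u, e)) x)) sphere_base = e sphere_base"
        by (simp add: loop_of_loops_base)
    qed
  qed auto
  moreover have "homotopic_with (\<lambda>h. \<forall>e \<in> topspace ?PM. fst (h e) = fst e) ?PM ?PM (f' \<circ> g') id"
  proof (rule homotopic_withI)
    let ?k = "\<lambda>w. (fst (snd w), loop_of_loops X (\<lambda>x. snd (k (fst w, (fst (snd w) x, loop_at (snd (snd w)) x)))))"
    let ?Z = "prod_topology (prod_topology unit_interval ?PM) X"
    show "continuous_map (prod_topology unit_interval ?PM) ?PM ?k"
    proof (intro continuous_map_pairedI into\<Omega> cmap_intros)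
      have z: "continuous_map ?Z ?PM (\<lambda>z. snd (fst z))"
        by (rule continuous_map_snd_comp[OF continuous_map_fst])
      have kz: "continuous_map ?Z ?PY (\<lambda>z. (fst (snd (fst z)) (snd z), loop_at (snd (snd (fst z))) (snd z)))"
        by (rule pair[OF continuous_map_fst_comp[OF z] continuous_map_snd_comp[OF z] continuous_map_snd])
      show "continuous_map ?Z ?PY
        (\<lambda>z. k (fst (fst z), (fst (snd (fst z)) (snd z), loop_at (snd (snd (fst z))) (snd z))))"
        by (rule continuous_map_comp[OF k(1)
            continuous_map_pairedI[OF continuous_map_fst_comp[OF continuous_map_fst] kz]])
    qed
    fix z assume z: "z \<in> topspace ?PM"
    have sz: "snd z \<in> topspace ?LM" "fst z \<in> topspace ?M" "snd z sphere_base = ?m" using z by auto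
    show "?k (0, z) = (f' \<circ> g') z"
    proof -
      have "g' z sphere_base = fst z" by (rule g'b[OF z])
      moreover have "loop_of_loops X (\<lambda>x. snd (k (0, (fst z x, loop_at (snd z) x))))
        = loop_of_loops X (\<lambda>x. snd (f (loop_at (g' z) x)))"
      proof (rule loop_of_loops_cong)
        fix x assume x: "x \<in> topspace X"
        have "(fst z x, loop_at (snd z) x) \<in> topspace ?PY"
          using x sz Mval[OF sz(2) x] LMmem[OF sz(1) x] by (auto simp: loop_at_base null_map_def)
        then have "loop_at (g' z) x = g (fst z x, loop_at (snd z) x)"
          unfolding g'_def
          by (rule loop_at_loop_of_loops[where q = "\<lambda>x. g (fst z x, loop_at (snd z) x)",
                OF x continuous_map_mem[OF g(1)]])
        then show "snd (k (0, (fst z x, loop_at (snd z) x))) = snd (f (loop_at (g' z) x))"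
          by (simp add: k(2))
      qed
      ultimately show ?thesis by (simp add: f'_def)
    qed
    show "?k (1, z) = id z"
      using loop_of_loops_loop_at[OF sz(1)] by (simp add: k(3))
  qed auto
  ultimately show ?thesis
    unfolding T_space_def fibre_homotopically_trivial_def fibre_homotopy_equivalent_def
    using f' g' f'b g'b by (intro exI[of _ f'] exI[of _ g']) auto
qed

section \<open>G-spaces\<close>

text \<open>
  The set \<open>{a}\<close> is compact, so the preimage of an open set is a member of the subbasis.  This is the
  continuity of evaluation that is available for \<open>A = map(X, Y; 0)\<close>, which is rarely locally compact.
\<close>
lemma continuous_map_eval_at:
  assumes "a \<in> topspace A"
  shows "continuous_map (mapping_space A Z) Z (\<lambda>g. g a)"
  unfolding continuous_map
proof (intro conjI allI impI)
  show "(\<lambda>g. g a) ` topspace (mapping_space A Z) \<subseteq> topspace Z"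
    using assms by (auto simp: maps_def continuous_map_def)
  fix U assume U: "openin Z U"
  have "{g \<in> topspace (mapping_space A Z). g a \<in> U} = {g \<in> maps A Z. g ` {a} \<subseteq> U}" by auto
  moreover have "openin (mapping_space A Z) {g \<in> maps A Z. g ` {a} \<subseteq> U}"
    unfolding mapping_space_def
    by (rule topology_generated_by_Basis, rule CollectI, rule exI[of _ "{a}"], rule exI[of _ U])
      (use assms U in simp)
  ultimately show "openin (mapping_space A Z) {g \<in> topspace (mapping_space A Z). g a \<in> U}" by simp
qed

lemma identity_map_in_mapping_space: "identity_map Z \<in> topspace (mapping_space Z Z)"
  by (simp add: identity_map_def restrict_in_maps continuous_map_id')

lemma continuous_aut1_eval:
  assumes "z0 \<in> topspace Z"
  shows "continuous_map (aut1 Z) Z (\<lambda>g. g z0)"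
  unfolding aut1_def by (rule continuous_map_from_subtopology[OF continuous_map_eval_at[OF assms]])

lemma based_class_eq_iff:
  assumes "f \<in> based_maps n Z z0"
  shows "based_class n Z z0 f = based_class n Z z0 g \<longleftrightarrow>
     homotopic_with (\<lambda>h. h sphere_base = z0) (nsphere n) Z g f"
proof
  assume "based_class n Z z0 f = based_class n Z z0 g"
  moreover have "f \<in> based_class n Z z0 f"
    using assms by (simp add: based_class_def based_maps_def)
  ultimately show "homotopic_with (\<lambda>h. h sphere_base = z0) (nsphere n) Z g f"
    by (simp add: based_class_def)
next
  assume "homotopic_with (\<lambda>h. h sphere_base = z0) (nsphere n) Z g f"
  then show "based_class n Z z0 f = based_class n Z z0 g"
    unfolding based_class_def
    by (intro Collect_cong iffI) (blast intro: homotopic_with_symD homotopic_with_trans)+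
qed

text \<open>
  The inclusion of the Gottlieb group in the homotopy group is automatic, and the other one unfolds to
  the right-hand side.
\<close>
lemma G_space_iff:
  assumes z0: "z0 \<in> topspace Z"
  shows "G_space Z z0 \<longleftrightarrow> onto_homotopy_groups (aut1 Z) (identity_map Z) (\<lambda>g. g z0) Z"
proof -
  let ?id = "identity_map Z"
  let ?ev = "\<lambda>g. g z0"
  have ev: "continuous_map (aut1 Z) Z ?ev" "?ev ?id = z0"
    using continuous_aut1_eval z0 by (auto simp: identity_map_def)
  have evF: "?ev \<circ> F \<in> based_maps n Z z0" if "F \<in> based_maps n (aut1 Z) ?id" for n F
    using that continuous_map_compose[of "nsphere n" "aut1 Z" F Z ?ev] ev by (simp add: based_maps_def)
  have G: "gottlieb_group n Z z0 = (\<lambda>F. based_class n Z z0 (?ev \<circ> F)) ` based_maps n (aut1 Z) ?id" for n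
    unfolding gottlieb_group_def homotopy_group_def image_image
    by (rule image_cong[OF refl]) (rule induced_map_based_class[where \<phi> = ?ev and ?w0.0 = ?id, OF ev])
  have "gottlieb_group n Z z0 \<subseteq> homotopy_group n Z z0" for n
    unfolding G homotopy_group_def using evF by blast
  then have "G_space Z z0 \<longleftrightarrow> (\<forall>n \<ge> 1. homotopy_group n Z z0 \<subseteq> gottlieb_group n Z z0)"
    unfolding G_space_def by blast
  also have "\<dots> \<longleftrightarrow> (\<forall>n \<ge> 1. \<forall>f \<in> based_maps n Z z0. \<exists>F \<in> based_maps n (aut1 Z) ?id.
      based_class n Z z0 f = based_class n Z z0 (?ev \<circ> F))"
    unfolding G homotopy_group_def by blast
  also have "\<dots> \<longleftrightarrow> onto_homotopy_groups (aut1 Z) ?id ?ev Z"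
    unfolding onto_homotopy_groups_def ev(2) by (simp add: based_class_eq_iff)
  finally show ?thesis .
qed

text \<open>
  If \<open>A\<close> lifts the adjoint of \<open>\<alpha>\<close> to \<open>aut\<^sub>1 Y\<close>, then \<open>\<Phi>(g, s)(x) = A(s, x)(g(x))\<close> defines, for each
  point \<open>s\<close> of the sphere, a self-map of the null component, which is the identity for the base point.
  Path connectedness of the sphere keeps everything in the path components of the null map and of the identity.
\<close>
theorem G_space_null_component:
  fixes X :: "'a topology" and Y :: "'b topology" and I :: "'i set"
  assumes X: "locally_compact_space X" "Hausdorff_space X" "well_pointed X x0"
    and Y: "locally_compact_space Y" "Hausdorff_space Y" and y0: "y0 \<in> topspace Y"
    and susp: "reduced_suspension X x0 homotopy_equivalent_space wedge_of_spheres I d"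
    and G: "G_space Y y0"
  shows "G_space (null_component X Y y0) (null_map X y0)"
proof -
  let ?M = "null_component X Y y0"
  let ?N = "mapping_space X Y"
  let ?m = "null_map X y0"
  let ?E = "aut1 Y"
  let ?p = "\<lambda>g. g y0"
  have m: "?m \<in> topspace ?M" by (rule null_map_in_null_component[OF y0])
  have pid: "?p (identity_map Y) = y0" using y0 by (simp add: identity_map_def)
  have onto: "onto_homotopy_groups ?E (identity_map Y) ?p Y" using G G_space_iff[OF y0] by simp
  have idE: "identity_map Y \<in> topspace ?E"
    unfolding aut1_def by (rule base_in_path_component[OF identity_map_in_mapping_space])
  have "\<exists>F \<in> based_maps n (aut1 ?M) (identity_map ?M).
      homotopic_with (\<lambda>h. h sphere_base = ?m) (nsphere n) ?M ((\<lambda>g. g ?m) \<circ> F) \<alpha>"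
    if n: "n \<ge> 1" and \<alpha>: "\<alpha> \<in> based_maps n ?M ?m" for n \<alpha>
  proof -
    let ?S = "nsphere n"
    have c\<alpha>: "continuous_map ?S ?M \<alpha>" and \<alpha>b: "\<alpha> sphere_base = ?m"
      using \<alpha> by (simp_all add: based_maps_def)
    let ?\<alpha> = "\<lambda>z. \<alpha> (fst z) (snd z)"
    have \<alpha>': "continuous_map (prod_topology ?S X) Y ?\<alpha>"
      by (rule continuous_from_null_component[OF X(1,2) continuous_map_comp[OF c\<alpha> continuous_map_fst] continuous_map_snd])
    have \<alpha>'b: "?\<alpha> (sphere_base, x) = ?p (identity_map Y)" if "x \<in> topspace X" for x
      using that pid by (simp add: \<alpha>b null_map_def)
    obtain A h where A: "continuous_map (prod_topology ?S X) ?E A"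
      "\<And>x. x \<in> topspace X \<Longrightarrow> A (sphere_base, x) = identity_map Y"
      and h: "continuous_map (prod_topology unit_interval (prod_topology ?S X)) Y h"
      "\<And>s x. s \<in> topspace ?S \<Longrightarrow> x \<in> topspace X \<Longrightarrow> h (0, (s, x)) = ?p (A (s, x))"
      "\<And>s x. s \<in> topspace ?S \<Longrightarrow> x \<in> topspace X \<Longrightarrow> h (1, (s, x)) = ?\<alpha> (s, x)"
      "\<And>u x. 0 \<le> u \<Longrightarrow> u \<le> 1 \<Longrightarrow> x \<in> topspace X \<Longrightarrow> h (u, (sphere_base, x)) = ?p (identity_map Y)"
    proof (rule lift_sphere_family[OF onto continuous_aut1_eval[OF y0] idE X susp n \<alpha>'])
      fix x assume "x \<in> topspace X"
      then show "?\<alpha> (sphere_base, x) = ?p (identity_map Y)" by (rule \<alpha>'b)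
    qed (rule that)

    define \<Phi> where "\<Phi> = (\<lambda>w. \<lambda>x \<in> topspace X. A (snd w, x) (fst w x))"
    let ?Z = "prod_topology (prod_topology ?M ?S) X"
    have "continuous_map ?Z ?E (\<lambda>z. A (snd (fst z), snd z))"
      by (intro continuous_map_comp[OF A(1)] cmap_intros)
    then have "continuous_map ?Z (mapping_space Y Y) (\<lambda>z. A (snd (fst z), snd z))"
      by (simp add: aut1_def continuous_map_in_subtopology)
    then have "continuous_map ?Z Y (\<lambda>z. A (snd (fst z), snd z) (fst (fst z) (snd z)))"
      by (rule continuous_map_uncurry[OF Y])
        (rule continuous_from_null_component[OF X(1,2) continuous_map_fst_comp[OF continuous_map_fst] continuous_map_snd])
    then have "continuous_map (prod_topology ?M ?S) ?N
        (\<lambda>w. \<lambda>x \<in> topspace X. A (snd (fst (w, x)), snd (w, x)) (fst (fst (w, x)) (snd (w, x))))"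
      by (rule continuous_map_curry)
    then have \<Phi>N: "continuous_map (prod_topology ?M ?S) ?N \<Phi>" by (simp add: \<Phi>_def)
    have \<Phi>b: "\<Phi> (g, sphere_base) = g" if g: "g \<in> topspace ?M" for g
    proof (rule extensionalityI[where A = "topspace X"])
      note gm = null_component_member[OF g]
      show "g \<in> extensional (topspace X)" by (rule mapsD(2)[OF gm])
      show "\<Phi> (g, sphere_base) x = g x" if "x \<in> topspace X" for x
        using that A(2)[OF that] continuous_map_mem[OF mapsD(1)[OF gm] that]
        by (simp add: \<Phi>_def identity_map_def)
    qed (simp add: \<Phi>_def)
    have \<Phi>: "continuous_map (prod_topology ?M ?S) ?M \<Phi>"
      unfolding null_component_def[of X Y]
    proof (rule continuous_map_into_path_component, fold null_component_def)
      show "continuous_map (prod_topology ?M ?S) ?N \<Phi>" by (rule \<Phi>N)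
      fix w assume w: "w \<in> topspace (prod_topology ?M ?S)"
      have "path_component_of (prod_topology ?M ?S) (fst w, sphere_base) w"
        using path_component_of_slice[OF n, of "snd w" "fst w" ?M] w by auto
      then show "\<exists>w0. path_component_of (prod_topology ?M ?S) w0 w \<and> \<Phi> w0 \<in> topspace ?M"
        using \<Phi>b w by fastforce
    qed
    let ?F = "\<lambda>s. \<lambda>g \<in> topspace ?M. \<Phi> (g, s)"
    have "continuous_map (prod_topology ?S ?M) ?M (\<lambda>z. \<Phi> (snd z, fst z))"
      by (intro continuous_map_comp[OF \<Phi>] cmap_intros)
    then have "continuous_map ?S (mapping_space ?M ?M) (\<lambda>s. \<lambda>g \<in> topspace ?M. \<Phi> (snd (s, g), fst (s, g)))"
      by (rule continuous_map_curry)
    then have F: "continuous_map ?S (mapping_space ?M ?M) ?F" by simp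
    have Fb: "?F sphere_base = identity_map ?M"
      using \<Phi>b by (auto simp: identity_map_def)
    have Spath: "path_component_of ?S sphere_base s" if "s \<in> topspace ?S" for s
      using nsphere_path_connected[OF n] that sphere_base_in_nsphere[of n]
      by (simp add: path_connected_space_iff_path_component)
    have "continuous_map ?S (aut1 ?M) ?F"
      unfolding aut1_def
    proof (rule continuous_map_into_path_component[OF F])
      fix s assume s: "s \<in> topspace ?S"
      have "?F sphere_base \<in> topspace (subtopology (mapping_space ?M ?M)
          (path_component_of_set (mapping_space ?M ?M) (identity_map ?M)))"
        unfolding Fb by (rule base_in_path_component[OF identity_map_in_mapping_space])
      then show "\<exists>w0. path_component_of ?S w0 s \<and> ?F w0 \<in> topspace (subtopology (mapping_space ?M ?M)
          (path_component_of_set (mapping_space ?M ?M) (identity_map ?M)))"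
        using Spath[OF s] by blast
    qed
    then have "?F \<in> based_maps n (aut1 ?M) (identity_map ?M)"
      using Fb by (simp add: based_maps_def)
    moreover have "homotopic_with (\<lambda>h. h sphere_base = ?m) ?S ?M ((\<lambda>g. g ?m) \<circ> ?F) \<alpha>"
    proof (rule homotopic_withI)
      let ?k = "\<lambda>w. \<lambda>x \<in> topspace X. h (fst w, (snd w, x))"
      have "continuous_map (prod_topology (prod_topology unit_interval ?S) X) Y
          (\<lambda>z. h (fst (fst z), (snd (fst z), snd z)))"
        by (intro continuous_map_comp[OF h(1)] cmap_intros)
      then have "continuous_map (prod_topology unit_interval ?S) ?N
          (\<lambda>w. \<lambda>x \<in> topspace X. h (fst (fst (w, x)), (snd (fst (w, x)), snd (w, x))))"
        by (rule continuous_map_curry)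
      then have k: "continuous_map (prod_topology unit_interval ?S) ?N ?k" by simp
      have kb: "?k (u, sphere_base) = ?m" if "0 \<le> u" "u \<le> 1" for u
        using h(4)[OF that] pid by (auto simp: null_map_def)
      show "continuous_map (prod_topology unit_interval ?S) ?M ?k"
        unfolding null_component_def
      proof (rule continuous_map_into_path_component[OF k], fold null_component_def)
        fix w assume w: "w \<in> topspace (prod_topology unit_interval ?S)"
        have "path_component_of (prod_topology unit_interval ?S) (fst w, sphere_base) w"
          using path_component_of_slice[OF n, of "snd w" "fst w" unit_interval] w by auto
        moreover have "?k (fst w, sphere_base) \<in> topspace ?M"
          using kb[of "fst w"] w m by auto
        ultimately show "\<exists>w0. path_component_of (prod_topology unit_interval ?S) w0 w \<and> ?k w0 \<in> topspace ?M"
          by blast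
      qed
      show "?k (0, s) = ((\<lambda>g. g ?m) \<circ> ?F) s" if "s \<in> topspace ?S" for s
        using h(2)[OF that] m by (auto simp: \<Phi>_def null_map_def restrict_def fun_eq_iff)
      show "?k (1, s) = \<alpha> s" if s: "s \<in> topspace ?S" for s
      proof (rule extensionalityI[where A = "topspace X"])
        show "\<alpha> s \<in> extensional (topspace X)"
          by (rule mapsD(2)[OF null_component_member[OF continuous_map_mem[OF c\<alpha> s]]])
      qed (use h(3)[OF s] in auto)
      show "?k (u, sphere_base) = ?m" if "0 \<le> u" "u \<le> 1" for u
        by (rule kb[OF that])
    qed (use sphere_base_in_nsphere in metis)
    ultimately show ?thesis by blast
  qed
  then have "onto_homotopy_groups (aut1 ?M) (identity_map ?M) (\<lambda>g. g ?m) ?M"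
    unfolding onto_homotopy_groups_def using m by (simp add: identity_map_def)
  then show ?thesis using G_space_iff[OF m] by simp
qed

theorem corollary5p1:
  fixes X :: "'a topology" and x0 :: 'a
    and Y :: "'b topology" and y0 :: 'b
  assumes "connected_space X" "locally_compact_space X" "Hausdorff_space X" "well_pointed X x0"
    and "connected_space Y" "locally_compact_space Y" "Hausdorff_space Y" "well_pointed Y y0"
  shows "(T_space Y y0 \<longrightarrow> T_space (null_component X Y y0) (null_map X y0)) \<and>
         (\<forall>(I :: 'i set) (d :: 'i \<Rightarrow> nat).
            reduced_suspension X x0 homotopy_equivalent_space wedge_of_spheres I d \<longrightarrow>
            G_space Y y0 \<longrightarrow> G_space (null_component X Y y0) (null_map X y0))"
proof -
  have y0: "y0 \<in> topspace Y" using assms(8) by (simp add: well_pointed_def)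
  show ?thesis
  proof (intro conjI impI allI)
    assume "T_space Y y0"
    then show "T_space (null_component X Y y0) (null_map X y0)"
      by (rule T_space_null_component[OF assms(2,3) y0])
  next
    fix I :: "'i set" and d :: "'i \<Rightarrow> nat"
    assume "reduced_suspension X x0 homotopy_equivalent_space wedge_of_spheres I d" "G_space Y y0"
    then show "G_space (null_component X Y y0) (null_map X y0)"
      by (rule G_space_null_component[OF assms(2-4,6,7) y0])
  qed
qed

end
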